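(* Let $\alpha\in(1,2)$ and let $p\ge2$ be an integer. Then $$\{n^{-\alpha}A_n^{p,\alpha}\}_n\sim_\lambda(f^{p,\alpha},[-\pi,\pi]),\qquad f^{p,\alpha}(\theta)=\sum_{l\in\mathbb Z}|\theta+2l\pi|^{\alpha}\left(\frac{\sin(\theta/2+l\pi)}{\theta/2+l\pi}\right)^{p+1}.$$
   Context: For $n\ge1$: knots $\xi_1=\dots=\xi_{p+1}=0$, $\xi_{i+p+1}=i/n$ ($i=0,\dots,n$), $\xi_{p+n+1}=\dots=\xi_{2p+n+1}=1$. B-splines: $N^0_i=\mathbf 1_{[\xi_i,\xi_{i+1})}$, $N^k_i(x)=\frac{x-\xi_i}{\xi_{i+k}-\xi_i}N^{k-1}_i(x)+\frac{\xi_{i+k+1}-x}{\xi_{i+k+1}-\xi_{i+1}}N^{k-1}_{i+1}(x)$ (zero-denominator fractions are zero). Greville abscissae $\eta_i=\frac{\xi_{i+1}+\dots+\xi_{i+p}}{p}$, $i=2,\dots,n+p-1$. On $[0,1]$: $D^\alpha_{0,x}u(x)=\frac{1}{\Gamma(2-\alpha)}\frac{d^2}{dx^2}\int_0^x(x-y)^{1-\alpha}u(y)dy$, $D^\alpha_{x,1}u(x)=\frac{1}{\Gamma(2-\alpha)}\frac{d^2}{dx^2}\int_x^1(y-x)^{1-\alpha}u(y)dy$. The B-spline collocation matrix (Greville collocation of the Riesz operator $\frac{1}{2\cos(\pi\alpha/2)}(D^\alpha_{0,x}+D^\alpha_{x,1})$ on the spline space spanned by $N^p_2,\dots,N^p_{n+p-1}$)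 is $A_n^{p,\alpha}=\frac{1}{2\cos(\pi\alpha/2)}(A_n^L+A_n^R)$ with $(A_n^L)_{i,j}=D^\alpha_{0,x}N^p_{j+1}(\eta_{i+1})$, $(A_n^R)_{i,j}=D^\alpha_{x,1}N^p_{j+1}(\eta_{i+1})$, $i,j=1,\dots,n+p-2$. A sequence $\{A_n\}_n$ of matrices of sizes $d_n$ ($d_n<d_{n+1}$) with eigenvalues $\lambda_j(A_n)$ satisfies $\{A_n\}_n\sim_\lambda(f,G)$ (for measurable $f:G\to\mathbb C$, $G\subset\mathbb R^k$ of finite positive measure $\mu_k(G)$) if for every continuous compactly supported $F:\mathbb C\to\mathbb C$, $\lim_{n\to\infty}\frac1{d_n}\sum_{j=1}^{d_n}F(\lambda_j(A_n))=\frac{1}{\mu_k(G)}\int_G F(f(t))\,dt$. *)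

theory Defs
  imports "HOL-Analysis.Analysis" "Jordan_Normal_Form.Char_Poly"
begin

text \<open>Knot vector (1-indexed, for n \<ge> 1): xi_1 = ... = xi_(p+1) = 0,
  xi_(i+p+1) = i/n for i = 0..n, xi_(p+n+1) = ... = xi_(2p+n+1) = 1.\<close>
definition knot :: "nat \<Rightarrow> nat \<Rightarrow> nat \<Rightarrow> real" where
  "knot p n j = (if j \<le> p + 1 then 0
                 else if j \<ge> p + n + 1 then 1
                 else (real j - real p - 1) / real n)"

text \<open>B-splines N^k_i via the Cox-de Boor recursion; fractions with zero
  denominator are zero (this is automatic in Isabelle since x / 0 = 0).\<close>
fun bspline :: "nat \<Rightarrow> nat \<Rightarrow> nat \<Rightarrow> nat \<Rightarrow> real \<Rightarrow> real" where
  "bspline p n 0 i x = indicator {knot p n i ..< knot p n (i+1)} x"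
| "bspline p n (Suc k) i x =
     (x - knot p n i) / (knot p n (i + Suc k) - knot p n i) * bspline p n k i x
   + (knot p n (i + Suc k + 1) - x) / (knot p n (i + Suc k + 1) - knot p n (i+1))
       * bspline p n k (i+1) x"

definition greville :: "nat \<Rightarrow> nat \<Rightarrow> nat \<Rightarrow> real" where
  "greville p n i = (\<Sum>j = i+1..i+p. knot p n j) / real p"

text \<open>Riemann-Liouville fractional derivatives of order alpha in (1,2) on [0,1].\<close>
definition RL_left :: "real \<Rightarrow> (real \<Rightarrow> real) \<Rightarrow> real \<Rightarrow> real" where
  "RL_left \<alpha> u x = 1 / Gamma (2 - \<alpha>) *
     deriv (deriv (\<lambda>t. integral {0..t} (\<lambda>y. (t - y) powr (1 - \<alpha>) * u y))) x"

definition RL_right :: "real \<Rightarrow> (real \<Rightarrow> real) \<Rightarrow> real \<Rightarrow> real" where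
  "RL_right \<alpha> u x = 1 / Gamma (2 - \<alpha>) *
     deriv (deriv (\<lambda>t. integral {t..1} (\<lambda>y. (y - t) powr (1 - \<alpha>) * u y))) x"

text \<open>The collocation matrix A_n^{p,alpha}, of size n+p-2 (0-indexed here:
  entry (i,j) corresponds to the paper's (i+1,j+1)).\<close>
definition colloc_matrix :: "nat \<Rightarrow> real \<Rightarrow> nat \<Rightarrow> real mat" where
  "colloc_matrix p \<alpha> n = mat (n + p - 2) (n + p - 2) (\<lambda>(i, j).
      1 / (2 * cos (pi * \<alpha> / 2)) *
      (RL_left \<alpha> (bspline p n p (j + 2)) (greville p n (i + 2))
     + RL_right \<alpha> (bspline p n p (j + 2)) (greville p n (i + 2))))"

definition eigvals :: "complex mat \<Rightarrow> complex multiset" where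
  "eigvals A = proots (char_poly A)"

definition spectral_distr ::
  "(nat \<Rightarrow> complex mat) \<Rightarrow> ('a::euclidean_space \<Rightarrow> complex) \<Rightarrow> 'a set \<Rightarrow> bool" where
  "spectral_distr A f G \<longleftrightarrow>
     (\<forall>n. dim_row (A n) = dim_col (A n)) \<and> strict_mono (\<lambda>n. dim_row (A n)) \<and>
     G \<in> sets lebesgue \<and> 0 < emeasure lebesgue G \<and> emeasure lebesgue G < \<infinity> \<and>
     f \<in> borel_measurable (restrict_space lebesgue G) \<and>
     (\<forall>F :: complex \<Rightarrow> complex.
        continuous_on UNIV F \<and> (\<exists>K. compact K \<and> (\<forall>z. z \<notin> K \<longrightarrow> F z = 0)) \<longrightarrow>
        (\<lambda>n. (\<Sum>z\<in>#eigvals (A n). F z) / of_nat (dim_row (A n)))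
          \<longlonglongrightarrow> (LINT t:G|lebesgue. F (f t)) / complex_of_real (measure lebesgue G))"

definition symbol_f :: "nat \<Rightarrow> real \<Rightarrow> real \<Rightarrow> real" where
  "symbol_f p \<alpha> \<theta> = (\<Sum>\<^sub>\<infinity>l::int. \<bar>\<theta> + 2 * of_int l * pi\<bar> powr \<alpha> *
      (sin (\<theta> / 2 + of_int l * pi) / (\<theta> / 2 + of_int l * pi)) ^ (p + 1))"

end

theory Submission
  imports Defs "Jordan_Normal_Form.Schur_Decomposition" "HOL-Probability.Sinc_Integral"
begin

text \<open>
  Away from the boundary the entries of \<open>n powr (- \<alpha>) \<cdot>\<^sub>m colloc_matrix p \<alpha> n\<close> depend only on \<open>i - j\<close>: they are the
  values \<open>t (i - j)\<close> at the integers of the Riesz derivative of the centred cardinal B-spline. All entries are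
  dominated by \<open>C (1 + \<bar>i - j\<bar>) powr (- 1 - \<alpha>)\<close>, uniformly in \<open>n\<close>. Products of matrices with these two properties
  have them again, with convolved symbols, so the averages of the \<open>k\<close>-th powers of the eigenvalues converge to the
  \<open>k\<close>-th moment of \<open>f = (\<Sum>m. t m cis (m \<theta>))\<close>. The matrices are not symmetric, but by Schur's inequality the average of
  \<open>(Im \<lambda>)\<^sup>2\<close> is at most \<open>(tr (A A\<^sup>*) - Re (tr (A\<^sup>2))) / (2 d)\<close>, and both traces have the same limit because \<open>t\<close> is even.
  Hence polynomials in \<open>\<lambda>\<close> suffice to approximate a continuous function of the eigenvalues.

  On the Fourier side the Riesz derivative is multiplication by \<open>\<bar>w\<bar> powr \<alpha>\<close>; for degree \<open>2\<close> this reduces to the Mellin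
  transform of \<open>sin\<close>, and the degree is raised by averaging over a unit interval. Periodizing, the symbol of the
  theorem is a continuous even function with cosine coefficients \<open>t m\<close>, hence equal to \<open>f\<close>.
\<close>

text \<open>The weight \<open>(1 + |m|) powr (- 1 - \<alpha>)\<close> is what a Riemann-Liouville
  derivative leaves behind: past the support of the spline the kernel
  \<open>(t - y) powr (1 - \<alpha>)\<close> is smooth and is differentiated twice. Summability of
  this weight carries the products of nearly Toeplitz matrices and confines all spectra to one disc.
  The obstacle is the boundary, where knots are multiple and the one-sided derivatives of the
  splines can be unbounded. The scaled collocation points keep a distance of at least
  \<open>1 / p\<close> from both ends, which saves the estimates. In the variable \<open>n x\<close>
  only finitely many shapes of boundary splines occur, independently of \<open>n\<close>, so one
  constant serves them all; right derivatives become left ones under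
  \<open>x \<mapsto> 1 - x\<close>. Degree \<open>2\<close> is the base of both inductions. It is
  the least degree for which the derivative of order \<alpha> is continuous across simple knots, and
  on the Fourier side \<open>|w| powr \<alpha> / w ^ 3\<close> has the decay exponent
  \<open>3 - \<alpha>\<close> in \<open>(1, 2)\<close>, the range in which the sine integral
  converges absolutely.\<close>

no_notation Infinite_Set_Sum.abs_summable_on (infix "abs'_summable'_on" 50)

section \<open>Schur's inequality and power sums of eigenvalues\<close>

text \<open>The square of the Frobenius norm, without a root, so that it compares linearly with
  traces and with sums of \<open>(cmod e)\<^sup>2\<close>.\<close>

definition frob :: "complex mat \<Rightarrow> real" where
  "frob A = (\<Sum>i<dim_row A. \<Sum>j<dim_col A. (cmod (A $$ (i, j)))\<^sup>2)"

text \<open>The columns of \<open>U\<close> are orthonormal, so \<open>U\<close> preserves the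
  Euclidean length of every column of \<open>B\<close>. Multiplication from the right is reduced to
  this case by transposing.\<close>

lemma frob_mult_isometry:
  assumes U: "U \<in> carrier_mat n n" and B: "B \<in> carrier_mat n m"
    and orth: "\<And>k l. k < n \<Longrightarrow> l < n \<Longrightarrow> (\<Sum>i<n. cnj (U $$ (i, k)) * U $$ (i, l)) = (if k = l then 1 else 0)"
  shows "frob (U * B) = frob B"
proof -
  have col: "(\<Sum>i<n. (cmod ((U * B) $$ (i, j)))\<^sup>2) = (\<Sum>i<n. (cmod (B $$ (i, j)))\<^sup>2)" if j: "j < m" for j
  proof -
    have "complex_of_real (\<Sum>i<n. (cmod ((U * B) $$ (i, j)))\<^sup>2)
        = (\<Sum>i<n. cnj (\<Sum>k<n. U $$ (i, k) * B $$ (k, j)) * (\<Sum>l<n. U $$ (i, l) * B $$ (l, j)))"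
      unfolding of_real_sum
    proof (intro sum.cong refl)
      fix i assume "i \<in> {..<n}"
      hence "(U * B) $$ (i, j) = (\<Sum>k<n. U $$ (i, k) * B $$ (k, j))"
        using U B j by (auto simp: times_mat_def scalar_prod_def atLeast0LessThan intro!: sum.cong)
      thus "complex_of_real ((cmod ((U * B) $$ (i, j)))\<^sup>2) =
          cnj (\<Sum>k<n. U $$ (i, k) * B $$ (k, j)) * (\<Sum>l<n. U $$ (i, l) * B $$ (l, j))"
        by (simp only: complex_norm_square mult.commute)
    qed
    also have "\<dots> = (\<Sum>i<n. \<Sum>k<n. \<Sum>l<n. (cnj (B $$ (k, j)) * B $$ (l, j)) * (cnj (U $$ (i, k)) * U $$ (i, l)))"
      unfolding cnj_sum sum_product by (intro sum.cong refl) (simp add: mult_ac)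
    also have "\<dots> = (\<Sum>k<n. \<Sum>i<n. \<Sum>l<n. (cnj (B $$ (k, j)) * B $$ (l, j)) * (cnj (U $$ (i, k)) * U $$ (i, l)))"
      by (rule sum.swap)
    also have "\<dots> = (\<Sum>k<n. \<Sum>l<n. \<Sum>i<n. (cnj (B $$ (k, j)) * B $$ (l, j)) * (cnj (U $$ (i, k)) * U $$ (i, l)))"
      by (intro sum.cong refl sum.swap)
    also have "\<dots> = (\<Sum>k<n. \<Sum>l<n. (cnj (B $$ (k, j)) * B $$ (l, j)) * (if k = l then 1 else 0))"
      by (intro sum.cong refl) (simp add: sum_distrib_left[symmetric] orth)
    also have "\<dots> = (\<Sum>k<n. cnj (B $$ (k, j)) * B $$ (k, j))"
      by (intro sum.cong refl) (simp add: if_distrib[of "\<lambda>x. _ * x"] cong: if_cong)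
    also have "\<dots> = complex_of_real (\<Sum>i<n. (cmod (B $$ (i, j)))\<^sup>2)"
      unfolding of_real_sum by (intro sum.cong refl) (simp only: complex_norm_square mult.commute)
    finally show ?thesis using of_real_eq_iff by blast
  qed
  have d: "dim_row U = n" "dim_col U = n" "dim_row B = n" "dim_col B = m" using U B by auto
  have "frob (U * B) = (\<Sum>j<m. \<Sum>i<n. (cmod ((U * B) $$ (i, j)))\<^sup>2)"
    unfolding frob_def index_mult_mat(2,3) d by (rule sum.swap)
  also have "\<dots> = (\<Sum>j<m. \<Sum>i<n. (cmod (B $$ (i, j)))\<^sup>2)" by (intro sum.cong refl col) simp
  also have "\<dots> = frob B" unfolding frob_def d by (rule sum.swap)
  finally show ?thesis .
qed

lemma frob_transpose: "frob (transpose_mat A) = frob A"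
  unfolding frob_def using sum.swap[of _ "{..<dim_row A}" "{..<dim_col A}"] by auto

text \<open>\<open>corthogonal_inv\<close> conjugates each column and divides by its squared length.
  For columns of length one the division disappears, and the inverse is the conjugate
  transpose.\<close>

lemma mat_of_cols_unitary:
  assumes ws: "set ws \<subseteq> carrier_vec n" "corthogonal ws" "length ws = n"
    and unit: "\<And>i. i < n \<Longrightarrow> (ws ! i) \<bullet>c (ws ! i) = (1::complex)"
  defines "W \<equiv> mat_of_cols n ws"
  defines "W' \<equiv> corthogonal_inv W"
  assumes k: "k < n" and l: "l < n"
  shows "(\<Sum>i<n. cnj (W $$ (i, k)) * W $$ (i, l)) = (if k = l then 1 else 0)"
    and "W' $$ (k, l) = cnj (W $$ (l, k))"
proof -
  have W: "W \<in> carrier_mat n n" unfolding W_def using ws by auto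
  have c: "ws ! i \<in> carrier_vec n" if "i < n" for i using that ws by auto
  have "(\<Sum>i<n. cnj (W $$ (i, k)) * W $$ (i, l)) = ws ! l \<bullet>c ws ! k"
    using c[OF k] c[OF l] k l ws
    by (auto simp: W_def scalar_prod_def mat_of_cols_index atLeast0LessThan mult.commute intro!: sum.cong)
  thus "(\<Sum>i<n. cnj (W $$ (i, k)) * W $$ (i, l)) = (if k = l then 1 else 0)"
    using unit[OF k] corthogonalD[OF ws(2), of l k] k l ws by auto
  have cW: "cols W = ws" unfolding W_def using ws by (intro cols_mat_of_cols) auto
  have "row W' k = vec_inv (ws ! k)"
    unfolding W'_def corthogonal_inv_def cW using W k ws c[OF k]
    by (subst mat_of_rows_row) (auto simp: cW)
  moreover have "vec_inv (ws ! k) = conjugate (ws ! k)"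
    unfolding vec_inv_def using unit[OF k] by simp
  moreover have "dim_row W' = n" "dim_col W' = n"
    unfolding W'_def corthogonal_inv_def using W cW ws by auto
  ultimately show "W' $$ (k, l) = cnj (W $$ (l, k))"
    using k l c[OF k] ws by (auto simp: row_def vec_eq_iff W_def mat_of_cols_index dest!: spec[of _ l])
qed

text \<open>Deflation by one eigenvector: a unitary change of basis that starts with the eigenvector
  keeps \<open>frob\<close>, turns the first column into \<open>(e, 0, ..., 0)\<close>, and leaves
  the other eigenvalues to the lower right block. The basis has to be orthonormal, because a general
  similarity changes \<open>frob\<close>.\<close>

lemma schur_inequality:
  assumes "A \<in> carrier_mat n n" and "char_poly A = (\<Prod>e\<leftarrow>es. [:- e, 1:])"
  shows "(\<Sum>e\<leftarrow>es. (cmod e)\<^sup>2) \<le> frob A"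
  using assms
proof (induct es arbitrary: n A)
  case Nil
  then show ?case by (simp add: frob_def sum_nonneg)
next
  case (Cons e es n A)
  let ?n1 = "n - 1"
  from Cons have A: "A \<in> carrier_mat n n" by auto
  have cp: "char_poly A = [: -e, 1 :] * (\<Prod>e \<leftarrow> es. [:- e, 1:])" using Cons(3) by auto
  have mon: "monic (\<Prod>e\<leftarrow> es. [:- e, 1:])" by (rule monic_prod_list, auto)
  have deg: "degree (char_poly A) = Suc (degree (\<Prod>e\<leftarrow> es. [:- e, 1:]))" unfolding cp
    by (subst degree_mult_eq, insert mon, auto)
  with degree_monic_char_poly[OF A] have n: "n \<noteq> 0" by auto
  have e: "eigenvalue A e" 
    unfolding eigenvalue_root_char_poly[OF A] cp by simp
  then obtain v where v: "v \<in> carrier_vec n" "v \<noteq> 0\<^sub>v n" and ev: "A *\<^sub>v v = e \<cdot>\<^sub>v v"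
    using A unfolding eigenvalue_def eigenvector_def by auto
  define b where "b = basis_completion v"
  define ws where "ws = gram_schmidt n b"
  interpret cof_vec_space n "TYPE(complex)" .
  from basis_completion[OF v, folded b_def]
  have span_b: "span (set b) = carrier_vec n" and dist_b: "distinct b" 
    and indep: "\<not> lin_dep (set b)" and b: "set b \<subseteq> carrier_vec n" and hdb: "hd b = v" 
    and len_b: "length b = n" by auto
  from hdb len_b n obtain vs where bv: "b = v # vs" by (cases b, auto)
  from gram_schmidt_result[OF b dist_b indep refl, folded ws_def]
  have ws: "set ws \<subseteq> carrier_vec n" "corthogonal ws" "length ws = n" 
    by (auto simp: len_b)
  from gram_schmidt_hd[OF v(1), of vs, folded bv] have hdws: "hd ws = v" unfolding ws_def .
  \<comment> \<open>The Gram-Schmidt vectors are orthogonal but need not have length one;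
    \<open>nr\<close> rescales them. The first vector remains an eigenvector.\<close>
  define nr where "nr = (\<lambda>w::complex vec. complex_of_real (1 / sqrt (Re (w \<bullet>c w))))"
  define us where "us = map (\<lambda>w. nr w \<cdot>\<^sub>v w) ws"
  have wsc: "ws ! i \<in> carrier_vec n" if "i < n" for i using that ws by auto
  have pos: "(ws ! i \<bullet>c ws ! i) = of_real (Re (ws ! i \<bullet>c ws ! i))" "Re (ws ! i \<bullet>c ws ! i) > 0" if i: "i < n" for i
  proof -
    have "ws ! i \<bullet>c ws ! i \<noteq> 0" using corthogonalD[OF ws(2), of i i] i ws by auto
    moreover have "ws ! i \<bullet>c ws ! i \<ge> 0" using conjugate_square_greater_0_vec conjugate_square_ge_0_vec wsc[OF i] by blast
    ultimately show "(ws ! i \<bullet>c ws ! i) = of_real (Re (ws ! i \<bullet>c ws ! i))" "Re (ws ! i \<bullet>c ws ! i) > 0"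
      by (auto simp: less_eq_complex_def complex_eq_iff)
  qed
  have nr0: "nr (ws ! i) \<noteq> 0" if "i < n" for i using pos[OF that] by (simp add: nr_def)
  have prod: "us ! i \<bullet>c us ! j = nr (ws ! i) * cnj (nr (ws ! j)) * (ws ! i \<bullet>c ws ! j)" if "i < n" "j < n" for i j
    using that wsc[OF that(1)] wsc[OF that(2)] ws
    by (simp add: us_def conjugate_smult_vec)
  have us: "set us \<subseteq> carrier_vec n" "length us = n" using ws by (auto simp: us_def)
  have uco: "corthogonal us"
    by (rule corthogonalI) (use us prod nr0 corthogonalD[OF ws(2)] ws in auto)
  have unit: "us ! i \<bullet>c us ! i = 1" if "i < n" for i
  proof -
    define r where "r = Re (ws ! i \<bullet>c ws ! i)"
    have r: "r > 0" "(ws ! i \<bullet>c ws ! i) = of_real r" using pos[OF that] by (auto simp: r_def)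
    have "us ! i \<bullet>c us ! i = of_real (1 / sqrt r * (1 / sqrt r) * r)"
      unfolding prod[OF that that] nr_def r(2) by (simp only: complex_cnj_complex_of_real of_real_mult r_def[symmetric] Re_complex_of_real)
    also have "1 / sqrt r * (1 / sqrt r) * r = 1" using r(1) by (simp add: field_simps)
    finally show ?thesis by simp
  qed
  define u where "u = hd us"
  have u_eq: "u = nr v \<cdot>\<^sub>v v" using hdws ws n by (cases ws) (auto simp: u_def us_def)
  have uc: "u \<in> carrier_vec n" using u_eq v by auto
  have nrv: "nr v \<noteq> 0" using nr0[of 0] hdws ws n by (cases ws) auto
  have u0: "u \<noteq> 0\<^sub>v n" using nrv v u_eq by (auto simp: vec_eq_iff)
  have eu: "A *\<^sub>v u = e \<cdot>\<^sub>v u" unfolding u_eq using A v ev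
    by (simp add: mult_mat_vec smult_smult_assoc mult.commute)
  define W where "W = mat_of_cols n us"
  define W' where "W' = corthogonal_inv W"
  define A' where "A' = W' * A * W"
  have orth_W: "corthogonal_mat W" using orthogonal_mat_of_cols us uco unfolding W_def by auto
  have W: "W \<in> carrier_mat n n"
    using us unfolding W_def by auto
  have W': "W' \<in> carrier_mat n n" unfolding W'_def corthogonal_inv_def using W 
    by (auto simp: mat_of_rows_def)  
  from corthogonal_inv_result[OF orth_W] have W'W: "W' * W = 1\<^sub>m n"
    unfolding W'_def[symmetric] inverts_mat_def using W' by auto
  hence WW': "W * W' = 1\<^sub>m n" using mat_mult_left_right_inverse[OF W' W] by auto
  note un = mat_of_cols_unitary[OF us(1) uco us(2) unit, folded W_def, folded W'_def]
  have A': "A' \<in> carrier_mat n n" using W W' A unfolding A'_def by auto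
  have "similar_mat_wit A' A W' W"
    by (rule similar_mat_witI[of _ _ n], insert W W' A A' W'W WW', auto simp: A'_def)
  hence A'A: "similar_mat A' A" unfolding similar_mat_def by blast
  let ?f = "(\<lambda> i. if i = 0 then e else 0)"
  have col0: "col A' 0 = vec n ?f"
    unfolding A'_def W'_def W_def
    by (rule corthogonal_col_ev_0[OF A uc u0 eu n _ us(1) uco us(2)]) (simp add: u_def)
  \<comment> \<open>The columns of \<open>W'\<close> are the conjugated rows of \<open>W\<close>, so
    their orthonormality is the identity \<open>WW'\<close>, the product in the order opposite to
    the one that \<open>corthogonal_inv_result\<close> gives.\<close>
  have orth2: "(\<Sum>i<n. cnj (W' $$ (i, k)) * W' $$ (i, l)) = (if k = l then 1 else 0)"
    if kl: "k < n" "l < n" for k l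
  proof -
    have "(\<Sum>i<n. cnj (W' $$ (i, k)) * W' $$ (i, l)) = (W * W') $$ (k, l)"
      using kl W W' by (auto simp: times_mat_def scalar_prod_def atLeast0LessThan un intro!: sum.cong)
    thus ?thesis using kl by (simp add: WW')
  qed
  have orth3: "(\<Sum>i<n. cnj (W\<^sup>T $$ (i, k)) * W\<^sup>T $$ (i, l)) = (if k = l then 1 else 0)"
    if kl: "k < n" "l < n" for k l
  proof -
    have "(\<Sum>i<n. cnj (W\<^sup>T $$ (i, k)) * W\<^sup>T $$ (i, l)) = (W * W') $$ (l, k)"
      using kl W W' by (auto simp: times_mat_def scalar_prod_def atLeast0LessThan un mult.commute intro!: sum.cong)
    thus ?thesis using kl by (simp add: WW')
  qed
  have "frob A' = frob (W\<^sup>T * (W' * A)\<^sup>T)"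
    unfolding A'_def using W' A W by (subst frob_transpose[symmetric], subst transpose_mult[of _ n n _ n]) auto
  also have "\<dots> = frob ((W' * A)\<^sup>T)"
    using W W' A by (intro frob_mult_isometry[of _ n _ n] orth3) auto
  also have "\<dots> = frob A"
    unfolding frob_transpose using W' A by (intro frob_mult_isometry[of _ n _ n] orth2) auto
  finally have frA: "frob A' = frob A" .
  obtain A1 A2 A0 A3 where splitA': "split_block A' 1 1 = (A1,A2,A0,A3)"
    by (cases "split_block A' 1 1", auto)
  from A' n have "dim_row A' = 1 + ?n1" "dim_col A' = 1 + ?n1" by auto
  from split_block[OF splitA' this] have A2: "A2 \<in> carrier_mat 1 ?n1"
    and A3: "A3 \<in> carrier_mat ?n1 ?n1" 
    and A'block: "A' = four_block_mat A1 A2 A0 A3" by auto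
  have A1id: "A1 = mat 1 1 (\<lambda> _. e)"
    using splitA'[unfolded split_block_def Let_def] arg_cong[OF col0, of "\<lambda> v. vec_index v 0"] A' n
    by (auto simp: col_def)
  have A1: "A1 \<in> carrier_mat 1 1" unfolding A1id by auto
  have A'0: "A' $$ (Suc i, 0) = 0" if "i < ?n1" for i
    using that arg_cong[OF col0, of "\<lambda> v. vec_index v (Suc i)"] A' by auto
  have A0id: "A0 = 0\<^sub>m ?n1 1"
    using splitA'[unfolded split_block_def Let_def] A'0 A' by auto
  from cp char_poly_similar[OF A'A]
  have cp: "char_poly A' = [: -e,1 :] * (\<Prod> e \<leftarrow> es. [:- e, 1:])" by simp
  also have "char_poly A' = char_poly A1 * char_poly A3" 
    unfolding A'block A0id
    by (rule char_poly_four_block_zeros_col[OF A1 A2 A3])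
  also have "char_poly A1 = [: -e,1 :]"
    by (simp add: A1id char_poly_defs det_def sign_def)
  finally have cp3: "char_poly A3 = (\<Prod> e \<leftarrow> es. [:- e, 1:])"
    by (metis mult_cancel_left pCons_eq_0_iff zero_neq_one)
  have IH: "(\<Sum>e\<leftarrow>es. (cmod e)\<^sup>2) \<le> frob A3" by (rule Cons(1)[OF A3 cp3])
  have A3e: "A3 $$ (i, j) = A' $$ (Suc i, Suc j)" "A' $$ (0, 0) = e" if "i < ?n1" "j < ?n1" for i j
    using splitA'[unfolded split_block_def Let_def] that A' n arg_cong[OF col0, of "\<lambda> v. vec_index v 0"]
    by auto
  have e00: "A' $$ (0, 0) = e" using A' n arg_cong[OF col0, of "\<lambda> v. vec_index v 0"] by auto
  have nS: "n = Suc ?n1" using n by auto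
  have "frob A' = (\<Sum>i<Suc ?n1. \<Sum>j<Suc ?n1. (cmod (A' $$ (i, j)))\<^sup>2)"
    unfolding frob_def using A' nS by auto
  \<comment> \<open>The source of the inequality: the entries of the first row to the right of
    \<open>e\<close> are dropped.\<close>
  also have "\<dots> \<ge> (cmod e)\<^sup>2 + (\<Sum>i<?n1. \<Sum>j<?n1. (cmod (A' $$ (Suc i, Suc j)))\<^sup>2)"
    unfolding sum.lessThan_Suc_shift
    by (intro add_mono) (auto simp: e00 sum.distrib sum_nonneg)
  also have "(\<Sum>i<?n1. \<Sum>j<?n1. (cmod (A' $$ (Suc i, Suc j)))\<^sup>2) = frob A3"
    unfolding frob_def using A3 A3e by (auto intro!: sum.cong)
  finally show ?case using IH frA by simp
qed


section \<open>Power sums of eigenvalues as traces, and a bound by row sums\<close>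

definition tr :: "complex mat \<Rightarrow> complex" where
  "tr A = (\<Sum>i<dim_row A. A $$ (i, i))"

lemma tr_mult_commute:
  assumes "A \<in> carrier_mat n m" "B \<in> carrier_mat m n"
  shows "tr (A * B) = tr (B * A)"
proof -
  have "tr (A * B) = (\<Sum>i<n. \<Sum>k<m. A $$ (i, k) * B $$ (k, i))"
    using assms by (auto simp: tr_def times_mat_def scalar_prod_def atLeast0LessThan intro!: sum.cong)
  also have "\<dots> = (\<Sum>k<m. \<Sum>i<n. A $$ (i, k) * B $$ (k, i))" by (rule sum.swap)
  also have "\<dots> = tr (B * A)"
    using assms by (auto simp: tr_def times_mat_def scalar_prod_def atLeast0LessThan mult.commute intro!: sum.cong)
  finally show ?thesis .
qed

lemma upper_triangular_mult:
  fixes A B :: "'a::comm_ring_1 mat"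
  assumes A: "A \<in> carrier_mat n n" "upper_triangular A" and B: "B \<in> carrier_mat n n" "upper_triangular B"
  shows "upper_triangular (A * B)" and "i < n \<Longrightarrow> (A * B) $$ (i, i) = A $$ (i, i) * B $$ (i, i)"
proof -
  have e: "(A * B) $$ (i, j) = (\<Sum>k<n. A $$ (i, k) * B $$ (k, j))" if "i < n" "j < n" for i j
    using that A B by (auto simp: times_mat_def scalar_prod_def atLeast0LessThan intro!: sum.cong)
  have z: "A $$ (i, j) = 0" "B $$ (i, j) = 0" if "j < i" "i < n" for i j
    using that A B by auto
  show "upper_triangular (A * B)"
  proof (rule upper_triangularI)
    fix i j assume ij: "j < i" "i < dim_row (A * B)"
    hence "(A * B) $$ (i, j) = (\<Sum>k<n. A $$ (i, k) * B $$ (k, j))" using A by (intro e) auto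
    also have "\<dots> = 0"
    proof (intro sum.neutral ballI)
      fix k assume "k \<in> {..<n}"
      thus "A $$ (i, k) * B $$ (k, j) = 0" using z[of k i] z[of j k] ij A by (cases "k < i") auto
    qed
    finally show "(A * B) $$ (i, j) = 0" .
  qed
  assume i: "i < n"
  have "(A * B) $$ (i, i) = (\<Sum>k<n. A $$ (i, k) * B $$ (k, i))" using i by (intro e)
  also have "\<dots> = (\<Sum>k\<in>{i}. A $$ (i, k) * B $$ (k, i))"
  proof (intro sum.mono_neutral_right ballI)
    fix k assume "k \<in> {..<n} - {i}"
    thus "A $$ (i, k) * B $$ (k, i) = 0" using z[of k i] z[of i k] i by (cases "k < i") auto
  qed (use i in auto)
  finally show "(A * B) $$ (i, i) = A $$ (i, i) * B $$ (i, i)" by simp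
qed

lemma upper_triangular_pow:
  fixes A :: "'a::comm_ring_1 mat"
  assumes A: "A \<in> carrier_mat n n" "upper_triangular A"
  shows "upper_triangular (A ^\<^sub>m k) \<and> (\<forall>i<n. (A ^\<^sub>m k) $$ (i, i) = (A $$ (i, i)) ^ k)"
proof (induct k)
  case 0
  then show ?case using A by auto
next
  case (Suc k)
  thus ?case using upper_triangular_mult[of "A ^\<^sub>m k" n A] A by (auto simp: mult.commute)
qed

text \<open>One list \<open>es\<close> of roots serves the first three claims: it factorizes the
  characteristic polynomial, it enumerates \<open>eigvals A\<close>, and it can be prescribed as the
  diagonal of a Schur form, whose powers are triangular with diagonal entries
  \<open>e ^ k\<close>.\<close>

lemma eigvals_mat:
  assumes A: "A \<in> carrier_mat n n"
  shows "size (eigvals A) = n" 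
    and "(\<Sum>z\<in>#eigvals A. z ^ k) = tr (A ^\<^sub>m k)"
    and "(\<Sum>z\<in>#eigvals A. (cmod z)\<^sup>2) \<le> frob A"
    and "z \<in># eigvals A \<Longrightarrow> eigenvalue A z"
proof -
  obtain es where es: "char_poly A = (\<Prod>e\<leftarrow>es. [:- e, 1:])" "length es = n"
    using char_poly_factorized[OF A] by auto
  have ev: "eigvals A = mset es"
  proof -
    have *: "proots (\<Prod>e\<leftarrow>xs. [:- e, 1:]) = mset xs" for xs :: "complex list"
    proof (induct xs)
      case (Cons x xs)
      have "(\<Prod>e\<leftarrow>xs. [:- e, 1:]) \<noteq> 0" by (auto simp: prod_list_zero_iff)
      thus ?case using Cons by (simp add: proots_mult del: mult_pCons_left)
    qed simp
    show ?thesis unfolding eigvals_def es * ..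
  qed
  show "size (eigvals A) = n" using ev es by simp
  show "(\<Sum>z\<in>#eigvals A. (cmod z)\<^sup>2) \<le> frob A"
    using schur_inequality[OF A es(1)]
    unfolding ev by (simp add: sum_mset_sum_list flip: mset_map)
  show "eigenvalue A z" if "z \<in># eigvals A"
  proof -
    have "char_poly A \<noteq> 0" using degree_monic_char_poly[OF A] by auto
    thus ?thesis using that unfolding eigvals_def eigenvalue_root_char_poly[OF A] by simp
  qed
  obtain B P Q where B: "schur_decomposition A es = (B, P, Q)" by (cases "schur_decomposition A es") auto
  from schur_decomposition[OF A es(1) B] have sim: "similar_mat_wit A B P Q"
    and ut: "upper_triangular B" and dg: "diag_mat B = es" by auto
  note w = similar_mat_witD2[OF A sim]
  have Bk: "B ^\<^sub>m k \<in> carrier_mat n n" using w(5) by simp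
  have "A ^\<^sub>m k = P * (B ^\<^sub>m k * Q)"
    using similar_mat_witD2(3)[OF _ similar_mat_wit_pow[OF sim, of k], of n n] A w Bk
    by (metis assoc_mult_mat pow_carrier_mat)
  hence "tr (A ^\<^sub>m k) = tr (P * (B ^\<^sub>m k * Q))" by (simp only:)
  also have "\<dots> = tr ((B ^\<^sub>m k * Q) * P)"
    by (rule tr_mult_commute[OF w(6)]) (use w(7) Bk in simp)
  also have "(B ^\<^sub>m k * Q) * P = B ^\<^sub>m k"
    by (simp only: assoc_mult_mat[OF Bk w(7) w(6)] w(2) right_mult_one_mat[OF Bk])
  also have "tr (B ^\<^sub>m k) = (\<Sum>i<n. (B $$ (i, i)) ^ k)"
    unfolding tr_def using upper_triangular_pow[OF w(5) ut, of k] w(5) by auto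
  also have "\<dots> = (\<Sum>z\<leftarrow>es. z ^ k)"
    unfolding dg[symmetric] diag_mat_def using w(5) 
    by (simp add: sum_list_sum_nth atLeast0LessThan)
  finally show "(\<Sum>z\<in>#eigvals A. z ^ k) = tr (A ^\<^sub>m k)"
    unfolding ev by (simp add: sum_mset_sum_list flip: mset_map)
qed

text \<open>Read the eigenvalue equation in a coordinate where the eigenvector has maximal modulus.
  Row sums suit the application: if the entries are dominated by \<open>g (i - j)\<close>, they are
  at most the total sum of \<open>g\<close>, whatever the size of the matrix.\<close>

lemma eigenvalue_le_row_sum:
  fixes A :: "complex mat"
  assumes A: "A \<in> carrier_mat n n" and r: "\<And>i. i < n \<Longrightarrow> (\<Sum>j<n. cmod (A $$ (i, j))) \<le> C"
    and z: "eigenvalue A z"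
  shows "cmod z \<le> C"
proof -
  obtain v where v: "v \<in> carrier_vec n" "v \<noteq> 0\<^sub>v n" "A *\<^sub>v v = z \<cdot>\<^sub>v v"
    using z A unfolding eigenvalue_def eigenvector_def by auto
  obtain i0 where i0: "i0 < n" "vec_index v i0 \<noteq> 0"
    using v(1,2) by (auto simp: vec_eq_iff)
  define m where "m = Max ((\<lambda>i. cmod (vec_index v i)) ` {..<n})"
  have mle: "cmod (vec_index v i) \<le> m" if "i < n" for i
    unfolding m_def using that by (intro Max_ge) auto
  have "m \<in> (\<lambda>i. cmod (vec_index v i)) ` {..<n}" unfolding m_def using i0 by (intro Max_in) auto
  then obtain i where i: "i < n" "cmod (vec_index v i) = m" by auto
  have m0: "m > 0" using mle[OF i0(1)] i0(2) by (smt (verit) zero_less_norm_iff)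
  have "z * vec_index v i = (\<Sum>j<n. A $$ (i, j) * vec_index v j)"
  proof -
    have "vec_index (A *\<^sub>v v) i = (\<Sum>j<n. A $$ (i, j) * vec_index v j)"
      using A v(1) i(1) by (auto simp: scalar_prod_def atLeast0LessThan intro!: sum.cong)
    thus ?thesis using v i by simp
  qed
  hence "cmod z * m = cmod (\<Sum>j<n. A $$ (i, j) * vec_index v j)" using i(2) by (metis norm_mult)
  also have "\<dots> \<le> (\<Sum>j<n. cmod (A $$ (i, j)) * m)"
    by (intro sum_norm_le) (auto simp: norm_mult intro!: mult_left_mono mle)
  also have "\<dots> = (\<Sum>j<n. cmod (A $$ (i, j))) * m" by (simp add: sum_distrib_right)
  also have "\<dots> \<le> C * m" using r[OF i(1)] m0 by (intro mult_right_mono) auto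
  finally show ?thesis using m0 by simp
qed

section \<open>Fourier series and nearly Toeplitz matrices\<close>

definition conv :: "(int \<Rightarrow> 'a::{real_normed_field,banach}) \<Rightarrow> (int \<Rightarrow> 'a) \<Rightarrow> int \<Rightarrow> 'a" where
  "conv s t m = (\<Sum>\<^sub>\<infinity>k. s k * t (m - k))"

definition fourier :: "(int \<Rightarrow> complex) \<Rightarrow> real \<Rightarrow> complex" where
  "fourier t \<theta> = (\<Sum>\<^sub>\<infinity>m. t m * cis (of_int m * \<theta>))"

lemma summable_shift_int:
  fixes f :: "int \<Rightarrow> 'a::{topological_comm_monoid_add}"
  assumes "f summable_on UNIV"
  shows "(\<lambda>k. f (c + k)) summable_on UNIV" "(\<lambda>k. f (c - k)) summable_on UNIV"
proof -
  have b: "bij (\<lambda>k. c + k)" by (rule bij_betw_byWitness[where f'="\<lambda>k. k - c"]) auto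
  show "(\<lambda>k. f (c + k)) summable_on UNIV"
    using summable_on_reindex_bij_betw[OF b, of f] assms by simp
  have b: "bij (\<lambda>k. c - k)" by (rule bij_betw_byWitness[where f'="\<lambda>k. c - k"]) auto
  show "(\<lambda>k. f (c - k)) summable_on UNIV"
    using summable_on_reindex_bij_betw[OF b, of f] assms by simp
qed

lemma infsum_shift_int:
  fixes f :: "int \<Rightarrow> 'a::{topological_comm_monoid_add, t2_space}"
  shows "(\<Sum>\<^sub>\<infinity>k. f (c + k)) = (\<Sum>\<^sub>\<infinity>k. f k)" "(\<Sum>\<^sub>\<infinity>k. f (c - k)) = (\<Sum>\<^sub>\<infinity>k. f k)"
proof -
  have b: "bij (\<lambda>k. c + k)" by (rule bij_betw_byWitness[where f'="\<lambda>k. k - c"]) auto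
  show "(\<Sum>\<^sub>\<infinity>k. f (c + k)) = (\<Sum>\<^sub>\<infinity>k. f k)"
    using infsum_reindex_bij_betw[OF b, of f] by simp
  have b: "bij (\<lambda>k. c - k)" by (rule bij_betw_byWitness[where f'="\<lambda>k. c - k"]) auto
  show "(\<Sum>\<^sub>\<infinity>k. f (c - k)) = (\<Sum>\<^sub>\<infinity>k. f k)"
    using infsum_reindex_bij_betw[OF b, of f] by simp
qed

lemma abs_summable_times:
  fixes f :: "'a \<Rightarrow> 'c::{real_normed_algebra,banach}" and g :: "'b \<Rightarrow> 'c"
  assumes f: "f abs_summable_on A" and g: "g abs_summable_on B"
  shows "(\<lambda>(x, y). f x * g y) abs_summable_on A \<times> B"
proof -
  have "(\<lambda>(x, y). norm (f x) * norm (g y)) summable_on A \<times> B"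
    by (rule summable_on_SigmaI[where g="\<lambda>x. norm (f x) * (\<Sum>\<^sub>\<infinity>y\<in>B. norm (g y))"])
       (use f g in \<open>auto intro!: has_sum_cmult_right has_sum_infsum summable_on_cmult_left\<close>)
  thus ?thesis
    by (rule summable_on_comparison_test) (auto intro: norm_mult_ineq)
qed

text \<open>The bijection \<open>(m, k) \<mapsto> (k, m - k)\<close> turns this double family into a
  product family; the other two claims are its sections and its marginal.\<close>

lemma conv_abs_summable:
  fixes s t :: "int \<Rightarrow> 'a::{real_normed_field,banach}"
  assumes s: "s abs_summable_on UNIV" and t: "t abs_summable_on UNIV"
  shows "(\<lambda>(m, k). s k * t (m - k)) abs_summable_on UNIV \<times> UNIV"
    and "(\<lambda>k. s k * t (m - k)) abs_summable_on UNIV"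
    and "conv s t abs_summable_on UNIV"
proof -
  have b: "bij_betw (\<lambda>(m::int, k::int). (k, m - k)) (UNIV \<times> UNIV) (UNIV \<times> UNIV)"
    by (rule bij_betw_byWitness[where f'="\<lambda>(k, l). (k + l, k)"]) auto
  show 1: "(\<lambda>(m, k). s k * t (m - k)) abs_summable_on UNIV \<times> UNIV"
    using summable_on_reindex_bij_betw[OF b, of "\<lambda>x. norm ((\<lambda>(x, y). s x * t y) x)"]
      abs_summable_times[OF s t] by (simp add: case_prod_unfold)
  have *: "(\<lambda>k. s k * t (m - k)) abs_summable_on UNIV" for m
    using 1 unfolding Infinite_Sum.abs_summable_on_Sigma_iff by simp
  show "(\<lambda>k. s k * t (m - k)) abs_summable_on UNIV" by (rule *)
  have "(\<lambda>m. \<Sum>\<^sub>\<infinity>k. norm (s k * t (m - k))) summable_on UNIV"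
    using 1 unfolding Infinite_Sum.abs_summable_on_Sigma_iff by (simp add: abs_of_nonneg infsum_nonneg)
  thus "conv s t abs_summable_on UNIV"
    by (rule summable_on_comparison_test) (auto simp: conv_def intro!: norm_infsum_bound *)
qed

lemma fourier_summable:
  assumes "t abs_summable_on UNIV"
  shows "(\<lambda>m. t m * cis (of_int m * \<theta>)) abs_summable_on UNIV"
  using assms by (simp add: norm_mult)

lemma fourier_conv:
  assumes s: "s abs_summable_on UNIV" and t: "t abs_summable_on UNIV"
  shows "fourier (conv s t) \<theta> = fourier s \<theta> * fourier t \<theta>"
proof -
  let ?s = "\<lambda>m. s m * cis (of_int m * \<theta>)" and ?t = "\<lambda>m. t m * cis (of_int m * \<theta>)"
  note st = fourier_summable[OF s, of \<theta>] fourier_summable[OF t, of \<theta>]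
  have "fourier (conv s t) \<theta> = (\<Sum>\<^sub>\<infinity>m. \<Sum>\<^sub>\<infinity>k. ?s k * ?t (m - k))"
    unfolding fourier_def conv_def
    by (intro infsum_cong, subst infsum_cmult_left'[symmetric])
       (auto intro!: infsum_cong simp: cis_mult algebra_simps)
  also have "\<dots> = (\<Sum>\<^sub>\<infinity>k. \<Sum>\<^sub>\<infinity>m. ?s k * ?t (m - k))"
    by (rule infsum_swap_banach) (use conv_abs_summable(1)[OF st] abs_summable_summable in fastforce)
  also have "\<dots> = (\<Sum>\<^sub>\<infinity>k. ?s k * (\<Sum>\<^sub>\<infinity>m. ?t m))"
    by (intro infsum_cong, subst infsum_cmult_right'[symmetric])
       (use infsum_shift_int(1)[of "\<lambda>m. _ * ?t m" "- _"] in simp)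
  also have "\<dots> = fourier s \<theta> * fourier t \<theta>"
    unfolding fourier_def by (rule infsum_cmult_left')
  finally show ?thesis .
qed

lemma fourier_real:
  assumes t: "\<And>m. t (- m) = cnj (t m)"
  shows "Im (fourier t \<theta>) = 0"
proof -
  have "cnj (fourier t \<theta>) = (\<Sum>\<^sub>\<infinity>m. t (0 - m) * cis (of_int (0 - m) * \<theta>))"
    unfolding fourier_def infsum_cnj[symmetric] by (intro infsum_cong) (simp add: t cis_cnj)
  also have "\<dots> = fourier t \<theta>"
    unfolding fourier_def by (rule infsum_shift_int(2)[of "\<lambda>m. t m * cis (of_int m * \<theta>)" 0])
  finally show ?thesis by (simp add: complex_eq_iff)
qed

lemma fourier_even:
  assumes t: "\<And>m. t (- m) = t m"
  shows "fourier t (- \<theta>) = fourier t \<theta>"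
proof -
  have "fourier t (- \<theta>) = (\<Sum>\<^sub>\<infinity>m. t (0 - m) * cis (of_int (0 - m) * \<theta>))"
    unfolding fourier_def by (intro infsum_cong) (simp add: t)
  also have "\<dots> = fourier t \<theta>"
    unfolding fourier_def by (rule infsum_shift_int(2)[of "\<lambda>m. t m * cis (of_int m * \<theta>)" 0])
  finally show ?thesis .
qed

text \<open>Symmetric intervals exhaust the integers. This links unordered sums to limits of
  sequences.\<close>

lemma sum_int_tendsto_infsum:
  fixes f :: "int \<Rightarrow> 'a::{real_normed_vector}"
  assumes "f summable_on UNIV"
  shows "(\<lambda>N. \<Sum>m\<in>{-int N..int N}. f m) \<longlonglongrightarrow> (\<Sum>\<^sub>\<infinity>m. f m)"
proof -
  have "(f has_sum (\<Sum>\<^sub>\<infinity>m. f m)) UNIV" using assms by (rule has_sum_infsum)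
  hence "(sum f \<longlongrightarrow> (\<Sum>\<^sub>\<infinity>m. f m)) (finite_subsets_at_top UNIV)" by (simp add: has_sum_def)
  moreover have "filterlim (\<lambda>N. {-int N..int N}) (finite_subsets_at_top UNIV) sequentially"
    unfolding filterlim_finite_subsets_at_top
  proof (intro allI impI)
    fix X :: "int set" assume X: "finite X \<and> X \<subseteq> UNIV"
    have "\<forall>\<^sub>F N in sequentially. \<forall>x\<in>X. x \<in> {-int N..int N}"
    proof (rule eventually_ball_finite)
      show "\<forall>x\<in>X. \<forall>\<^sub>F N in sequentially. x \<in> {-int N..int N}"
        proof
        fix x
        show "\<forall>\<^sub>F N in sequentially. x \<in> {-int N..int N}"
          using eventually_ge_at_top[of "nat \<bar>x\<bar>"] by eventually_elim auto
      qed
    qed (use X in auto)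
    thus "\<forall>\<^sub>F N in sequentially. finite {-int N..int N} \<and> X \<subseteq> {-int N..int N} \<and> {-int N..int N} \<subseteq> UNIV"
      by eventually_elim auto
  qed
  ultimately show ?thesis by (rule filterlim_compose)
qed

text \<open>The Weierstrass test for unordered sums: the remainder outside a symmetric interval is
  bounded by the corresponding tail of \<open>M\<close>, uniformly in \<open>x\<close>.\<close>

lemma uniform_limit_infsum_int:
  fixes f :: "int \<Rightarrow> 'a \<Rightarrow> 'b::banach"
  assumes M: "M summable_on UNIV" and le: "\<And>m x. x \<in> S \<Longrightarrow> norm (f m x) \<le> M m"
  shows "uniform_limit S (\<lambda>N x. \<Sum>m\<in>{-int N..int N}. f m x) (\<lambda>x. \<Sum>\<^sub>\<infinity>m. f m x) sequentially"
proof (rule uniform_limitI)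
  fix e :: real assume e: "e > 0"
  have "(\<lambda>N. \<Sum>m\<in>{-int N..int N}. M m) \<longlonglongrightarrow> (\<Sum>\<^sub>\<infinity>m. M m)" by (rule sum_int_tendsto_infsum[OF M])
  hence "\<forall>\<^sub>F N in sequentially. dist (\<Sum>m\<in>{-int N..int N}. M m) (\<Sum>\<^sub>\<infinity>m. M m) < e" using e by (rule tendstoD)
  thus "\<forall>\<^sub>F N in sequentially. \<forall>x\<in>S. dist (\<Sum>m\<in>{-int N..int N}. f m x) (\<Sum>\<^sub>\<infinity>m. f m x) < e"
  proof eventually_elim
    case (elim N)
    show ?case
    proof
      fix x assume x: "x \<in> S"
      let ?I = "{-int N..int N}"
      have ab: "(\<lambda>m. f m x) abs_summable_on A" for A
        by (rule summable_on_comparison_test[OF summable_on_subset_banach[OF M]]) (auto intro: le x)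
      have M': "M summable_on A" for A using summable_on_subset_banach[OF M] by auto
      have split: "(\<Sum>\<^sub>\<infinity>m. g m) = (\<Sum>m\<in>?I. g m) + (\<Sum>\<^sub>\<infinity>m\<in>-?I. g m)"
        if "g summable_on UNIV" for g :: "int \<Rightarrow> 'c::banach"
        using infsum_Un_disjoint[of g ?I "-?I"] summable_on_subset_banach[OF that] by simp
      have "norm ((\<Sum>\<^sub>\<infinity>m. f m x) - (\<Sum>m\<in>?I. f m x)) = norm (\<Sum>\<^sub>\<infinity>m\<in>-?I. f m x)"
        by (subst split) (auto intro: abs_summable_summable ab)
      also have "\<dots> \<le> (\<Sum>\<^sub>\<infinity>m\<in>-?I. norm (f m x))" by (rule norm_infsum_bound[OF ab])
      also have "\<dots> \<le> (\<Sum>\<^sub>\<infinity>m\<in>-?I. M m)" by (intro infsum_mono ab M' le x)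
      also have "\<dots> = (\<Sum>\<^sub>\<infinity>m. M m) - (\<Sum>m\<in>?I. M m)" by (subst split[OF M]) simp
      also have "\<dots> < e" using elim by (simp add: dist_real_def)
      finally show "dist (\<Sum>m\<in>?I. f m x) (\<Sum>\<^sub>\<infinity>m. f m x) < e"
        by (simp add: dist_norm norm_minus_commute)
    qed
  qed
qed

lemma continuous_on_infsum_int:
  fixes f :: "int \<Rightarrow> 'a::topological_space \<Rightarrow> 'b::banach"
  assumes M: "M summable_on UNIV" and le: "\<And>m x. x \<in> S \<Longrightarrow> norm (f m x) \<le> M m"
    and c: "\<And>m. continuous_on S (f m)"
  shows "continuous_on S (\<lambda>x. \<Sum>\<^sub>\<infinity>m. f m x)"
  by (rule uniform_limit_theorem[OF _ uniform_limit_infsum_int[OF M le]])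
     (auto intro!: always_eventually continuous_on_sum c)

text \<open>Stated with symmetric partial sums rather than with an infinite sum of integrals,
  because in \<open>integral_symbol_f_cos\<close> these partial sums are integrals over one growing
  interval.\<close>

lemma integral_infsum_int:
  fixes f :: "int \<Rightarrow> real \<Rightarrow> 'b::euclidean_space"
  assumes M: "M summable_on UNIV" and le: "\<And>m x. x \<in> {a..b} \<Longrightarrow> norm (f m x) \<le> M m"
    and c: "\<And>m. continuous_on {a..b} (f m)"
  shows "(\<lambda>N. \<Sum>m\<in>{-int N..int N}. integral {a..b} (f m)) \<longlonglongrightarrow> integral {a..b} (\<lambda>x. \<Sum>\<^sub>\<infinity>m. f m x)"
proof -
  obtain I J where IJ: "\<And>N. ((\<lambda>x. \<Sum>m\<in>{-int N..int N}. f m x) has_integral I N) {a..b}"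
    "((\<lambda>x. \<Sum>\<^sub>\<infinity>m. f m x) has_integral J) {a..b}" "I \<longlonglongrightarrow> J"
    by (rule uniform_limit_integral[OF uniform_limit_infsum_int[OF M le]])
       (auto intro!: always_eventually continuous_on_sum c)
  have "I = (\<lambda>N. \<Sum>m\<in>{-int N..int N}. integral {a..b} (f m))"
  proof
    fix N
    have "I N = integral {a..b} (\<lambda>x. \<Sum>m\<in>{-int N..int N}. f m x)"
      using IJ(1)[of N] by (simp add: integral_unique)
    also have "\<dots> = (\<Sum>m\<in>{-int N..int N}. integral {a..b} (f m))"
      by (rule integral_sum) (auto intro!: integrable_continuous_real c)
    finally show "I N = (\<Sum>m\<in>{-int N..int N}. integral {a..b} (f m))" .
  qed
  with IJ(2,3) show ?thesis by (simp add: integral_unique)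
qed

lemma integral_cis:
  "integral {-pi..pi} (\<lambda>\<theta>. cis (of_int m * \<theta>)) = (if m = 0 then of_real (2 * pi) else 0)"
proof (cases "m = 0")
  case False
  have "((\<lambda>\<theta>. cis (of_int m * \<theta>)) has_integral
      (cis (of_int m * pi) / (\<i> * of_int m) - cis (of_int m * (-pi)) / (\<i> * of_int m))) {-pi..pi}"
  proof (intro fundamental_theorem_of_calculus)
    fix x :: real
    have "((\<lambda>z. exp (\<i> * of_int m * z) / (\<i> * of_int m)) has_field_derivative exp (\<i> * of_int m * z)) (at z)" for z :: complex
      using False by (auto intro!: derivative_eq_intros)
    from has_vector_derivative_real_field[OF this, of x "{-pi..pi}"]
    show "((\<lambda>x. cis (of_int m * x) / (\<i> * of_int m)) has_vector_derivative cis (of_int m * x)) (at x within {-pi..pi})"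
      unfolding cis_conv_exp of_real_mult of_real_of_int_eq by (simp only: mult.assoc)
  qed simp
  moreover have "cis (of_int m * (-pi)) = cis (of_int m * pi)"
    by (simp add: complex_eq_iff sin_integer_2pi sin_zero_iff_int2)
  ultimately show ?thesis using False by (simp add: integral_unique)
qed (simp add: scaleR_conv_of_real)

lemma fourier_continuous:
  assumes t: "t abs_summable_on UNIV"
  shows "continuous_on S (fourier t)"
  unfolding fourier_def[abs_def]
  by (rule continuous_on_infsum_int[OF t]) (auto simp: norm_mult intro!: continuous_intros)

lemma integral_fourier:
  assumes t: "t abs_summable_on UNIV"
  shows "integral {-pi..pi} (fourier t) = of_real (2 * pi) * t 0"
proof -
  have "(\<lambda>N. \<Sum>m\<in>{-int N..int N}. integral {-pi..pi} (\<lambda>\<theta>. t m * cis (of_int m * \<theta>)))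
     \<longlonglongrightarrow> integral {-pi..pi} (\<lambda>\<theta>. \<Sum>\<^sub>\<infinity>m. t m * cis (of_int m * \<theta>))"
    by (rule integral_infsum_int[OF t]) (auto simp: norm_mult intro!: continuous_intros)
  moreover have "(\<Sum>m\<in>{-int N..int N}. integral {-pi..pi} (\<lambda>\<theta>. t m * cis (of_int m * \<theta>))) = of_real (2 * pi) * t 0" for N
  proof -
    have "(\<Sum>m\<in>{-int N..int N}. integral {-pi..pi} (\<lambda>\<theta>. t m * cis (of_int m * \<theta>)))
       = (\<Sum>m\<in>{-int N..int N}. if m = 0 then of_real (2 * pi) * t 0 else 0)"
      by (intro sum.cong refl) (auto simp: integral_cis)
    thus ?thesis by simp
  qed
  ultimately have "integral {-pi..pi} (\<lambda>\<theta>. \<Sum>\<^sub>\<infinity>m. t m * cis (of_int m * \<theta>)) = of_real (2 * pi) * t 0"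
    by (simp add: LIMSEQ_const_iff)
  thus ?thesis by (simp add: fourier_def[abs_def])
qed


text \<open>Unlike exact Toeplitz structure, this property is preserved by products (up to the constants).\<close>
definition near_toeplitz :: "(nat \<Rightarrow> nat) \<Rightarrow> (nat \<Rightarrow> complex mat) \<Rightarrow> (int \<Rightarrow> real) \<Rightarrow> (int \<Rightarrow> complex) \<Rightarrow> bool" where
  "near_toeplitz d A g t \<longleftrightarrow> (\<forall>n. A n \<in> carrier_mat (d n) (d n)) \<and> g summable_on UNIV \<and>
     (\<forall>m. cmod (t m) \<le> g m) \<and>
     (\<forall>n i j. i < d n \<longrightarrow> j < d n \<longrightarrow> cmod (A n $$ (i, j)) \<le> g (int i - int j)) \<and>
     (\<forall>\<epsilon>>0. \<exists>M. \<forall>n i j. M \<le> i \<longrightarrow> i + M < d n \<longrightarrow> M \<le> j \<longrightarrow> j + M < d n \<longrightarrow>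
        cmod (A n $$ (i, j) - t (int i - int j)) \<le> \<epsilon>)"

lemma near_toeplitzD:
  assumes "near_toeplitz d A g t"
  shows "A n \<in> carrier_mat (d n) (d n)" "g summable_on UNIV" "cmod (t m) \<le> g m" "0 \<le> g m"
    "i < d n \<Longrightarrow> j < d n \<Longrightarrow> cmod (A n $$ (i, j)) \<le> g (int i - int j)" "t abs_summable_on UNIV"
    "\<epsilon> > 0 \<Longrightarrow> \<exists>M. \<forall>n i j. M \<le> i \<longrightarrow> i + M < d n \<longrightarrow> M \<le> j \<longrightarrow> j + M < d n \<longrightarrow>
        cmod (A n $$ (i, j) - t (int i - int j)) \<le> \<epsilon>"
proof -
  show "A n \<in> carrier_mat (d n) (d n)" "g summable_on UNIV" "cmod (t m) \<le> g m" 
    "i < d n \<Longrightarrow> j < d n \<Longrightarrow> cmod (A n $$ (i, j)) \<le> g (int i - int j)"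
    "\<epsilon> > 0 \<Longrightarrow> \<exists>M. \<forall>n i j. M \<le> i \<longrightarrow> i + M < d n \<longrightarrow> M \<le> j \<longrightarrow> j + M < d n \<longrightarrow>
        cmod (A n $$ (i, j) - t (int i - int j)) \<le> \<epsilon>"
    using assms by (auto simp: near_toeplitz_def)
  show "0 \<le> g m" using \<open>cmod (t m) \<le> g m\<close> norm_ge_zero order_trans by blast
  show "t abs_summable_on UNIV"
    by (rule summable_on_comparison_test[of g]) (use assms in \<open>auto simp: near_toeplitz_def\<close>)
qed

lemma summable_int_tail:
  fixes g :: "int \<Rightarrow> real"
  assumes g: "g summable_on UNIV" "\<And>m. 0 \<le> g m" and e: "e > 0"
  shows "\<exists>L. (\<Sum>\<^sub>\<infinity>m. if m \<in> {-int L..int L} then 0 else g m) < e"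
proof -
  have "(\<lambda>N. \<Sum>m\<in>{-int N..int N}. g m) \<longlonglongrightarrow> (\<Sum>\<^sub>\<infinity>m. g m)" by (rule sum_int_tendsto_infsum[OF g(1)])
  then obtain L where L: "dist (\<Sum>m\<in>{-int L..int L}. g m) (\<Sum>\<^sub>\<infinity>m. g m) < e"
    using e unfolding lim_sequentially by blast
  let ?I = "{-int L..int L}"
  have "(\<Sum>\<^sub>\<infinity>m. if m \<in> ?I then 0 else g m) = (\<Sum>\<^sub>\<infinity>m\<in>-?I. g m)"
    by (rule infsum_cong_neutral) auto
  moreover have "(\<Sum>\<^sub>\<infinity>m. g m) = (\<Sum>m\<in>?I. g m) + (\<Sum>\<^sub>\<infinity>m\<in>-?I. g m)"
    using infsum_Un_disjoint[of g ?I "-?I"] summable_on_subset_banach[OF g(1)] by simp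
  ultimately have "(\<Sum>\<^sub>\<infinity>m. if m \<in> ?I then 0 else g m) < e" using L by (simp add: dist_real_def)
  thus ?thesis by blast
qed

text \<open>The entry of the product and the convolution are both sums over \<open>k\<close> of
  products of two factors. For \<open>k\<close> away from the border the factors are close to the
  symbols; for the other \<open>k\<close> the index \<open>i\<close>, being deep inside, is far from
  \<open>k\<close>, and the summand is controlled by a tail of \<open>g\<close>.\<close>

lemma near_toeplitz_mult:
  assumes A: "near_toeplitz d A g s" and B: "near_toeplitz d B h t"
  shows "near_toeplitz d (\<lambda>n. A n * B n) (conv g h) (conv s t)"
proof -
  note a = near_toeplitzD[OF A] and b = near_toeplitzD[OF B]
  have ga: "g abs_summable_on UNIV" "h abs_summable_on UNIV" using a(2,4) b(2,4) by simp_all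
  note cg = conv_abs_summable[OF ga] and cs = conv_abs_summable[OF a(6) b(6)]
  have gh: "(\<lambda>k. g k * h (m - k)) summable_on UNIV" for m
    using cg(2)[of m] a(4) b(4) by simp
  have ghs: "(\<lambda>k. g (i - k) * h (k - j)) summable_on UNIV" "(\<Sum>\<^sub>\<infinity>k. g (i - k) * h (k - j)) = conv g h (i - j)" for i j
    using summable_shift_int(2)[OF gh[of "i - j"], of i] infsum_shift_int(2)[of "\<lambda>k. g k * h (i - j - k)" i]
    by (auto simp: conv_def algebra_simps)
  have sts: "(\<lambda>k. s (i - k) * t (k - j)) summable_on UNIV" "(\<Sum>\<^sub>\<infinity>k. s (i - k) * t (k - j)) = conv s t (i - j)" for i j
    using summable_shift_int(2)[OF abs_summable_summable[OF cs(2)[of "i - j"]], of i] infsum_shift_int(2)[of "\<lambda>k. s k * t (i - j - k)" i]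
    by (auto simp: conv_def algebra_simps)
  have bnd: "cmod (conv s t m) \<le> conv g h m" for m
    unfolding conv_def
    by (rule order_trans[OF norm_infsum_bound[OF cs(2)] infsum_mono[OF cs(2) gh]])
       (auto simp: norm_mult intro!: mult_mono a(3) b(3) a(4))
  have entry: "(A n * B n) $$ (i, j) = (\<Sum>k<d n. A n $$ (i, k) * B n $$ (k, j))" if "i < d n" "j < d n" for n i j
    using that a(1)[of n] b(1)[of n] by (auto simp: times_mat_def scalar_prod_def atLeast0LessThan intro!: sum.cong)
  \<comment> \<open>The entries are extended by zero to all integers \<open>k\<close>, so that the
    finite sum in the matrix product can be compared termwise with the sum over the integers in
    \<open>conv\<close>.\<close>
  define a' where "a' = (\<lambda>n i k. if k \<in> int ` {..<d n} then A n $$ (i, nat k) else 0)"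
  define b' where "b' = (\<lambda>n k j. if k \<in> int ` {..<d n} then B n $$ (nat k, j) else 0)"
  have entry': "(A n * B n) $$ (i, j) = (\<Sum>\<^sub>\<infinity>k. a' n i k * b' n k j)"
    "(\<lambda>k. a' n i k * b' n k j) summable_on UNIV" if "i < d n" "j < d n" for n i j
  proof -
    have "(\<Sum>\<^sub>\<infinity>k. a' n i k * b' n k j) = (\<Sum>\<^sub>\<infinity>k\<in>int ` {..<d n}. a' n i k * b' n k j)"
      by (rule infsum_cong_neutral) (auto simp: a'_def b'_def)
    also have "\<dots> = (\<Sum>k\<in>int ` {..<d n}. a' n i k * b' n k j)" by simp
    also have "\<dots> = (\<Sum>k<d n. A n $$ (i, k) * B n $$ (k, j))"
      by (subst sum.reindex) (auto simp: a'_def b'_def)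
    finally show "(A n * B n) $$ (i, j) = (\<Sum>\<^sub>\<infinity>k. a' n i k * b' n k j)" using entry[OF that] by simp
    have "(\<lambda>k. a' n i k * b' n k j) summable_on int ` {..<d n}" by simp
    thus "(\<lambda>k. a' n i k * b' n k j) summable_on UNIV"
      by (rule summable_on_cong_neutral[THEN iffD1, rotated -1]) (auto simp: a'_def b'_def)
  qed
  have a'b: "cmod (a' n i k) \<le> g (int i - k)" if "i < d n" for n i k
    using a(5)[OF that, of "nat k"] a(4) by (auto simp: a'_def)
  have b'b: "cmod (b' n k j) \<le> h (k - int j)" if "j < d n" for n j k
    using b(5)[OF _ that, of "nat k"] b(4) by (auto simp: b'_def)
  have ab: "cmod (a' n i k * b' n k j) \<le> g (int i - k) * h (k - int j)" if "i < d n" "j < d n" for n i j k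
    unfolding norm_mult by (intro mult_mono a'b b'b that a(4)) auto
  have bound: "cmod ((A n * B n) $$ (i, j)) \<le> conv g h (int i - int j)" if ij: "i < d n" "j < d n" for n i j
  proof -
    have "(\<lambda>k. a' n i k * b' n k j) abs_summable_on UNIV"
      by (rule summable_on_comparison_test[OF ghs(1)[of "int i" "int j"]]) (auto intro: ab ij)
    hence "cmod (\<Sum>\<^sub>\<infinity>k. a' n i k * b' n k j) \<le> (\<Sum>\<^sub>\<infinity>k. g (int i - k) * h (k - int j))"
      by (intro order_trans[OF norm_infsum_bound infsum_mono] ghs(1) ab ij) auto
    thus ?thesis using entry'(1)[OF ij] ghs(2) by simp
  qed
  define G where "G = (\<Sum>\<^sub>\<infinity>m. g m)"
  define H where "H = (\<Sum>\<^sub>\<infinity>m. h m)"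
  have GH: "G \<ge> 0" "H \<ge> 0" unfolding G_def H_def by (auto intro!: infsum_nonneg a(4) b(4))
  have hH: "h m \<le> H" for m
    using finite_sum_le_infsum[OF b(2), of "{m}"] b(4) by (auto simp: H_def)
  have approx: "\<exists>M. \<forall>n i j. M \<le> i \<longrightarrow> i + M < d n \<longrightarrow> M \<le> j \<longrightarrow> j + M < d n \<longrightarrow>
        cmod ((A n * B n) $$ (i, j) - conv s t (int i - int j)) \<le> \<epsilon>" if e: "\<epsilon> > 0" for \<epsilon>
  proof -
    \<comment> \<open>The budget: the interior terms cost at most \<open>e1 * (G + H + 1)\<close>
      and the remaining ones at most \<open>2 * (H + 1) * e2\<close>, each of which is half of
      \<epsilon>. The added \<open>1\<close> keeps the denominators positive.\<close>
    define e1 where "e1 = \<epsilon> / (2 * (G + H + 1))"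
    define e2 where "e2 = \<epsilon> / (4 * (H + 1))"
    have e12: "e1 > 0" "e2 > 0" using e GH by (auto simp: e1_def e2_def)
    obtain M1 where M1: "\<And>n i j. M1 \<le> i \<Longrightarrow> i + M1 < d n \<Longrightarrow> M1 \<le> j \<Longrightarrow> j + M1 < d n \<Longrightarrow>
        cmod (A n $$ (i, j) - s (int i - int j)) \<le> e1" using a(7)[OF e12(1)] by blast
    obtain M2 where M2: "\<And>n i j. M2 \<le> i \<Longrightarrow> i + M2 < d n \<Longrightarrow> M2 \<le> j \<Longrightarrow> j + M2 < d n \<Longrightarrow>
        cmod (B n $$ (i, j) - t (int i - int j)) \<le> e1" using b(7)[OF e12(1)] by blast
    define M where "M = max M1 M2"
    obtain L where L: "(\<Sum>\<^sub>\<infinity>m. if m \<in> {-int L..int L} then 0 else g m) < e2"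
      using summable_int_tail[OF a(2,4) e12(2)] by blast
    define gt where "gt = (\<lambda>m. if m \<in> {-int L..int L} then 0 else g m)"
    have gt: "gt summable_on UNIV"
      by (rule summable_on_comparison_test[OF a(2)]) (use a(4) in \<open>auto simp: gt_def\<close>)
    \<comment> \<open>With the margin \<open>M + L + 1\<close> every \<open>k\<close> within
      distance \<open>L\<close> of \<open>i\<close> is still \<open>M\<close>-interior, so a
      \<open>k\<close> that is not \<open>M\<close>-interior lies where \<open>gt\<close> agrees
      with \<open>g\<close>.\<close>
    show ?thesis
    proof (intro exI[of _ "M + L + 1"] allI impI)
      fix n i j assume ij: "M + L + 1 \<le> i" "i + (M + L + 1) < d n" "M + L + 1 \<le> j" "j + (M + L + 1) < d n"
      have ij': "i < d n" "j < d n" using ij by auto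
      let ?r = "\<lambda>k. e1 * h (k - int j) + (e1 * g (int i - k) + 2 * H * gt (int i - k))"
      have trm: "cmod (a' n i k * b' n k j - s (int i - k) * t (k - int j)) \<le> ?r k" for k
      proof (cases "int M \<le> k \<and> k + int M < int (d n)")
        case True
        define k' where "k' = nat k"
        have k': "k = int k'" "M \<le> k'" "k' + M < d n" using True by (auto simp: k'_def)
        have *: "cmod (A n $$ (i, k') - s (int i - int k')) \<le> e1" "cmod (B n $$ (k', j) - t (int k' - int j)) \<le> e1"
          using ij k' by (intro M1 M2; auto simp: M_def)+
        have eq: "a' n i k = A n $$ (i, k')" "b' n k j = B n $$ (k', j)" using k' by (auto simp: a'_def b'_def)
        have "a' n i k * b' n k j - s (int i - k) * t (k - int j)
            = (a' n i k - s (int i - k)) * b' n k j + s (int i - k) * (b' n k j - t (k - int j))"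
          by (simp add: algebra_simps)
        also have "cmod \<dots> \<le> e1 * h (k - int j) + g (int i - k) * e1"
          by (intro order_trans[OF norm_triangle_ineq] add_mono, unfold norm_mult, intro mult_mono)
             (use * eq k' b'b[OF ij'(2), of k] a(3) a(4) e12 in \<open>auto intro: mult_mono\<close>)
        also have "\<dots> \<le> ?r k" using GH a(4) by (simp add: gt_def)
        finally show ?thesis .
      next
        case False
        hence gt': "gt (int i - k) = g (int i - k)" using ij by (auto simp: gt_def)
        have "cmod (a' n i k * b' n k j - s (int i - k) * t (k - int j)) \<le> 
            g (int i - k) * h (k - int j) + g (int i - k) * h (k - int j)"
          by (intro order_trans[OF norm_triangle_ineq4] add_mono ab ij')
             (auto simp: norm_mult intro!: mult_mono a(3) b(3) a(4))
        also have "\<dots> \<le> g (int i - k) * H + g (int i - k) * H"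
          by (intro add_mono mult_left_mono hH a(4))
        also have "\<dots> \<le> ?r k" unfolding gt' using e12 a(4) b(4) by (simp add: mult.commute)
        finally show ?thesis .
      qed
      have sh: "(\<lambda>k. h (k - int j)) summable_on UNIV" "(\<Sum>\<^sub>\<infinity>k. h (k - int j)) = H"
        using summable_shift_int(1)[OF b(2), of "- int j"] infsum_shift_int(1)[of h "- int j"] by (auto simp: H_def)
      have sg: "(\<lambda>k. g (int i - k)) summable_on UNIV" "(\<Sum>\<^sub>\<infinity>k. g (int i - k)) = G"
        using summable_shift_int(2)[OF a(2), of "int i"] infsum_shift_int(2)[of g "int i"] by (auto simp: G_def)
      have sgt: "(\<lambda>k. gt (int i - k)) summable_on UNIV" "(\<Sum>\<^sub>\<infinity>k. gt (int i - k)) = (\<Sum>\<^sub>\<infinity>k. gt k)"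
        using summable_shift_int(2)[OF gt, of "int i"] infsum_shift_int(2)[of gt "int i"] by auto
      have r: "?r summable_on UNIV"
        by (intro summable_on_add summable_on_cmult_right sh(1) sg(1) sgt(1))
      have "(A n * B n) $$ (i, j) - conv s t (int i - int j) = (\<Sum>\<^sub>\<infinity>k. a' n i k * b' n k j - s (int i - k) * t (k - int j))"
        unfolding entry'(1)[OF ij'] sts(2)[symmetric]
        using infsum_add[OF entry'(2)[OF ij'] summable_on_uminus[THEN iffD2, OF sts(1)]] by (simp add: infsum_uminus)
      also have "cmod \<dots> \<le> (\<Sum>\<^sub>\<infinity>k. cmod (a' n i k * b' n k j - s (int i - k) * t (k - int j)))"
        by (intro norm_infsum_bound summable_on_comparison_test[OF r]) (auto intro: trm)
      also have "\<dots> \<le> (\<Sum>\<^sub>\<infinity>k. ?r k)"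
        by (intro infsum_mono r trm summable_on_comparison_test[OF r]) (auto intro: trm)
      also have "\<dots> = e1 * H + (e1 * G + 2 * H * (\<Sum>\<^sub>\<infinity>k. gt k))"
        by (simp add: infsum_add summable_on_add summable_on_cmult_right infsum_cmult_right sh sg sgt)
      also have "\<dots> \<le> e1 * (G + H + 1) + 2 * (H + 1) * e2"
        using L GH e12 unfolding gt_def[symmetric]
        by (smt (verit, ccfv_SIG) mult_mono distrib_left mult_left_mono infsum_nonneg a(4) gt_def)
      also have "e1 * (G + H + 1) = \<epsilon> / 2"
        using GH nonzero_divide_mult_cancel_right[of "G + H + 1" \<epsilon>] by (simp add: e1_def divide_simps)
      also have "2 * (H + 1) * e2 = \<epsilon> / 2" using GH by (simp add: e2_def divide_simps)
      also have "\<epsilon> / 2 + \<epsilon> / 2 = \<epsilon>" by simp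
      finally show "cmod ((A n * B n) $$ (i, j) - conv s t (int i - int j)) \<le> \<epsilon>" .
    qed
  qed
  show ?thesis
    unfolding near_toeplitz_def
    using a(1) b(1) bnd bound approx cg(3) summable_on_iff_abs_summable_on_real[of "conv g h"]
    by (auto intro: mult_carrier_mat)
qed


lemma near_toeplitz_one:
  "near_toeplitz d (\<lambda>n. 1\<^sub>m (d n)) (\<lambda>m. if m = 0 then 1 else 0) (\<lambda>m. if m = 0 then 1 else 0)"
proof -
  have "(\<lambda>m::int. if m = 0 then 1 else 0 :: real) summable_on {0}" by simp
  hence "(\<lambda>m::int. if m = 0 then 1 else 0 :: real) summable_on UNIV"
    by (rule summable_on_cong_neutral[THEN iffD1, rotated -1]) auto
  thus ?thesis by (auto simp: near_toeplitz_def)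
qed

lemma near_toeplitz_pow:
  assumes A: "near_toeplitz d A g t"
  shows "\<exists>g' t'. near_toeplitz d (\<lambda>n. A n ^\<^sub>m k) g' t' \<and> (\<forall>\<theta>. fourier t' \<theta> = fourier t \<theta> ^ k)"
proof (induct k)
  case 0
  have "dim_row (A n) = d n" for n using near_toeplitzD(1)[OF A, of n] by simp
  hence "near_toeplitz d (\<lambda>n. A n ^\<^sub>m 0) (\<lambda>m. if m = 0 then 1 else 0) (\<lambda>m. if m = 0 then 1 else 0)"
    using near_toeplitz_one[of d] by simp
  moreover have "fourier (\<lambda>m. if m = 0 then 1 else 0) \<theta> = 1" for \<theta>
  proof -
    have "fourier (\<lambda>m. if m = 0 then 1 else 0) \<theta> = (\<Sum>\<^sub>\<infinity>m\<in>{0}. (if m = 0 then 1 else 0) * cis (of_int m * \<theta>))"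
      unfolding fourier_def by (rule infsum_cong_neutral) auto
    thus ?thesis by simp
  qed
  ultimately show ?case by (intro exI conjI) auto
next
  case (Suc k)
  then obtain g' t' where *: "near_toeplitz d (\<lambda>n. A n ^\<^sub>m k) g' t'" "\<forall>\<theta>. fourier t' \<theta> = fourier t \<theta> ^ k" by blast
  have "near_toeplitz d (\<lambda>n. A n ^\<^sub>m Suc k) (conv g' g) (conv t' t)"
    using near_toeplitz_mult[OF *(1) A] by simp
  moreover have "fourier (conv t' t) \<theta> = fourier t \<theta> ^ Suc k" for \<theta>
    using fourier_conv[OF near_toeplitzD(6)[OF *(1)] near_toeplitzD(6)[OF A]] *(2) by simp
  ultimately show ?case by blast
qed

text \<open>The conjugate transpose, not the adjugate.\<close>

definition adj :: "complex mat \<Rightarrow> complex mat" where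
  "adj A = mat (dim_col A) (dim_row A) (\<lambda>(i, j). cnj (A $$ (j, i)))"

text \<open>The adjoint has the symbol \<open>cnj (t (- m))\<close>, which is \<open>t m\<close>
  again. Thus the symbol cannot tell \<open>A n\<close> from its adjoint, although
  \<open>A n\<close> need not be Hermitian.\<close>

lemma near_toeplitz_adj:
  assumes A: "near_toeplitz d A g t" and t: "\<And>m. t (- m) = cnj (t m)"
  shows "near_toeplitz d (\<lambda>n. adj (A n)) (\<lambda>m. g (- m)) t"
proof -
  note a = near_toeplitzD[OF A]
  have c: "dim_row (A n) = d n" "dim_col (A n) = d n" for n using a(1)[of n] by auto
  have tt: "t (int i - int j) = cnj (t (int j - int i))" for i j
    using t[of "int j - int i"] by simp
  have "cmod (t m) \<le> g (- m)" for m using a(3)[of "- m"] t by simp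
  moreover have "cmod (adj (A n) $$ (i, j)) \<le> g (- (int i - int j))" if "i < d n" "j < d n" for n i j
    using a(5)[OF that(2) that(1)] that by (simp add: adj_def c)
  moreover have "\<exists>M. \<forall>n i j. M \<le> i \<longrightarrow> i + M < d n \<longrightarrow> M \<le> j \<longrightarrow> j + M < d n \<longrightarrow>
        cmod (adj (A n) $$ (i, j) - t (int i - int j)) \<le> \<epsilon>" if e: "\<epsilon> > 0" for \<epsilon>
  proof -
    obtain M where M: "\<And>n i j. M \<le> i \<Longrightarrow> i + M < d n \<Longrightarrow> M \<le> j \<Longrightarrow> j + M < d n \<Longrightarrow>
        cmod (A n $$ (i, j) - t (int i - int j)) \<le> \<epsilon>" using a(7)[OF e] by blast
    show ?thesis
    proof (intro exI[of _ M] allI impI)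
      fix n i j assume ij: "M \<le> i" "i + M < d n" "M \<le> j" "j + M < d n"
      have "adj (A n) $$ (i, j) - t (int i - int j) = cnj (A n $$ (j, i) - t (int j - int i))"
        using ij by (simp add: adj_def c tt[of i j])
      thus "cmod (adj (A n) $$ (i, j) - t (int i - int j)) \<le> \<epsilon>"
        using M[of j n i] ij by (simp only: complex_mod_cnj)
    qed
  qed
  moreover have "(\<lambda>m. g (- m)) summable_on UNIV" using summable_shift_int(2)[OF a(2), of 0] by simp
  ultimately show ?thesis unfolding near_toeplitz_def using c by (auto simp: adj_def)
qed

lemma frob_conv_tr: "of_real (frob A) = tr (A * adj A)"
  unfolding frob_def tr_def of_real_sum
  by (intro sum.cong) (auto simp: times_mat_def scalar_prod_def adj_def complex_norm_square atLeast0LessThan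
      simp del: of_real_power intro!: sum.cong)

text \<open>All but at most \<open>2 * M\<close> diagonal entries are close to \<open>t 0\<close>,
  and the exceptional ones are bounded, so they disappear after division by the size.\<close>

lemma near_toeplitz_tr:
  assumes A: "near_toeplitz d A g t" and d: "filterlim d at_top sequentially"
  shows "(\<lambda>n. tr (A n) / of_nat (d n)) \<longlonglongrightarrow> t 0"
proof (rule LIMSEQ_I)
  fix r :: real assume r: "r > 0"
  note a = near_toeplitzD[OF A]
  obtain M where M: "\<And>n i. M \<le> i \<Longrightarrow> i + M < d n \<Longrightarrow> cmod (A n $$ (i, i) - t 0) \<le> r / 2"
    using a(7)[of "r / 2"] r by fastforce
  have g0: "g 0 \<ge> 0" by (rule a(4))
  \<comment> \<open>Total error of the exceptional entries: at most \<open>2 * M\<close> of them,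
    each off by at most \<open>g 0 + g 0\<close>.\<close>
  define B where "B = 2 * real M * (2 * g 0)"
  have "filterlim (\<lambda>n. real (d n)) at_top sequentially"
    using d filterlim_compose filterlim_real_sequentially by blast
  hence "\<forall>\<^sub>F n in sequentially. real (d n) \<ge> 2 * B / r + 2 * M + 1" by (simp add: filterlim_at_top)
  then obtain N where N: "\<And>n. n \<ge> N \<Longrightarrow> real (d n) \<ge> 2 * B / r + 2 * M + 1"
    unfolding eventually_sequentially by blast
  show "\<exists>N. \<forall>n\<ge>N. cmod (tr (A n) / of_nat (d n) - t 0) < r"
  proof (intro exI[of _ N] allI impI)
    fix n assume "n \<ge> N"
    hence dn: "real (d n) \<ge> 2 * B / r + 2 * M + 1" by (rule N)
    have B0: "B \<ge> 0" using g0 by (simp add: B_def)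
    hence "2 * B / r \<ge> 0" using r by simp
    hence pos: "d n > 0" "real (d n) > 2 * B / r" using dn by auto
    have "cmod (tr (A n) - of_nat (d n) * t 0) = cmod (\<Sum>i<d n. A n $$ (i, i) - t 0)"
      using a(1)[of n] by (auto simp: tr_def sum_subtractf)
    also have "\<dots> \<le> (\<Sum>i<d n. r / 2 + (if i < M \<or> i + M \<ge> d n then 2 * g 0 else 0))"
    proof (rule sum_norm_le)
      fix i assume i: "i \<in> {..<d n}"
      show "cmod (A n $$ (i, i) - t 0) \<le> r / 2 + (if i < M \<or> i + M \<ge> d n then 2 * g 0 else 0)"
      proof (cases "i < M \<or> i + M \<ge> d n")
        case True
        have "cmod (A n $$ (i, i) - t 0) \<le> g 0 + g 0"
          using a(5)[of i n i] a(3)[of 0] i by (intro order_trans[OF norm_triangle_ineq4] add_mono) auto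
        thus ?thesis using True r by simp
      qed (use M[of i n] in auto)
    qed
    also have "\<dots> = d n * (r / 2) + card {i \<in> {..<d n}. i < M \<or> i + M \<ge> d n} * (2 * g 0)"
      by (simp add: sum.distrib sum.If_cases Collect_conj_eq lessThan_def)
    also have "\<dots> \<le> d n * (r / 2) + (2 * M) * (2 * g 0)"
    proof -
      have "card {i \<in> {..<d n}. i < M \<or> i + M \<ge> d n} \<le> card ({..<M} \<union> {d n - M..<d n})"
        by (intro card_mono) auto
      also have "\<dots> \<le> 2 * M" using card_Un_le[of "{..<M}" "{d n - M..<d n}"] by simp
      finally show ?thesis using g0 by (intro add_left_mono mult_right_mono) auto
    qed
    also have "\<dots> < d n * (r / 2) + d n * (r / 2)"
      using pos r by (simp add: B_def field_simps)
    finally have "cmod (tr (A n) - of_nat (d n) * t 0) < d n * r" by (simp add: mult.commute)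
    moreover have "tr (A n) / of_nat (d n) - t 0 = (tr (A n) - of_nat (d n) * t 0) / of_nat (d n)"
      using pos(1) by (simp add: field_simps)
    ultimately show "cmod (tr (A n) / of_nat (d n) - t 0) < r"
      using pos(1) by (simp add: norm_divide field_simps)
  qed
qed

text \<open>The normalized trace of a power tends to the zeroth coefficient of the convolution power
  of \<open>t\<close>, and this coefficient is the mean of
  \<open>fourier t \<theta> ^ k\<close>.\<close>

lemma near_toeplitz_moment:
  assumes A: "near_toeplitz d A g t" and d: "filterlim d at_top sequentially"
  shows "(\<lambda>n. tr (A n ^\<^sub>m k) / of_nat (d n)) \<longlonglongrightarrow> integral {-pi..pi} (\<lambda>\<theta>. fourier t \<theta> ^ k) / of_real (2 * pi)"
proof -
  obtain g' t' where *: "near_toeplitz d (\<lambda>n. A n ^\<^sub>m k) g' t'" "\<And>\<theta>. fourier t' \<theta> = fourier t \<theta> ^ k"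
    using near_toeplitz_pow[OF A] by blast
  have "integral {-pi..pi} (fourier t') = of_real (2 * pi) * t' 0"
    by (rule integral_fourier[OF near_toeplitzD(6)[OF *(1)]])
  hence "t' 0 = integral {-pi..pi} (\<lambda>\<theta>. fourier t \<theta> ^ k) / of_real (2 * pi)" 
    using ext[of "fourier t'" "\<lambda>\<theta>. fourier t \<theta> ^ k", OF *(2)] by simp
  thus ?thesis using near_toeplitz_tr[OF *(1) d] by simp
qed


section \<open>From moments to continuous test functions\<close>

lemma norm_sum_mset_le:
  fixes f :: "'a \<Rightarrow> 'b::real_normed_vector"
  assumes "\<And>x. x \<in># X \<Longrightarrow> norm (f x) \<le> g x"
  shows "norm (\<Sum>x\<in>#X. f x) \<le> (\<Sum>x\<in>#X. g x)"
  using assms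
proof (induct X)
  case (add x X)
  thus ?case by (auto intro!: order_trans[OF norm_triangle_ineq] add_mono)
qed simp

text \<open>Weierstrass for the real and the imaginary part separately. The approximation holds on a
  real segment only: on a disc, uniform limits of polynomials in \<open>z\<close> are holomorphic
  inside, which \<open>F\<close> in general is not.\<close>

lemma approx_by_complex_polynomial:
  fixes F :: "complex \<Rightarrow> complex"
  assumes F: "continuous_on UNIV F" and e: "\<epsilon> > 0"
  shows "\<exists>c N. \<forall>x\<in>{-C..C::real}. cmod (F (of_real x) - (\<Sum>k\<le>N. c k * of_real x ^ k)) \<le> \<epsilon>"
proof -
  have cont: "continuous_on {-C..C} (\<lambda>x. F (of_real x))" 
    by (intro continuous_on_compose2[OF F]) (auto intro!: continuous_intros)
  have *: "\<exists>a n. \<forall>x\<in>{-C..C}. \<bar>h x - (\<Sum>i\<le>n. a i * x ^ i)\<bar> < \<epsilon> / 2" if h: "continuous_on {-C..C} h" for h :: "real \<Rightarrow> real"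
  proof -
    obtain g where g: "real_polynomial_function g" "\<And>x. x \<in> {-C..C} \<Longrightarrow> \<bar>h x - g x\<bar> < \<epsilon> / 2"
      using Stone_Weierstrass_real_polynomial_function[OF compact_Icc h, of "\<epsilon> / 2"] e by auto
    thus ?thesis unfolding real_polynomial_function_iff_sum by blast
  qed
  obtain a n where a: "\<And>x. x \<in> {-C..C} \<Longrightarrow> \<bar>Re (F (of_real x)) - (\<Sum>i\<le>n. a i * x ^ i)\<bar> < \<epsilon> / 2"
    using *[OF continuous_on_Re[OF cont]] by blast
  obtain b m where b: "\<And>x. x \<in> {-C..C} \<Longrightarrow> \<bar>Im (F (of_real x)) - (\<Sum>i\<le>m. b i * x ^ i)\<bar> < \<epsilon> / 2"
    using *[OF continuous_on_Im[OF cont]] by blast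
  define a' where "a' = (\<lambda>i. if i \<le> n then a i else 0)"
  define b' where "b' = (\<lambda>i. if i \<le> m then b i else 0)"
  define c where "c = (\<lambda>i. Complex (a' i) (b' i))"
  define N where "N = max n m"
  have sa: "(\<Sum>i\<le>n. a i * x ^ i) = (\<Sum>i\<le>N. a' i * x ^ i)" for x :: real
    by (rule sum.mono_neutral_cong_left) (auto simp: a'_def N_def)
  have sb: "(\<Sum>i\<le>m. b i * x ^ i) = (\<Sum>i\<le>N. b' i * x ^ i)" for x :: real
    by (rule sum.mono_neutral_cong_left) (auto simp: b'_def N_def)
  have "cmod (F (of_real x) - (\<Sum>k\<le>N. c k * of_real x ^ k)) \<le> \<epsilon>" if x: "x \<in> {-C..C}" for x
  proof -
    let ?z = "F (of_real x) - (\<Sum>k\<le>N. c k * of_real x ^ k)"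
    have "Re ?z = Re (F (of_real x)) - (\<Sum>i\<le>n. a i * x ^ i)"
      "Im ?z = Im (F (of_real x)) - (\<Sum>i\<le>m. b i * x ^ i)"
      unfolding sa sb by (simp_all add: c_def flip: of_real_power)
    thus ?thesis using cmod_le[of ?z] a[OF x] b[OF x] by linarith
  qed
  thus ?thesis by blast
qed

text \<open>The deviation of \<open>F\<close> from a polynomial is small on the real segment, hence at a point \<open>z\<close> of the
  disc it is small up to a multiple of \<open>(Im z)\<^sup>2\<close>; the latter are negligible on average by Schur's inequality.\<close>
lemma bound_near_real_axis:
  fixes H :: "complex \<Rightarrow> complex"
  assumes H: "continuous_on (cball 0 C) H" and e: "\<epsilon> > 0"
    and small: "\<And>x. x \<in> {-C..C::real} \<Longrightarrow> cmod (H (of_real x)) \<le> \<epsilon>"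
  shows "\<exists>K\<ge>0. \<forall>z\<in>cball (0::complex) C. cmod (H z) \<le> 2 * \<epsilon> + K * (Im z)\<^sup>2"
proof -
  have "uniformly_continuous_on (cball 0 C) H" by (rule compact_uniformly_continuous[OF H compact_cball])
  then obtain \<delta> where \<delta>: "\<delta> > 0" "\<And>z w::complex. z \<in> cball 0 C \<Longrightarrow> w \<in> cball 0 C \<Longrightarrow> dist w z < \<delta> \<Longrightarrow> dist (H w) (H z) < \<epsilon>"
    using e unfolding uniformly_continuous_on_def by metis
  obtain B where B: "B > 0" "\<And>z::complex. z \<in> cball 0 C \<Longrightarrow> cmod (H z) \<le> B"
    using compact_imp_bounded[OF compact_continuous_image[OF H compact_cball]]
    unfolding bounded_pos by auto
  show ?thesis
  \<comment> \<open>Within distance \<delta> of the axis uniform continuity gives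
    \<open>2 * \<epsilon>\<close>; farther away the crude bound \<open>B\<close> is at most
    \<open>B * (Im z / \<delta>)\<^sup>2\<close>.\<close>
  proof (intro exI[of _ "B / \<delta>\<^sup>2"] conjI ballI)
    fix z :: complex assume z: "z \<in> cball 0 C"
    show "cmod (H z) \<le> 2 * \<epsilon> + B / \<delta>\<^sup>2 * (Im z)\<^sup>2"
    proof (cases "\<bar>Im z\<bar> < \<delta>")
      case True
      have re: "\<bar>Re z\<bar> \<le> C" using z abs_Re_le_cmod[of z] by simp
      have "dist (H z) (H (of_real (Re z))) < \<epsilon>"
        using True re z by (intro \<delta>(2)) (auto simp: dist_norm cmod_def)
      moreover have "cmod (H (of_real (Re z))) \<le> \<epsilon>" using re by (intro small) auto
      ultimately have "cmod (H z) \<le> 2 * \<epsilon>"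
        using norm_triangle_sub[of "H z" "H (of_real (Re z))"] by (simp add: dist_norm)
      moreover have "0 \<le> B / \<delta>\<^sup>2 * (Im z)\<^sup>2" using B(1) by simp
      ultimately show ?thesis by linarith
    next
      case False
      hence "1 \<le> (\<bar>Im z\<bar> / \<delta>)\<^sup>2" using \<delta>(1) by (intro one_le_power) simp
      hence "B * 1 \<le> B * ((Im z)\<^sup>2 / \<delta>\<^sup>2)" using B(1) by (intro mult_left_mono) (auto simp: power_divide)
      thus ?thesis using B(2)[OF z] e by (simp add: field_simps)
    qed
  qed (use B(1) in auto)
qed

text \<open>The radius \<open>C\<close>, the sum of the dominating function, bounds all eigenvalues
  of all matrices as well as the range of the symbol. Hence one polynomial on \<open>[-C, C]\<close>
  and one constant \<open>K\<close> work for every \<open>n\<close>.\<close>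

theorem near_toeplitz_eigenvalue_limit:
  fixes F :: "complex \<Rightarrow> complex"
  assumes A: "near_toeplitz d A g t" and t: "\<And>m. t (- m) = cnj (t m)"
    and d: "filterlim d at_top sequentially" and F: "continuous_on UNIV F"
  shows "(\<lambda>n. (\<Sum>z\<in>#eigvals (A n). F z) / of_nat (d n)) \<longlonglongrightarrow>
      integral {-pi..pi} (\<lambda>\<theta>. F (fourier t \<theta>)) / of_real (2 * pi)"
proof -
  note a = near_toeplitzD[OF A]
  define C where "C = (\<Sum>\<^sub>\<infinity>m. g m)"
  have C0: "C \<ge> 0" unfolding C_def by (intro infsum_nonneg a(4))
  have fbound: "cmod (fourier t \<theta>) \<le> C" for \<theta>
  proof -
    have "cmod (fourier t \<theta>) \<le> (\<Sum>\<^sub>\<infinity>m. cmod (t m * cis (of_int m * \<theta>)))"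
      unfolding fourier_def by (rule norm_infsum_bound[OF fourier_summable[OF a(6)]])
    also have "\<dots> \<le> C" unfolding C_def
      by (intro infsum_mono fourier_summable[OF a(6)] a(2)) (auto simp: norm_mult a(3))
    finally show ?thesis .
  qed
  have freal: "fourier t \<theta> = of_real (Re (fourier t \<theta>))" for \<theta>
    using fourier_real[of t \<theta>, OF t] by (simp add: complex_eq_iff)
  have fseg: "Re (fourier t \<theta>) \<in> {-C..C}" for \<theta>
    using fbound[of \<theta>] abs_Re_le_cmod[of "fourier t \<theta>"] by (simp add: abs_le_iff)
  note ev = eigvals_mat[OF a(1)]
  have evC: "z \<in> cball 0 C" if "z \<in># eigvals (A n)" for z n
  proof -
    have "(\<Sum>j<d n. cmod (A n $$ (i, j))) \<le> C" if i: "i < d n" for i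
    proof -
      have "(\<Sum>j<d n. cmod (A n $$ (i, j))) \<le> (\<Sum>j<d n. g (int i - int j))"
        by (intro sum_mono a(5)) (use i in auto)
      also have "\<dots> = (\<Sum>m\<in>(\<lambda>j. int i - int j) ` {..<d n}. g m)"
        by (subst sum.reindex) (auto simp: inj_on_def)
      also have "\<dots> \<le> C" unfolding C_def by (intro finite_sum_le_infsum a(2) a(4)) auto
      finally show ?thesis .
    qed
    thus ?thesis using eigenvalue_le_row_sum[OF a(1) _ ev(4)[OF that]] by simp
  qed
  have fc: "continuous_on {-pi..pi} (\<lambda>\<theta>. P (fourier t \<theta>))" if "continuous_on UNIV P" for P :: "complex \<Rightarrow> complex"
    by (rule continuous_on_compose2[OF that fourier_continuous[OF a(6)]]) auto
  \<comment> \<open>Both traces in the upper bound have the limit \<open>conv t t 0\<close>, because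
    \<open>A n\<close> and \<open>adj (A n)\<close> have the same symbol.\<close>
  have im: "(\<lambda>n. (\<Sum>z\<in>#eigvals (A n). (Im z)\<^sup>2) / d n) \<longlonglongrightarrow> 0"
  proof (rule tendsto_sandwich[OF _ _ tendsto_const])
    have "(\<lambda>n. (Re (tr (A n * adj (A n)) / of_nat (d n)) - Re (tr (A n * A n) / of_nat (d n))) / 2)
       \<longlonglongrightarrow> (Re (conv t t 0) - Re (conv t t 0)) / 2"
      by (intro tendsto_divide tendsto_diff tendsto_Re tendsto_const
          near_toeplitz_tr[OF near_toeplitz_mult[OF A near_toeplitz_adj[OF A t]] d]
          near_toeplitz_tr[OF near_toeplitz_mult[OF A A] d]) simp
    thus "(\<lambda>n. (Re (tr (A n * adj (A n)) / of_nat (d n)) - Re (tr (A n * A n) / of_nat (d n))) / 2) \<longlonglongrightarrow> 0"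
      by simp
    have "(\<Sum>z\<in>#eigvals (A n). (Im z)\<^sup>2) / d n \<le> 
        (Re (tr (A n * adj (A n)) / of_nat (d n)) - Re (tr (A n * A n) / of_nat (d n))) / 2" for n
    proof -
      have "2 * (\<Sum>z\<in>#X. (Im z)\<^sup>2) = (\<Sum>z\<in>#X. (cmod z)\<^sup>2) - Re (\<Sum>z\<in>#X. z ^ 2)" for X
        by (induct X) (auto simp: cmod_power2 Re_power2 algebra_simps)
      from this[of "eigvals (A n)"] have "2 * (\<Sum>z\<in>#eigvals (A n). (Im z)\<^sup>2) \<le> frob (A n) - Re (tr (A n ^\<^sub>m 2))"
        using ev(2)[of 2 n] ev(3)[of n] by simp
      moreover have "A n ^\<^sub>m 2 = A n * A n" using a(1)[of n] by (simp add: numeral_2_eq_2)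
      moreover have "frob (A n) = Re (tr (A n * adj (A n)))" by (simp flip: frob_conv_tr)
      ultimately have "2 * (\<Sum>z\<in>#eigvals (A n). (Im z)\<^sup>2) \<le> Re (tr (A n * adj (A n))) - Re (tr (A n * A n))"
        by (simp only:)
      moreover have "x / real (d n) \<le> (u / real (d n) - v / real (d n)) / 2" if "2 * x \<le> u - v" for x u v :: real
        using divide_right_mono[OF that, of "real (d n)"] by (simp add: diff_divide_distrib)
      ultimately show ?thesis by (simp only: Re_divide_of_nat)
    qed
    thus "\<forall>\<^sub>F n in sequentially. (\<Sum>z\<in>#eigvals (A n). (Im z)\<^sup>2) / d n \<le> 
        (Re (tr (A n * adj (A n)) / of_nat (d n)) - Re (tr (A n * A n) / of_nat (d n))) / 2" by simp
    have "0 \<le> (\<Sum>z\<in>#X. (Im z)\<^sup>2)" for X by (induct X) auto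
    thus "\<forall>\<^sub>F n in sequentially. 0 \<le> (\<Sum>z\<in>#eigvals (A n). (Im z)\<^sup>2) / d n" by simp
  qed
  show ?thesis
  proof (rule LIMSEQ_I)
    fix r :: real assume r: "r > 0"
    \<comment> \<open>Five of the eight shares are spent: three on replacing \<open>F\<close> by
      \<open>P\<close> at the eigenvalues (two from the approximation, one from the imaginary
      parts), one on the convergence for \<open>P\<close>, and one on returning from
      \<open>P\<close> to \<open>F\<close> in the integral.\<close>
    define e where "e = r / 8"
    have e: "e > 0" using r by (simp add: e_def)
    obtain c N where P: "\<And>x. x \<in> {-C..C} \<Longrightarrow> cmod (F (of_real x) - (\<Sum>k\<le>N. c k * of_real x ^ k)) \<le> e"
      using approx_by_complex_polynomial[OF F e, of C] by blast
    define P where "P = (\<lambda>z::complex. \<Sum>k\<le>N. c k * z ^ k)"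
    have Pc: "continuous_on S P" for S unfolding P_def by (intro continuous_intros)
    obtain K where K: "K \<ge> 0" "\<And>z. z \<in> cball 0 C \<Longrightarrow> cmod (F z - P z) \<le> 2 * e + K * (Im z)\<^sup>2"
      using bound_near_real_axis[of C "\<lambda>z. F z - P z" e] e P Pc continuous_on_subset[OF F]
      by (force simp: P_def intro!: continuous_on_diff)
    let ?I = "\<lambda>G. integral {-pi..pi} (\<lambda>\<theta>. G (fourier t \<theta>)) / complex_of_real (2 * pi)"
    have limP: "(\<lambda>n. (\<Sum>z\<in>#eigvals (A n). P z) / of_nat (d n)) \<longlonglongrightarrow> ?I P"
    proof -
      have eq: "(\<Sum>z\<in>#eigvals (A n). P z) / of_nat (d n) = (\<Sum>k\<le>N. c k * (tr (A n ^\<^sub>m k) / of_nat (d n)))" for n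
      proof -
        have *: "(\<Sum>z\<in>#X. P z) = (\<Sum>k\<le>N. c k * (\<Sum>z\<in>#X. z ^ k))" for X
          by (induct X) (auto simp: P_def sum.distrib algebra_simps)
        show ?thesis unfolding * ev(2) by (simp add: sum_divide_distrib)
      qed
      have "integral {-pi..pi} (\<lambda>\<theta>. P (fourier t \<theta>)) = (\<Sum>k\<le>N. c k * integral {-pi..pi} (\<lambda>\<theta>. fourier t \<theta> ^ k))"
        unfolding P_def
        by (subst integral_sum) (auto intro!: integrable_continuous_real continuous_intros fourier_continuous[OF a(6)])
      hence "?I P = (\<Sum>k\<le>N. c k * (integral {-pi..pi} (\<lambda>\<theta>. fourier t \<theta> ^ k) / of_real (2 * pi)))"
        by (simp add: sum_divide_distrib)
      thus ?thesis unfolding eq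
        by (simp only:) (intro tendsto_sum tendsto_mult tendsto_const near_toeplitz_moment[OF A d])
    qed
    have "cmod (integral {-pi..pi} (\<lambda>\<theta>. P (fourier t \<theta>) - F (fourier t \<theta>))) \<le> e * (pi - (- pi))"
    proof (rule integral_bound)
      fix \<theta>
      show "cmod (P (fourier t \<theta>) - F (fourier t \<theta>)) \<le> e"
        using P[OF fseg[of \<theta>]] freal[of \<theta>] by (simp add: P_def norm_minus_commute)
    qed (auto intro!: continuous_on_diff fc F Pc)
    also have "integral {-pi..pi} (\<lambda>\<theta>. P (fourier t \<theta>) - F (fourier t \<theta>)) = 
        integral {-pi..pi} (\<lambda>\<theta>. P (fourier t \<theta>)) - integral {-pi..pi} (\<lambda>\<theta>. F (fourier t \<theta>))"
      by (intro Henstock_Kurzweil_Integration.integral_diff integrable_continuous_real fc F Pc)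
    finally have IPF: "cmod (?I P - ?I F) \<le> e"
      unfolding diff_divide_distrib[symmetric] norm_divide by (simp add: field_simps norm_mult)
    obtain N1 where N1: "\<And>n. n \<ge> N1 \<Longrightarrow> cmod ((\<Sum>z\<in>#eigvals (A n). P z) / of_nat (d n) - ?I P) < e"
      using LIMSEQ_D[OF limP e] by blast
    have "(\<lambda>n. K * ((\<Sum>z\<in>#eigvals (A n). (Im z)\<^sup>2) / d n)) \<longlonglongrightarrow> K * 0" by (intro tendsto_mult im tendsto_const)
    from LIMSEQ_D[OF this e] obtain N2 where N2: "\<And>n. n \<ge> N2 \<Longrightarrow> \<bar>K * ((\<Sum>z\<in>#eigvals (A n). (Im z)\<^sup>2) / d n)\<bar> < e"
      by auto
    have "\<forall>\<^sub>F n in sequentially. d n \<ge> 1" using d by (simp add: filterlim_at_top)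
    then obtain N3 where N3: "\<And>n. n \<ge> N3 \<Longrightarrow> d n > 0"
      unfolding eventually_sequentially by force
    show "\<exists>no. \<forall>n\<ge>no. cmod ((\<Sum>z\<in>#eigvals (A n). F z) / of_nat (d n) - ?I F) < r"
    proof (intro exI[of _ "max N1 (max N2 N3)"] allI impI)
      fix n assume n: "n \<ge> max N1 (max N2 N3)"
      let ?E = "eigvals (A n)"
      have dn: "d n > 0" using N3 n by auto
      have "(\<Sum>z\<in>#X. F z) - (\<Sum>z\<in>#X. P z) = (\<Sum>z\<in>#X. F z - P z)" for X
        by (induct X) (auto simp: algebra_simps)
      hence "cmod ((\<Sum>z\<in>#?E. F z) - (\<Sum>z\<in>#?E. P z)) = cmod (\<Sum>z\<in>#?E. F z - P z)" by simp
      also have "\<dots> \<le> (\<Sum>z\<in>#?E. 2 * e + K * (Im z)\<^sup>2)" by (rule norm_sum_mset_le) (rule K(2)[OF evC])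
      also have "\<dots> = d n * (2 * e) + K * (\<Sum>z\<in>#?E. (Im z)\<^sup>2)"
        by (simp only: sum_mset.distrib sum_mset_distrib_left sum_mset_constant ev(1) of_nat_mult)
      finally have "cmod ((\<Sum>z\<in>#?E. F z) - (\<Sum>z\<in>#?E. P z)) / d n \<le> 2 * e + K * ((\<Sum>z\<in>#?E. (Im z)\<^sup>2) / d n)"
        using dn by (simp add: field_simps)
      hence 1: "cmod ((\<Sum>z\<in>#?E. F z) / of_nat (d n) - (\<Sum>z\<in>#?E. P z) / of_nat (d n)) \<le> 3 * e"
      proof -
        have "x \<le> 3 * e" if "x \<le> 2 * e + y" "\<bar>y\<bar> < e" for x y :: real using that by linarith
        from this[OF _ N2[of n]] show ?thesis
          using \<open>_ / real (d n) \<le> _\<close> n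
          by (simp only: flip: diff_divide_distrib) (simp only: norm_divide norm_of_nat max.bounded_iff)
      qed
      have 2: "cmod ((\<Sum>z\<in>#?E. P z) / of_nat (d n) - ?I P) < e" using N1 n by auto
      show "cmod ((\<Sum>z\<in>#?E. F z) / of_nat (d n) - ?I F) < r"
      proof -
        have "cmod ((\<Sum>z\<in>#?E. F z) / of_nat (d n) - ?I F) \<le> 3 * e + e + e"
          using 1 2 IPF norm_triangle_le_diff
          by (smt (verit, ccfv_threshold) norm_triangle_ineq diff_add_cancel add_diff_eq)
        thus ?thesis using r by (simp add: e_def)
      qed
    qed
  qed
qed

section \<open>The Riesz derivative of the cardinal B-spline in the Fourier domain\<close>

lemma Gamma_scaled_integral:
  assumes q: "q > 0" and w: "w > (0::real)"
  shows "has_bochner_integral lborel (\<lambda>s. indicator {0..} s * (s powr (q - 1) * exp (- s * w))) (Gamma q * w powr (- q))"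
proof -
  let ?f = "\<lambda>t. indicator {0..} t * t powr (q - 1) / exp t"
  have "has_bochner_integral lborel ?f (Gamma q)"
    by (rule has_bochner_integral_nn_integral)
       (use q in \<open>auto simp: Gamma_conv_nn_integral_real[symmetric] less_imp_le\<close>)
  hence "has_bochner_integral lborel (\<lambda>s. ?f (0 + w * s)) (Gamma q /\<^sub>R \<bar>w\<bar>)"
    using w by (subst lborel_has_bochner_integral_real_affine_iff[symmetric]) auto
  hence "has_bochner_integral lborel (\<lambda>s. w powr (1 - q) * ?f (0 + w * s)) (w powr (1 - q) * (Gamma q /\<^sub>R \<bar>w\<bar>))"
    by (rule has_bochner_integral_mult_right)
  also have "(\<lambda>s. w powr (1 - q) * ?f (0 + w * s)) = (\<lambda>s. indicator {0..} s * (s powr (q - 1) * exp (- s * w)))"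
    using w by (auto simp: fun_eq_iff indicator_def zero_le_mult_iff powr_mult powr_diff exp_minus field_simps)
  also have "w powr (1 - q) * (Gamma q /\<^sub>R \<bar>w\<bar>) = Gamma q * w powr (- q)"
    using w by (simp add: powr_diff powr_minus field_simps)
  finally show ?thesis .
qed

text \<open>The substitution \<open>s = sqrt (t / (1 - t))\<close> maps \<open>(0, 1)\<close> onto
  \<open>(0, \<infinity>)\<close> with \<open>1 + s\<^sup>2 = 1 / (1 - t)\<close>. It produces the
  Beta integral with parameters \<open>q / 2\<close> and \<open>1 - q / 2\<close>, which the
  reflection formula of the Gamma function evaluates.\<close>

lemma integral_powr_over_one_plus_square:
  assumes q: "0 < q" "q < (2::real)"
  shows "has_bochner_integral lborel (\<lambda>s. indicator {0..} s * (s powr (q - 1) / (1 + s\<^sup>2))) (pi / (2 * sin (pi * q / 2)))"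
proof -
  define a where "a = q / 2"
  have a: "0 < a" "a < 1" using q by (auto simp: a_def)
  let ?B = "\<lambda>t::real. t powr (a - 1) * (1 - t) powr (1 - a - 1)"
  have intB: "set_integrable lborel {0..1} ?B" by (rule integrable_Beta) (use a in auto)
  have valB: "(LINT t:{0..1}|lborel. ?B t) = Beta a (1 - a)"
    using has_integral_Beta_real[of a "1 - a"] set_borel_integral_eq_integral(2)[OF intB] a
    by (simp add: integral_unique)
  define g where "g = (\<lambda>t::real. sqrt (t / (1 - t)))"
  define g' where "g' = (\<lambda>t::real. inverse (sqrt (t / (1 - t))) / 2 * (1 / (1 - t)\<^sup>2))"
  \<comment> \<open>The factor \<open>2\<close> cancels the \<open>1 / 2\<close> in the derivative
    of the square root and is removed again at the end.\<close>
  define f where "f = (\<lambda>s::real. 2 * (s powr (q - 1) / (1 + s\<^sup>2)))"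
  have fg: "f (g t) * g' t = ?B t" if t: "0 < t" "t < 1" for t
  proof -
    define u where "u = t / (1 - t)"
    have u: "u > 0" using t by (simp add: u_def)
    have u1: "1 + u = 1 / (1 - t)" using t by (simp add: u_def field_simps)
    have gs: "g t = u powr (1/2)" using u by (simp add: g_def u_def powr_half_sqrt)
    have "f (g t) * g' t = u powr (1/2 * (q - 1)) * u powr (- 1 / 2) / ((1 + u) * (1 - t)\<^sup>2)"
    proof -
      have sq: "(u powr (1/2))\<^sup>2 = u" using u by (simp add: powr_half_sqrt)
      have inv: "inverse (sqrt u) = u powr (- 1 / 2)" using u by (simp add: powr_minus powr_half_sqrt flip: powr_half_sqrt)
      have gen: "2 * (x / y) * (v / 2 * (1 / z)) = x * v / (y * z)" for x y z v :: real by simp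
      show ?thesis unfolding f_def g'_def gs u_def[symmetric] powr_powr sq inv by (rule gen)
    qed
    also have "u powr (1/2 * (q - 1)) * u powr (- 1 / 2) = u powr (a - 1)"
    proof -
      have "1/2 * (q - 1) + - 1 / 2 = a - 1" by (simp add: a_def field_simps)
      thus ?thesis by (simp only: powr_add[symmetric])
    qed
    also have "(1 + u) * (1 - t)\<^sup>2 = 1 - t" unfolding u1 using t by (simp add: power2_eq_square)
    also have "u powr (a - 1) / (1 - t) = ?B t"
      using t by (simp add: u_def powr_divide powr_diff powr_minus field_simps)
    finally show ?thesis .
  qed
  have "set_integrable lborel (einterval 0 1) (\<lambda>t. f (g t) * g' t)"
  proof -
    have "set_integrable lborel (einterval 0 1) ?B"
      by (rule set_integrable_subset[OF intB]) (auto simp: einterval_def zero_ereal_def one_ereal_def)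
    thus ?thesis
      by (rule set_integrable_cong[THEN iffD1, rotated -1]) (auto simp: einterval_def zero_ereal_def one_ereal_def fg)
  qed
  note I = this
  have lim0: "((ereal \<circ> g \<circ> real_of_ereal) \<longlongrightarrow> 0) (at_right 0)"
  proof -
    have "(g \<longlongrightarrow> sqrt (0 / (1 - 0))) (at_right 0)" unfolding g_def by (intro tendsto_intros) auto
    thus ?thesis by (simp add: zero_ereal_def ereal_tendsto_simps)
  qed
  have lim1: "((ereal \<circ> g \<circ> real_of_ereal) \<longlongrightarrow> \<infinity>) (at_left 1)"
  proof -
    have "filterlim (\<lambda>t::real. t / (1 - t)) at_top (at_left 1)"
    proof (rule LIM_at_top_divide)
      show "((\<lambda>t::real. 1 - t) \<longlongrightarrow> 0) (at_left 1)" by (auto intro!: tendsto_eq_intros)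
      show "\<forall>\<^sub>F t in at_left 1. 0 < 1 - (t::real)" by (auto simp: eventually_at_filter)
    qed (rule tendsto_ident_at, simp)
    have "filterlim g at_top (at_left 1)" unfolding g_def
      by (rule filterlim_compose[OF sqrt_at_top]) fact
    thus ?thesis by (simp add: one_ereal_def ereal_tendsto_simps)
  qed
  have deriv: "(g has_real_derivative g' t) (at t)" if "0 < t" "t < 1" for t
  proof -
    have "((\<lambda>t. t / (1 - t)) has_real_derivative 1 / (1 - t)\<^sup>2) (at t)"
      using that by (auto intro!: derivative_eq_intros simp: power2_eq_square field_simps)
    from DERIV_chain2[OF DERIV_real_sqrt this] that show ?thesis by (simp add: g_def g'_def)
  qed
  have cg: "isCont g' t" if "0 < t" "t < 1" for t
    unfolding g'_def using that by (intro continuous_intros) auto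
  have cf: "isCont f (g t)" if "0 < t" "t < 1" for t
    unfolding f_def using that by (intro continuous_intros) (auto simp: g_def add_nonneg_eq_0_iff)
  have nn: "0 \<le> f t" "0 \<le> t \<Longrightarrow> t \<le> 1 \<Longrightarrow> 0 \<le> g' t" for t
    by (auto simp: f_def g'_def add_nonneg_nonneg)
  have S: "set_integrable lborel (einterval 0 \<infinity>) f" and V: "(LBINT x=0..\<infinity>. f x) = (LBINT x=0..1. f (g x) * g' x)"
    using interval_integral_substitution_nonneg[where f=f and g=g and g'=g' and a=0 and b=1, OF _ _ _ _ _ _ lim0 lim1 I]
      deriv cf cg nn by (auto simp: zero_ereal_def one_ereal_def)
  have "(LBINT x=0..1. f (g x) * g' x) = (LINT x:{0<..<1}|lborel. f (g x) * g' x)"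
    by (simp add: interval_lebesgue_integral_def einterval_def zero_ereal_def one_ereal_def greaterThanLessThan_def greaterThan_def lessThan_def Int_def)
  also have "\<dots> = (LINT x:{0<..<1}|lborel. ?B x)"
    by (intro set_lebesgue_integral_cong) (auto simp: fg)
  also have "\<dots> = (LINT x:{0..1}|lborel. ?B x)"
    by (rule set_integral_discrete_difference[where X="{0,1}"]) auto
  finally have V2: "(LBINT x=0..\<infinity>. f x) = Beta a (1 - a)" using V valB by simp
  have "Beta a (1 - a) = Gamma a * Gamma (1 - a)"
    unfolding Beta_def by simp
  also have "\<dots> = pi / sin (pi * a)"
  proof -
    have "complex_of_real (Gamma a * Gamma (1 - a)) = complex_of_real (pi / sin (pi * a))"
    proof -
      have "Gamma (1 - complex_of_real a) = of_real (Gamma (1 - a))"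
        using Gamma_complex_of_real[of "1 - a"] by simp
      moreover have "sin (complex_of_real pi * complex_of_real a) = complex_of_real (sin (pi * a))"
        by (simp add: sin_of_real flip: of_real_mult)
      ultimately show ?thesis
        using Gamma_reflection_complex[of "of_real a"] by (simp add: Gamma_complex_of_real)
    qed
    thus ?thesis using of_real_eq_iff by blast
  qed
  finally have "(LBINT x=0..\<infinity>. f x) = pi / sin (pi * q / 2)" using V2 by (simp add: a_def)
  hence L: "(LINT x:{0<..}|lborel. f x) = pi / sin (pi * q / 2)"
    by (simp add: interval_lebesgue_integral_0_infty)
  have S': "set_integrable lborel {0<..} f" using S by (simp add: einterval_def zero_ereal_def greaterThan_def)
  have "has_bochner_integral lborel (\<lambda>s. indicator {0<..} s *\<^sub>R f s) (pi / sin (pi * q / 2))"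
    using S' L unfolding set_integrable_def set_lebesgue_integral_def by (simp add: has_bochner_integral_iff)
  hence "has_bochner_integral lborel (\<lambda>s. 1 / 2 * (indicator {0<..} s *\<^sub>R f s)) (1 / 2 * (pi / sin (pi * q / 2)))"
    by (rule has_bochner_integral_mult_right)
  also have "(\<lambda>s. 1 / 2 * (indicator {0<..} s *\<^sub>R f s)) = (\<lambda>s. indicator {0..} s * (s powr (q - 1) / (1 + s\<^sup>2)))"
    by (auto simp: fun_eq_iff indicator_def f_def)
  finally show ?thesis by simp
qed

lemma laplace_sin:
  assumes s: "s > (0::real)"
  shows "has_bochner_integral lborel (\<lambda>w. indicator {0..} w * (exp (- s * w) * sin w)) (1 / (1 + s\<^sup>2))"
proof -
  have i0: "set_integrable lborel {0<..} (\<lambda>w. exp (- (w * s)))" by (rule integrable_I0i_exp_mscale[OF s])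
  have i: "set_integrable lborel {0<..} (\<lambda>w. exp (- s * w) * sin w)"
    by (rule set_integrable_bound[OF i0]) (auto simp: set_borel_measurable_def abs_mult mult_left_le_one_le mult.commute)
  define F where "F = (\<lambda>w. - exp (- s * w) * (s * sin w + cos w) / (1 + s\<^sup>2))"
  have s1: "1 + s\<^sup>2 \<noteq> 0" by (smt (verit) zero_le_power2)
  have "(LBINT w=0..\<infinity>. exp (- s * w) * sin w) = 0 - F 0"
  proof (rule interval_integral_FTC_integrable)
    fix x
    have "(F has_real_derivative exp (- s * x) * sin x) (at x)"
    proof -
      have "((\<lambda>w. - exp (- s * w) * (s * sin w + cos w)) has_real_derivative (1 + s\<^sup>2) * (exp (- s * x) * sin x)) (at x)"
        by (auto intro!: derivative_eq_intros simp: algebra_simps power2_eq_square)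
      from DERIV_cdivide[OF this, of "1 + s\<^sup>2"] s1 show ?thesis by (simp add: F_def)
    qed
    thus "(F has_vector_derivative exp (- s * x) * sin x) (at x)"
      by (simp add: has_real_derivative_iff_has_vector_derivative)
    have "isCont F 0" unfolding F_def using s1 by (intro continuous_intros) auto
    hence "(F \<longlongrightarrow> F 0) (at_right 0)" by (simp add: isCont_def filterlim_at_split)
    thus "((F \<circ> real_of_ereal) \<longlongrightarrow> F 0) (at_right 0)" by (simp add: zero_ereal_def ereal_tendsto_simps)
    have "(F \<longlongrightarrow> 0) at_top"
    proof (rule Lim_null_comparison)
      show "\<forall>\<^sub>F w in at_top. norm (F w) \<le> exp (- s * w) * ((s + 1) / (1 + s\<^sup>2))"
      proof (intro always_eventually allI)
        fix w
        have "\<bar>s * sin w + cos w\<bar> \<le> s * 1 + 1"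
          using s by (intro order_trans[OF abs_triangle_ineq] add_mono) (auto simp: abs_mult intro!: mult_left_le)
        hence "exp (- s * w) * \<bar>s * sin w + cos w\<bar> / (1 + s\<^sup>2) \<le> exp (- s * w) * (s * 1 + 1) / (1 + s\<^sup>2)"
          using s by (intro divide_right_mono mult_left_mono) (auto simp: add_nonneg_nonneg)
        thus "norm (F w) \<le> exp (- s * w) * ((s + 1) / (1 + s\<^sup>2))"
          by (simp add: F_def abs_mult)
      qed
      have "((\<lambda>w. exp (- s * w)) \<longlongrightarrow> 0) at_top"
        using s by (intro filterlim_compose[OF exp_at_bot] filterlim_tendsto_neg_mult_at_bot[of _ "- s"])
          (auto intro: filterlim_ident)
      from tendsto_mult[OF this tendsto_const[of "(s + 1) / (1 + s\<^sup>2)"]] show "((\<lambda>w. exp (- s * w) * ((s + 1) / (1 + s\<^sup>2))) \<longlongrightarrow> 0) at_top" by simp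
    qed
    thus "((F \<circ> real_of_ereal) \<longlongrightarrow> 0) (at_left \<infinity>)" by (simp add: ereal_tendsto_simps)
  qed (use i in \<open>auto simp: einterval_def zero_ereal_def greaterThan_def intro!: continuous_intros\<close>)
  also have "0 - F 0 = 1 / (1 + s\<^sup>2)" by (simp add: F_def)
  finally have L: "(LINT w:{0<..}|lborel. exp (- s * w) * sin w) = 1 / (1 + s\<^sup>2)"
    by (simp add: interval_lebesgue_integral_0_infty)
  have "has_bochner_integral lborel (\<lambda>w. indicator {0<..} w *\<^sub>R (exp (- s * w) * sin w)) (1 / (1 + s\<^sup>2))"
    using i L unfolding set_integrable_def set_lebesgue_integral_def by (simp add: has_bochner_integral_iff)
  also have "(\<lambda>w. indicator {0<..} w *\<^sub>R (exp (- s * w) * sin w)) = (\<lambda>w. indicator {0..} w * (exp (- s * w) * sin w))"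
    by (auto simp: fun_eq_iff indicator_def)
  finally show ?thesis .
qed


text \<open>Near \<open>0\<close> the bound \<open>|sin w| \<le> w\<close> gives
  \<open>w powr (1 - q)\<close>, integrable because \<open>q < 2\<close>; at infinity
  \<open>w powr (- q)\<close> is integrable because \<open>1 < q\<close>.\<close>

lemma powr_times_sin_integrable:
  assumes q: "1 < q" "q < (2::real)"
  shows "integrable lborel (\<lambda>w. indicator {0..} w * (w powr (- q) * sin w))"
proof -
  have i1: "set_integrable lborel {0..1} (\<lambda>w. w powr (1 - q))"
  proof -
    have "(\<lambda>w. w powr (1 - q)) absolutely_integrable_on {0..1}"
      using q by (intro nonnegative_absolutely_integrable_1 integrable_on_powr_from_0) auto
    thus ?thesis unfolding absolutely_integrable_on_def set_integrable_def
      by (subst (asm) integrable_completion) auto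
  qed
  have i2: "set_integrable lborel {1..} (\<lambda>w. w powr (- q))"
  proof -
    have "(\<lambda>w. w powr (- q)) absolutely_integrable_on {1..}"
      using q has_integral_powr_to_inf[of "-q" 1] by (intro nonnegative_absolutely_integrable_1) (auto simp: integrable_on_def)
    thus ?thesis unfolding absolutely_integrable_on_def set_integrable_def
      by (subst (asm) integrable_completion) auto
  qed
  have "integrable lborel (\<lambda>w. indicator {0..1} w *\<^sub>R w powr (1 - q) + indicator {1..} w *\<^sub>R w powr (- q))"
    using i1 i2 unfolding set_integrable_def by (rule Bochner_Integration.integrable_add)
  thus ?thesis
  proof (rule Bochner_Integration.integrable_bound)
    show "AE w in lborel. norm (indicator {0..} w * (w powr (- q) * sin w)) \<le>
       norm (indicator {0..1} w *\<^sub>R w powr (1 - q) + indicator {1..} w *\<^sub>R w powr (- q))"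
    proof (intro AE_I2)
      fix w :: real
      consider "w < 0" | "w = 0" | "0 < w" "w < 1" | "w \<ge> 1" by linarith
      thus "norm (indicator {0..} w * (w powr (- q) * sin w)) \<le>
       norm (indicator {0..1} w *\<^sub>R w powr (1 - q) + indicator {1..} w *\<^sub>R w powr (- q))"
      proof cases
        case 3
        have "w powr (- q) * \<bar>sin w\<bar> \<le> w powr (- q) * w"
          using abs_sin_x_le_abs_x[of w] 3 by (intro mult_left_mono) auto
        also have "\<dots> = w powr (1 - q)" using 3 by (simp add: powr_diff powr_minus field_simps)
        finally show ?thesis using 3 by (simp add: abs_mult)
      next
        case 4
        have "w powr (- q) * \<bar>sin w\<bar> \<le> w powr (- q) * 1"
          by (intro mult_left_mono) auto
        also have "\<dots> \<le> norm (indicator {0..1} w *\<^sub>R w powr (1 - q) + indicator {1..} w *\<^sub>R w powr (- q))"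
          using 4 by (simp add: indicator_def)
        finally show ?thesis using 4 by (simp add: abs_mult)
      qed auto
    qed
  qed simp
qed

text \<open>Write \<open>w powr (- q)\<close> as a Laplace transform and exchange the integrals.\<close>
lemma powr_times_sin_integral:
  assumes q: "1 < q" "q < (2::real)"
  shows "(LINT w|lborel. indicator {0..} w * (w powr (- q) * sin w)) = pi / (2 * Gamma q * sin (pi * q / 2))"
proof -
  let ?f = "\<lambda>w s::real. indicator {0..} w * indicator {0..} s * (s powr (q - 1) * exp (- s * w) * sin w)"
  have Gq: "Gamma q > 0" using q by (simp add: Gamma_real_pos)
  have inner_s: "has_bochner_integral lborel (\<lambda>s. ?f w s) (Gamma q * (indicator {0..} w * (w powr (- q) * sin w)))" if "w \<noteq> 0" for w
  proof (cases "w > 0")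
    case True
    have "has_bochner_integral lborel (\<lambda>s. sin w * (indicator {0..} s * (s powr (q - 1) * exp (- s * w)))) (sin w * (Gamma q * w powr (- q)))"
      by (rule has_bochner_integral_mult_right) (rule Gamma_scaled_integral, use q True in auto)
    thus ?thesis using True by (simp add: mult_ac)
  qed (use that in \<open>auto simp: indicator_def\<close>)
  have inner_abs: "has_bochner_integral lborel (\<lambda>s. norm (?f w s)) (Gamma q * norm (indicator {0..} w * (w powr (- q) * sin w)))" if "w \<noteq> 0" for w
  proof (cases "w > 0")
    case True
    have "has_bochner_integral lborel (\<lambda>s. \<bar>sin w\<bar> * (indicator {0..} s * (s powr (q - 1) * exp (- s * w)))) (\<bar>sin w\<bar> * (Gamma q * w powr (- q)))"
      by (rule has_bochner_integral_mult_right) (rule Gamma_scaled_integral, use q True in auto)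
    thus ?thesis using True by (simp add: mult_ac abs_mult)
  qed (use that in \<open>auto simp: indicator_def\<close>)
  have AE0: "AE w in lborel. w \<noteq> (0::real)" by (rule AE_lborel_singleton)
  have int: "integrable (lborel \<Otimes>\<^sub>M lborel) (case_prod ?f)"
  proof (rule lborel_pair.Fubini_integrable)
    show "case_prod ?f \<in> borel_measurable (lborel \<Otimes>\<^sub>M lborel)" by measurable
    have "integrable lborel (\<lambda>w. Gamma q * norm (indicator {0..} w * (w powr (- q) * sin w)))"
      by (intro integrable_mult_right integrable_norm powr_times_sin_integrable q)
    thus "integrable lborel (\<lambda>w. LINT s|lborel. norm (case_prod ?f (w, s)))"
    proof (rule integrable_cong_AE_imp)
      show "AE w in lborel. Gamma q * norm (indicator {0..} w * (w powr (- q) * sin w)) = (LINT s|lborel. norm (case_prod ?f (w, s)))"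
        using AE0 by eventually_elim (use has_bochner_integral_integral_eq[OF inner_abs] in simp)
    qed measurable
    show "AE w in lborel. integrable lborel (\<lambda>s. case_prod ?f (w, s))"
      using AE0 by eventually_elim (use integrable.intros[OF inner_s] in simp)
  qed
  have "Gamma q * (LINT w|lborel. indicator {0..} w * (w powr (- q) * sin w)) = (LINT w|lborel. LINT s|lborel. ?f w s)"
    unfolding integral_mult_right_zero[symmetric]
  proof (rule integral_cong_AE)
    show "AE w in lborel. Gamma q * (indicator {0..} w * (w powr (- q) * sin w)) = (LINT s|lborel. ?f w s)"
      using AE0 by eventually_elim (use has_bochner_integral_integral_eq[OF inner_s] in simp)
  qed measurable
  also have "\<dots> = (LINT s|lborel. LINT w|lborel. ?f w s)"
    using lborel_pair.Fubini_integral[OF int] by simp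
  also have "\<dots> = (LINT s|lborel. indicator {0..} s * (s powr (q - 1) / (1 + s\<^sup>2)))"
  proof (rule integral_cong_AE)
    show "AE s in lborel. (LINT w|lborel. ?f w s) = indicator {0..} s * (s powr (q - 1) / (1 + s\<^sup>2))"
      using AE_lborel_singleton[of 0]
    proof eventually_elim
      case (elim s)
      show ?case
      proof (cases "s > 0")
        case True
        have "has_bochner_integral lborel (\<lambda>w. s powr (q - 1) * (indicator {0..} w * (exp (- s * w) * sin w))) (s powr (q - 1) * (1 / (1 + s\<^sup>2)))"
          by (intro has_bochner_integral_mult_right laplace_sin True)
        from has_bochner_integral_integral_eq[OF this] True show ?thesis by (simp add: mult_ac)
      qed (use elim in \<open>auto simp: indicator_def\<close>)
    qed
  qed measurable
  also have "\<dots> = pi / (2 * sin (pi * q / 2))"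
    by (rule has_bochner_integral_integral_eq[OF integral_powr_over_one_plus_square]) (use q in auto)
  finally have *: "Gamma q * (LINT w|lborel. indicator {0..} w * (w powr (- q) * sin w)) = pi / (2 * sin (pi * q / 2))" .
  have "x = c / (2 * G * t)" if "G * x = c / (2 * t)" "G > 0" for x c t G :: real
    using that by (cases "t = 0") (auto simp: field_simps)
  from this[OF * Gq] show ?thesis .
qed

text \<open>The odd extension of the power function. It arises on both sides: as a sine transform,
  and as a truncated power minus its reflection when left and right derivatives are added.\<close>

definition signed_powr :: "real \<Rightarrow> real \<Rightarrow> real" where
  "signed_powr \<beta> y = sgn y * \<bar>y\<bar> powr \<beta>"

text \<open>The integrand is even for \<open>y = 1\<close>, so the half-line integral doubles;
  scaling \<open>w\<close> by \<open>y > 0\<close> gives the power \<open>q - 1\<close>, and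
  negative \<open>y\<close> follows by oddness.\<close>

lemma signed_powr_times_sin:
  assumes q: "1 < q" "q < (2::real)"
  shows "has_bochner_integral lborel (\<lambda>w. sgn w * \<bar>w\<bar> powr (- q) * sin (y * w))
     (pi / (Gamma q * sin (pi * q / 2)) * signed_powr (q - 1) y)"
proof -
  let ?S = "pi / (2 * Gamma q * sin (pi * q / 2))"
  let ?f = "\<lambda>w::real. sgn w * \<bar>w\<bar> powr (- q) * sin w"
  have "has_bochner_integral lborel (\<lambda>w. indicator {0..} w *\<^sub>R ?f w) ?S"
  proof -
    have eq: "(\<lambda>w. indicator {0..} w *\<^sub>R ?f w) = (\<lambda>w::real. indicator {0..} w * (w powr (- q) * sin w))"
      by (auto simp: fun_eq_iff indicator_def sgn_if)
    show ?thesis unfolding eq has_bochner_integral_iff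
      using powr_times_sin_integrable[OF q] powr_times_sin_integral[OF q] by simp
  qed
  hence f: "has_bochner_integral lborel ?f (2 *\<^sub>R ?S)"
    by (rule has_bochner_integral_even_function) (simp add: sgn_minus)
  have pos: "has_bochner_integral lborel (\<lambda>w. sgn w * \<bar>w\<bar> powr (- q) * sin (y * w)) (y powr (q - 1) * (2 * ?S))" if y: "y > 0" for y
  proof -
    have "has_bochner_integral lborel (\<lambda>w. ?f (0 + y * w)) ((2 *\<^sub>R ?S) /\<^sub>R \<bar>y\<bar>)"
      using y f by (subst lborel_has_bochner_integral_real_affine_iff[symmetric]) auto
    hence "has_bochner_integral lborel (\<lambda>w. y powr q * ?f (0 + y * w)) (y powr q * ((2 *\<^sub>R ?S) /\<^sub>R \<bar>y\<bar>))"
      by (rule has_bochner_integral_mult_right)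
    also have "(\<lambda>w. y powr q * ?f (0 + y * w)) = (\<lambda>w. sgn w * \<bar>w\<bar> powr (- q) * sin (y * w))"
      using y by (auto simp: fun_eq_iff sgn_mult abs_mult powr_mult powr_minus field_simps)
    also have "y powr q * ((2 *\<^sub>R ?S) /\<^sub>R \<bar>y\<bar>) = y powr (q - 1) * (2 * ?S)"
      using y by (simp add: powr_diff field_simps)
    finally show ?thesis .
  qed
  consider "y > 0" | "y = 0" | "y < 0" by linarith
  thus ?thesis
  proof cases
    case 1
    thus ?thesis using pos[of y] by (simp add: signed_powr_def mult.commute)
  next
    case 2
    thus ?thesis by (simp add: signed_powr_def has_bochner_integral_zero)
  next
    case 3
    thus ?thesis using has_bochner_integral_minus[OF pos[of "-y"]] by (simp add: signed_powr_def mult.commute)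
  qed
qed

section \<open>The Riesz derivative of the cardinal spline and its Fourier kernel\<close>

definition tpowr :: "real \<Rightarrow> real \<Rightarrow> real" where
  "tpowr \<beta> x = (if x > 0 then x powr \<beta> else 0)"

text \<open>The left Riemann-Liouville derivative of order \<open>\<alpha>\<close> of the cardinal B-spline of degree \<open>p\<close>
  with support \<open>[0, p + 1]\<close>.\<close>
definition card_rl :: "real \<Rightarrow> nat \<Rightarrow> real \<Rightarrow> real" where
  "card_rl \<alpha> p x = (\<Sum>j\<le>p+1. (-1) ^ j * real ((p + 1) choose j) * tpowr (real p - \<alpha>) (x - real j)) / Gamma (real p + 1 - \<alpha>)"

text \<open>The shift by \<open>(p + 1) / 2\<close> centres the spline at \<open>0\<close>. By its
  symmetry the right derivative at \<open>x\<close> is the left derivative at \<open>- x\<close>,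
  which explains the second summand.\<close>

definition riesz_card :: "real \<Rightarrow> nat \<Rightarrow> real \<Rightarrow> real" where
  "riesz_card \<alpha> p x = 1 / (2 * cos (pi * \<alpha> / 2)) *
     (card_rl \<alpha> p (x + (real p + 1) / 2) + card_rl \<alpha> p (- x + (real p + 1) / 2))"

text \<open>The multiplier \<open>|w| powr \<alpha>\<close> times the Fourier transform of the
  centred B-spline of degree \<open>p\<close>. At \<open>w = 0\<close> the quotient is
  \<open>0\<close> by convention instead of \<open>1\<close>, but the power vanishes there, so for
  positive \<alpha> the function is continuous.\<close>

definition hker :: "real \<Rightarrow> nat \<Rightarrow> real \<Rightarrow> real" where
  "hker \<alpha> p w = \<bar>w\<bar> powr \<alpha> * (sin (w / 2) / (w / 2)) ^ (p + 1)"

text \<open>The delicate point is \<open>x = 0\<close>: there the difference quotient is at most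
  \<open>|h| powr (\<beta> - 1)\<close>, which tends to \<open>0\<close> because
  \<open>\<beta> > 1\<close>.\<close>

lemma tpowr_deriv:
  assumes "\<beta> > 1"
  shows "(tpowr \<beta> has_real_derivative \<beta> * tpowr (\<beta> - 1) x) (at x)"
proof -
  consider "x > 0" | "x < 0" | "x = 0" by linarith
  thus ?thesis
  proof cases
    case 1
    have "((\<lambda>x. x powr \<beta>) has_real_derivative \<beta> * x powr (\<beta> - 1)) (at x)"
      using 1 by (auto intro!: derivative_eq_intros)
    moreover have "\<forall>\<^sub>F y in nhds x. tpowr \<beta> y = y powr \<beta>"
      using eventually_nhds_in_open[of "{0<..}" x] 1 by (auto elim!: eventually_mono simp: tpowr_def)
    ultimately show ?thesis using 1 by (subst DERIV_cong_ev[OF refl _ refl]) (auto simp: tpowr_def)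
  next
    case 2
    have "\<forall>\<^sub>F y in nhds x. tpowr \<beta> y = 0"
      using eventually_nhds_in_open[of "{..<0}" x] 2 by (auto elim!: eventually_mono simp: tpowr_def)
    thus ?thesis using 2 by (subst DERIV_cong_ev[OF refl _ refl]) (auto simp: tpowr_def)
  next
    case 3
    have "((\<lambda>h. tpowr \<beta> h / h) \<longlongrightarrow> 0) (at 0)"
    proof (rule Lim_null_comparison)
      show "\<forall>\<^sub>F h in at 0. norm (tpowr \<beta> h / h) \<le> \<bar>h\<bar> powr (\<beta> - 1)"
        by (intro always_eventually allI) (auto simp: tpowr_def powr_diff divide_le_0_iff)
      have "((\<lambda>h. \<bar>h\<bar> powr (\<beta> - 1)) \<longlongrightarrow> \<bar>0\<bar> powr (\<beta> - 1)) (at (0::real))"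
        using assms by (intro tendsto_powr' tendsto_intros) auto
      thus "((\<lambda>h. \<bar>h\<bar> powr (\<beta> - 1)) \<longlongrightarrow> 0) (at (0::real))" by simp
    qed
    thus ?thesis unfolding DERIV_def 3 by (simp add: tpowr_def)
  qed
qed

lemma tpowr_continuous:
  assumes "\<beta> > 0"
  shows "continuous_on S (tpowr \<beta>)"
proof -
  have eq: "tpowr \<beta> = (\<lambda>x. max 0 x powr \<beta>)" by (auto simp: tpowr_def fun_eq_iff max_def)
  show ?thesis unfolding eq
    by (intro continuous_on_powr' continuous_intros) (use assms in auto)
qed

text \<open>The weights \<open>1, -3, 3, -1\<close> are antisymmetric, so the reflected sum
  contributes the reflected truncated powers with opposite sign, and each pair joins to the odd
  power \<open>s\<close>.\<close>

lemma riesz_card_2: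
  assumes \<alpha>: "1 < \<alpha>" "\<alpha> < 2"
  defines "s \<equiv> signed_powr (2 - \<alpha>)"
  shows "riesz_card \<alpha> 2 x = 1 / (2 * cos (pi * \<alpha> / 2) * Gamma (3 - \<alpha>)) *
     (s (x + 3/2) - 3 * s (x + 1/2) + 3 * s (x - 1/2) - s (x - 3/2))"
proof -
  have st: "s y = tpowr (2 - \<alpha>) y - tpowr (2 - \<alpha>) (- y)" for y
    by (auto simp: s_def signed_powr_def tpowr_def sgn_if)
  have three: "(\<Sum>j\<le>3. f j) = f 0 + f 1 + f 2 + f (3::nat)" for f :: "nat \<Rightarrow> real"
    by (simp add: eval_nat_numeral)
  have ch: "(3::nat) choose 2 = 3" by (simp add: eval_nat_numeral)
  have L: "card_rl \<alpha> 2 y = (tpowr (2 - \<alpha>) y - 3 * tpowr (2 - \<alpha>) (y - 1) + 3 * tpowr (2 - \<alpha>) (y - 2) - tpowr (2 - \<alpha>) (y - 3)) / Gamma (3 - \<alpha>)" for y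
    by (simp add: card_rl_def three ch numeral_3_eq_3[symmetric] del: binomial_Suc_Suc)
  have G: "Gamma (3 - \<alpha>) > 0" using \<alpha> by (simp add: Gamma_real_pos)
  let ?T = "tpowr (2 - \<alpha>)"
  have 1: "x + (real 2 + 1) / 2 = x + 3/2" "x + 3/2 - 1 = x + 1/2" "x + 3/2 - 2 = x - 1/2" "x + 3/2 - 3 = x - 3/2"
    "- x + (real 2 + 1) / 2 = - (x - 3/2)" "- (x - 3/2) - 1 = - (x - 1/2)" "- (x - 3/2) - 2 = - (x + 1/2)" "- (x - 3/2) - 3 = - (x + 3/2)"
    by (simp_all add: field_simps)
  have gen: "1 / (2 * c) * (A / G + B / G) = 1 / (2 * c * G) * (A + B)" for c A B G :: real
    by (simp add: add_divide_distrib mult_ac)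
  show ?thesis unfolding riesz_card_def L 1 st gen
    by (intro arg_cong2[of _ _ _ _ "(*)"] refl) simp
qed

text \<open>The product \<open>8 sin(w/2)^3 cos(x w)\<close> is a combination of four sines with
  frequencies \<open>x + 1/2\<close>, \<open>x - 1/2\<close>, \<open>x + 3/2\<close>,
  \<open>x - 3/2\<close>, while \<open>|w| powr \<alpha> / w ^ 3\<close> is
  \<open>sgn w * |w| powr (- q)\<close> with \<open>q = 3 - \<alpha>\<close>. Each term is then
  covered by \<open>signed_powr_times_sin\<close>.\<close>

lemma hker_2_integral:
  assumes \<alpha>: "1 < \<alpha>" "\<alpha> < 2"
  shows "has_bochner_integral lborel (\<lambda>w. hker \<alpha> 2 w * cos (x * w)) (2 * pi * riesz_card \<alpha> 2 x)"
proof -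
  define q where "q = 3 - \<alpha>"
  have q: "1 < q" "q < 2" using \<alpha> by (auto simp: q_def)
  let ?g = "\<lambda>y w. sgn w * \<bar>w\<bar> powr (- q) * sin (y * w)"
  let ?C = "pi / (Gamma q * sin (pi * q / 2))"
  let ?s = "signed_powr (q - 1)"
  have "has_bochner_integral lborel (\<lambda>w. 3 * ?g (x + 1/2) w - 3 * ?g (x - 1/2) w - ?g (x + 3/2) w + ?g (x - 3/2) w)
     (3 * (?C * ?s (x + 1/2)) - 3 * (?C * ?s (x - 1/2)) - ?C * ?s (x + 3/2) + ?C * ?s (x - 3/2))"
    by (intro has_bochner_integral_add has_bochner_integral_diff has_bochner_integral_mult_right signed_powr_times_sin q)
  also have "(\<lambda>w. 3 * ?g (x + 1/2) w - 3 * ?g (x - 1/2) w - ?g (x + 3/2) w + ?g (x - 3/2) w) = (\<lambda>w. hker \<alpha> 2 w * cos (x * w))"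
  proof
    fix w :: real
    show "3 * ?g (x + 1/2) w - 3 * ?g (x - 1/2) w - ?g (x + 3/2) w + ?g (x - 3/2) w = hker \<alpha> 2 w * cos (x * w)"
    proof (cases "w = 0")
      case False
      define a where "a = w / 2"
      have sin3: "sin (3 * a) = 3 * sin a - 4 * sin a ^ 3" 
      proof -
        have "sin (2 * a + a) = 3 * sin a - 4 * sin a ^ 3"
        proof -
          have "sin (2 * a + a) = 2 * sin a * (cos a)\<^sup>2 + (1 - 2 * (sin a)\<^sup>2) * sin a"
            unfolding sin_add sin_double cos_double_sin by (simp add: power2_eq_square)
          also have "(cos a)\<^sup>2 = 1 - (sin a)\<^sup>2" by (rule cos_squared_eq)
          finally show ?thesis by (simp add: algebra_simps power2_eq_square power3_eq_cube)
        qed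
        thus ?thesis by simp
      qed
      have d: "sin (b + c) - sin (b - c) = 2 * cos b * sin c" for b c :: real
        by (simp add: sin_add sin_diff)
      have "3 * sin ((x + 1/2) * w) - 3 * sin ((x - 1/2) * w) - sin ((x + 3/2) * w) + sin ((x - 3/2) * w) =
          3 * (sin (x * w + a) - sin (x * w - a)) - (sin (x * w + 3 * a) - sin (x * w - 3 * a))"
        by (simp add: a_def algebra_simps)
      also have "\<dots> = 8 * sin a ^ 3 * cos (x * w)" unfolding d sin3 by (simp add: algebra_simps)
      finally have trig: "3 * sin ((x + 1/2) * w) - 3 * sin ((x - 1/2) * w) - sin ((x + 3/2) * w) + sin ((x - 3/2) * w) = 8 * sin a ^ 3 * cos (x * w)" .
      have "3 * ?g (x + 1/2) w - 3 * ?g (x - 1/2) w - ?g (x + 3/2) w + ?g (x - 3/2) w = 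
          sgn w * \<bar>w\<bar> powr (- q) * (3 * sin ((x + 1/2) * w) - 3 * sin ((x - 1/2) * w) - sin ((x + 3/2) * w) + sin ((x - 3/2) * w))"
        by (simp add: algebra_simps)
      also have "\<dots> = sgn w * \<bar>w\<bar> powr (- q) * (8 * sin a ^ 3 * cos (x * w))" by (simp only: trig)
      also have "sgn w * \<bar>w\<bar> powr (- q) * (8 * sin a ^ 3 * cos (x * w)) = \<bar>w\<bar> powr \<alpha> / w ^ 3 * (8 * sin a ^ 3 * cos (x * w))"
      proof -
        have "\<bar>w\<bar> powr (- q) = \<bar>w\<bar> powr \<alpha> / \<bar>w\<bar> ^ 3"
          using False by (simp add: q_def powr_diff powr_numeral)
        thus ?thesis using False by (auto simp: sgn_if abs_if)
      qed
      finally show ?thesis by (simp add: hker_def a_def power_divide eval_nat_numeral)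
    qed (simp add: hker_def)
  qed
  also have "3 * (?C * ?s (x + 1/2)) - 3 * (?C * ?s (x - 1/2)) - ?C * ?s (x + 3/2) + ?C * ?s (x - 3/2) = 2 * pi * riesz_card \<alpha> 2 x"
  proof -
    \<comment> \<open>This turns the constant of the sine transform into the normalization
      \<open>1 / (2 * cos (pi * \<alpha> / 2))\<close> of the Riesz derivative; the minus sign
      accounts for the reversed signs of the four terms.\<close>
    have "sin (pi * q / 2) = - cos (pi * \<alpha> / 2)"
    proof -
      have "pi * q / 2 = pi + (pi / 2 - pi * \<alpha> / 2)" by (simp add: q_def field_simps)
      thus ?thesis by (simp only: sin_periodic_pi2 cos_sin_eq of_real_eq_id id_apply)
    qed
    thus ?thesis unfolding riesz_card_2[OF \<alpha>] by (simp add: q_def algebra_simps)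
  qed
  finally show ?thesis .
qed

text \<open>Pascal's rule: a difference of order \<open>n + 1\<close> is a difference of differences
  of order \<open>n\<close>.\<close>

lemma choose_Suc_alternating_sum:
  fixes f :: "nat \<Rightarrow> real"
  shows "(\<Sum>j\<le>Suc n. (-1) ^ j * real (Suc n choose j) * f j) =
     (\<Sum>j\<le>n. (-1) ^ j * real (n choose j) * f j) - (\<Sum>j\<le>n. (-1) ^ j * real (n choose j) * f (Suc j))"
proof -
  have "(\<Sum>j\<le>Suc n. (-1) ^ j * real (Suc n choose j) * f j) =
      f 0 + (\<Sum>j\<le>n. - ((-1) ^ j) * real (Suc n choose Suc j) * f (Suc j))"
    by (subst sum.atMost_Suc_shift) simp
  also have "\<dots> = f 0 + (\<Sum>j\<le>n. (-1) ^ Suc j * real (n choose Suc j) * f (Suc j)) - (\<Sum>j\<le>n. (-1) ^ j * real (n choose j) * f (Suc j))"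
    by (simp add: sum.distrib sum_subtractf sum_negf algebra_simps)
  also have "f 0 + (\<Sum>j\<le>n. (-1) ^ Suc j * real (n choose Suc j) * f (Suc j)) = (\<Sum>j\<le>Suc n. (-1) ^ j * real (n choose j) * f j)"
    by (subst sum.atMost_Suc_shift) simp
  also have "\<dots> = (\<Sum>j\<le>n. (-1) ^ j * real (n choose j) * f j)" by (simp add: binomial_eq_0)
  finally show ?thesis .
qed

text \<open>Integration raises the exponent of the truncated powers by one, and the difference of
  the antiderivative across a unit interval raises the order of the binomial difference by one.
  Centring absorbs the half steps.\<close>

lemma riesz_card_Suc:
  assumes \<alpha>: "1 < \<alpha>" "\<alpha> < 2" and p: "p \<ge> 2"
  shows "(riesz_card \<alpha> p has_integral riesz_card \<alpha> (Suc p) x) {x - 1/2..x + 1/2}"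
proof -
  \<comment> \<open>An antiderivative of \<open>card_rl \<alpha> p\<close>, obtained
    termwise.\<close>
  define Q where "Q = (\<lambda>y. (\<Sum>j\<le>p+1. (-1) ^ j * real ((p + 1) choose j) * tpowr (real p + 1 - \<alpha>) (y - real j)) / Gamma (real p + 2 - \<alpha>))"
  have G: "Gamma (real p + 2 - \<alpha>) = (real p + 1 - \<alpha>) * Gamma (real p + 1 - \<alpha>)"
  proof -
    have "real p + 1 - \<alpha> \<notin> \<int>\<^sub>\<le>\<^sub>0" using \<alpha> p nonpos_Ints_nonpos by fastforce
    from Gamma_plus1[OF this] show ?thesis by (simp add: algebra_simps)
  qed
  have pos: "real p + 1 - \<alpha> > 1" "Gamma (real p + 1 - \<alpha>) > 0" using \<alpha> p by (auto intro!: Gamma_real_pos)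
  have dQ: "(Q has_real_derivative card_rl \<alpha> p y) (at y)" for y
  proof -
    have "(Q has_real_derivative (\<Sum>j\<le>p+1. (-1) ^ j * real ((p + 1) choose j) * ((real p + 1 - \<alpha>) * tpowr (real p + 1 - \<alpha> - 1) (y - real j))) / Gamma (real p + 2 - \<alpha>)) (at y)"
      unfolding Q_def 
      by (intro DERIV_cdivide DERIV_sum DERIV_cmult DERIV_chain2[OF tpowr_deriv, where g="\<lambda>y. y - real j" and Db=1 for j, simplified] pos)
         (auto intro!: derivative_eq_intros)
    also have "(\<Sum>j\<le>p+1. (-1) ^ j * real ((p + 1) choose j) * ((real p + 1 - \<alpha>) * tpowr (real p + 1 - \<alpha> - 1) (y - real j))) / Gamma (real p + 2 - \<alpha>)
        = ((real p + 1 - \<alpha>) * (\<Sum>j\<le>p+1. (-1) ^ j * real ((p + 1) choose j) * tpowr (real p - \<alpha>) (y - real j))) / Gamma (real p + 2 - \<alpha>)"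
      unfolding sum_distrib_left by (intro arg_cong2[of _ _ _ _ "(/)"] sum.cong refl) (simp add: algebra_simps)
    also have "\<dots> = card_rl \<alpha> p y" unfolding G card_rl_def using pos by simp
    finally show ?thesis .
  qed
  have LQ: "card_rl \<alpha> (Suc p) y = Q y - Q (y - 1)" for y
    using choose_Suc_alternating_sum[of "p + 1" "\<lambda>j. tpowr (real p + 1 - \<alpha>) (y - real j)"]
    by (simp add: card_rl_def Q_def diff_divide_distrib[symmetric] algebra_simps del: sum.atMost_Suc binomial_Suc_Suc)
  let ?c = "1 / (2 * cos (pi * \<alpha> / 2))"
  let ?h = "(real p + 1) / 2"
  have "(riesz_card \<alpha> p has_integral
     ?c * (Q (x + 1/2 + ?h) - Q (- (x + 1/2) + ?h)) - ?c * (Q (x - 1/2 + ?h) - Q (- (x - 1/2) + ?h))) {x - 1/2..x + 1/2}"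
  proof (rule fundamental_theorem_of_calculus)
    fix y
    have "((\<lambda>y. ?c * (Q (y + ?h) - Q (- y + ?h))) has_real_derivative ?c * (card_rl \<alpha> p (y + ?h) * 1 - card_rl \<alpha> p (- y + ?h) * (-1))) (at y within {x - 1/2..x + 1/2})"
      by (intro DERIV_cmult DERIV_diff DERIV_chain2[OF dQ]) (auto intro!: derivative_eq_intros)
    thus "((\<lambda>y. ?c * (Q (y + ?h) - Q (- y + ?h))) has_vector_derivative riesz_card \<alpha> p y) (at y within {x - 1/2..x + 1/2})"
      by (simp add: has_real_derivative_iff_has_vector_derivative riesz_card_def)
  qed simp
  also have "?c * (Q (x + 1/2 + ?h) - Q (- (x + 1/2) + ?h)) - ?c * (Q (x - 1/2 + ?h) - Q (- (x - 1/2) + ?h))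
     = riesz_card \<alpha> (Suc p) x"
    unfolding riesz_card_def LQ by (simp add: algebra_simps add_divide_distrib diff_divide_distrib)
  finally show ?thesis .
qed

lemma hker_measurable [measurable]: "hker \<alpha> p \<in> borel_measurable borel"
  unfolding hker_def by measurable

text \<open>Averaging \<open>cos (y * w)\<close> over the unit interval around \<open>x\<close>
  multiplies \<open>cos (x * w)\<close> by \<open>sin (w / 2) / (w / 2)\<close>, so it leads from
  \<open>hker \<alpha> p\<close> to \<open>hker \<alpha> (Suc p)\<close>. By Fubini the other side
  is averaged too, and \<open>riesz_card_Suc\<close> applies.\<close>

lemma hker_integral:
  assumes \<alpha>: "1 < \<alpha>" "\<alpha> < 2" and p: "p \<ge> 2"
  shows "has_bochner_integral lborel (\<lambda>w. hker \<alpha> p w * cos (x * w)) (2 * pi * riesz_card \<alpha> p x)"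
  using p
proof (induct p arbitrary: x rule: dec_induct)
  case base
  show ?case by (rule hker_2_integral[OF \<alpha>])
next
  case (step p)
  \<comment> \<open>At \<open>x = 0\<close> the cosine is \<open>1\<close>, so the induction
    hypothesis contains the integrability of the kernel itself.\<close>
  have int0: "integrable lborel (hker \<alpha> p)" using step(3)[of 0] by (auto simp: has_bochner_integral_iff)
  let ?I = "{x - 1/2..x + 1/2}"
  let ?f = "\<lambda>w y. indicator ?I y * (hker \<alpha> p w * cos (y * w))"
  have nb: "norm (?f w y) \<le> norm (indicator ?I y * hker \<alpha> p w)" for w y
    by (auto simp: indicator_def abs_mult mult_left_le)
  have int: "integrable (lborel \<Otimes>\<^sub>M lborel) (case_prod ?f)"
  proof (rule Bochner_Integration.integrable_bound)
    show "integrable (lborel \<Otimes>\<^sub>M lborel) (\<lambda>(w, y). indicator ?I y * hker \<alpha> p w)"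
    proof (rule lborel_pair.Fubini_integrable)
      show "integrable lborel (\<lambda>w. LINT y|lborel. norm (case (w, y) of (w, y) \<Rightarrow> indicator ?I y * hker \<alpha> p w))"
        using integrable_norm[OF int0] by (simp add: abs_mult)
      show "AE w in lborel. integrable lborel (\<lambda>y. case (w, y) of (w, y) \<Rightarrow> indicator ?I y * hker \<alpha> p w)"
        by simp
    qed measurable
    show "AE z in lborel \<Otimes>\<^sub>M lborel. norm (case_prod ?f z) \<le> norm (case z of (w, y) \<Rightarrow> indicator ?I y * hker \<alpha> p w)"
      using nb by (intro AE_I2) auto
  qed measurable
  have inner: "(LINT y|lborel. ?f w y) = hker \<alpha> (Suc p) w * cos (x * w)" if w: "w \<noteq> 0" for w
  proof -
    have "((\<lambda>y. cos (y * w)) has_integral (sin ((x + 1/2) * w) / w - sin ((x - 1/2) * w) / w)) ?I"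
      using w by (intro fundamental_theorem_of_calculus)
        (auto simp flip: has_real_derivative_iff_has_vector_derivative intro!: derivative_eq_intros)
    moreover have "set_integrable lborel ?I (\<lambda>y. cos (y * w))"
      by (intro borel_integrable_atLeastAtMost') (intro continuous_intros)
    ultimately have "(LINT y:?I|lborel. cos (y * w)) = sin ((x + 1/2) * w) / w - sin ((x - 1/2) * w) / w"
      using set_borel_integral_eq_integral(2) by (metis integral_unique)
    also have "\<dots> = cos (x * w) * (sin (w / 2) / (w / 2))"
    proof -
      have "sin ((x + 1/2) * w) - sin ((x - 1/2) * w) = 2 * cos (x * w) * sin (w / 2)"
        using sin_add[of "x * w" "w / 2"] sin_diff[of "x * w" "w / 2"] by (simp add: algebra_simps)
      thus ?thesis using w by (simp add: field_simps)
    qed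
    finally have "(LINT y:?I|lborel. cos (y * w)) = cos (x * w) * (sin (w / 2) / (w / 2))" .
    moreover have "(LINT y|lborel. ?f w y) = hker \<alpha> p w * (LINT y:?I|lborel. cos (y * w))"
      unfolding set_lebesgue_integral_def by (simp add: mult_ac flip: integral_mult_right_zero)
    ultimately show ?thesis by (simp add: hker_def)
  qed
  have AE0: "AE w in lborel. w \<noteq> (0::real)" by (rule AE_lborel_singleton)
  have "integrable lborel (\<lambda>w. LINT y|lborel. ?f w y)" using lborel_pair.integrable_fst[OF int] by simp
  hence i: "integrable lborel (\<lambda>w. hker \<alpha> (Suc p) w * cos (x * w))"
  proof (rule integrable_cong_AE_imp)
    show "AE w in lborel. (LINT y|lborel. ?f w y) = hker \<alpha> (Suc p) w * cos (x * w)"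
      using AE0 by eventually_elim (rule inner)
  qed measurable
  have "(LINT w|lborel. hker \<alpha> (Suc p) w * cos (x * w)) = (LINT w|lborel. LINT y|lborel. ?f w y)"
  proof (rule integral_cong_AE)
    show "AE w in lborel. hker \<alpha> (Suc p) w * cos (x * w) = (LINT y|lborel. ?f w y)"
      using AE0 by eventually_elim (rule inner[symmetric])
  qed measurable
  also have "\<dots> = (LINT y|lborel. LINT w|lborel. ?f w y)"
    using lborel_pair.Fubini_integral[OF int] by simp
  also have "\<dots> = (LINT y|lborel. indicator ?I y * (2 * pi * riesz_card \<alpha> p y))"
    using step(3) by (simp add: has_bochner_integral_iff)
  also have "\<dots> = 2 * pi * (LINT y:?I|lborel. riesz_card \<alpha> p y)"
    unfolding set_lebesgue_integral_def by (simp add: mult_ac flip: integral_mult_right_zero)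
  also have "(LINT y:?I|lborel. riesz_card \<alpha> p y) = riesz_card \<alpha> (Suc p) x"
  proof -
    have "continuous_on ?I (riesz_card \<alpha> p)"
      unfolding riesz_card_def card_rl_def using \<alpha> step(1)
      by (intro continuous_intros continuous_on_compose2[OF tpowr_continuous[of _ UNIV]]) (auto simp: Gamma_eq_zero_iff intro!: continuous_intros)
    hence "set_integrable lborel ?I (riesz_card \<alpha> p)" by (rule borel_integrable_atLeastAtMost')
    thus ?thesis using set_borel_integral_eq_integral(2) riesz_card_Suc[OF \<alpha> step(1), of x]
      by (metis integral_unique)
  qed
  finally show ?case using i by (simp add: has_bochner_integral_iff)
qed

section \<open>Periodization: continuity and cosine coefficients of the symbol\<close>

lemma summable_int_powr:
  assumes s: "s > 1"
  shows "(\<lambda>m::int. (1 + \<bar>of_int m\<bar>) powr (- s) :: real) summable_on UNIV"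
proof -
  let ?f = "\<lambda>m::int. (1 + \<bar>of_int m\<bar>) powr (- s) :: real"
  have "summable (\<lambda>n. real (Suc n) powr (- s))"
    using summable_real_powr_iff[of "- s"] s by (subst summable_Suc_iff) simp
  hence 1: "(\<lambda>n. real (Suc n) powr (- s)) summable_on UNIV"
    by (intro norm_summable_imp_summable_on) simp
  have A: "?f summable_on range int"
    by (subst summable_on_reindex) (use 1 in \<open>auto simp: comp_def add.commute\<close>)
  have B: "?f summable_on range (\<lambda>n. - int (Suc n))"
  proof (subst summable_on_reindex)
    have "(\<lambda>n. real (Suc (Suc n)) powr (- s)) summable_on UNIV"
      by (rule summable_on_comparison_test[OF 1]) (use s in \<open>auto intro!: powr_mono2'\<close>)
    thus "(?f \<circ> (\<lambda>n. - int (Suc n))) summable_on UNIV" by (simp add: comp_def algebra_simps)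
  qed (auto simp: inj_on_def)
  have "range int \<union> range (\<lambda>n. - int (Suc n)) = UNIV"
  proof safe
    fix m :: int assume "m \<notin> range (\<lambda>n. - int (Suc n))"
    thus "m \<in> range int" by (cases m) auto
  qed auto
  moreover have "range int \<inter> range (\<lambda>n. - int (Suc n)) = {}" by auto
  ultimately show ?thesis using summable_on_Un_disjoint[OF A B] by simp
qed

lemma hker_bound:
  assumes "\<alpha> > 0"
  shows "\<bar>hker \<alpha> p w\<bar> \<le> \<bar>w\<bar> powr \<alpha>" and "w \<noteq> 0 \<Longrightarrow> \<bar>hker \<alpha> p w\<bar> \<le> 2 ^ (p + 1) * \<bar>w\<bar> powr (\<alpha> - real (p + 1))"
proof -
  have "\<bar>sin (w / 2) / (w / 2)\<bar> \<le> 1"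
    using abs_sin_x_le_abs_x[of "w / 2"] by (cases "w = 0") (auto simp: abs_divide divide_le_eq)
  hence "\<bar>sin (w / 2) / (w / 2)\<bar> ^ (p + 1) \<le> 1 ^ (p + 1)" by (intro power_mono) auto
  hence "\<bar>w\<bar> powr \<alpha> * \<bar>sin (w / 2) / (w / 2)\<bar> ^ (p + 1) \<le> \<bar>w\<bar> powr \<alpha> * 1" by (intro mult_left_mono) auto
  thus "\<bar>hker \<alpha> p w\<bar> \<le> \<bar>w\<bar> powr \<alpha>" unfolding hker_def abs_mult power_abs by simp
  assume w: "w \<noteq> 0"
  have "\<bar>sin (w / 2) / (w / 2)\<bar> \<le> 2 / \<bar>w\<bar>" using w abs_sin_le_one[of "w / 2"] by (simp add: abs_mult divide_simps del: abs_sin_le_one)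
  hence "\<bar>sin (w / 2) / (w / 2)\<bar> ^ (p + 1) \<le> (2 / \<bar>w\<bar>) ^ (p + 1)" by (intro power_mono) auto
  hence "\<bar>w\<bar> powr \<alpha> * \<bar>sin (w / 2) / (w / 2)\<bar> ^ (p + 1) \<le> \<bar>w\<bar> powr \<alpha> * (2 / \<bar>w\<bar>) ^ (p + 1)" by (intro mult_left_mono) auto
  also have "\<dots> = 2 ^ (p + 1) * \<bar>w\<bar> powr (\<alpha> - real (p + 1))"
    using w by (simp add: powr_diff powr_realpow power_divide del: power_Suc of_nat_Suc of_nat_add)
  finally show "\<bar>hker \<alpha> p w\<bar> \<le> 2 ^ (p + 1) * \<bar>w\<bar> powr (\<alpha> - real (p + 1))"
    unfolding hker_def abs_mult power_abs by simp
qed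

lemma hker_continuous:
  assumes "\<alpha> > 0"
  shows "continuous_on S (hker \<alpha> p)"
proof (rule continuous_at_imp_continuous_on, rule ballI)
  fix w
  show "isCont (hker \<alpha> p) w"
  proof (cases "w = 0")
    case True
    have "((hker \<alpha> p) \<longlongrightarrow> 0) (at 0)"
    proof (rule Lim_null_comparison)
      show "\<forall>\<^sub>F h in at 0. norm (hker \<alpha> p h) \<le> \<bar>h\<bar> powr \<alpha>"
        using hker_bound(1)[OF assms] by (auto intro!: always_eventually)
      have "((\<lambda>h. \<bar>h\<bar> powr \<alpha>) \<longlongrightarrow> \<bar>0\<bar> powr \<alpha>) (at (0::real))"
        using assms by (intro tendsto_powr' tendsto_intros) auto
      thus "((\<lambda>h. \<bar>h\<bar> powr \<alpha>) \<longlongrightarrow> 0) (at (0::real))" by simp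
    qed
    thus ?thesis using True by (simp add: isCont_def hker_def)
  qed (auto simp: hker_def[abs_def] intro!: continuous_intros)
qed

lemma hker_minus: "hker \<alpha> p (- w) = hker \<alpha> p w"
  by (simp add: hker_def)

lemma symbol_f_conv_hker: "symbol_f p \<alpha> \<theta> = (\<Sum>\<^sub>\<infinity>l::int. hker \<alpha> p (\<theta> + 2 * pi * of_int l))"
  unfolding symbol_f_def hker_def by (intro infsum_cong) (simp add: add_divide_distrib mult_ac)

text \<open>A majorant for the Weierstrass test. For \<open>l \<noteq> 0\<close> the argument has
  modulus at least \<open>pi * |l|\<close>, hence at least \<open>2 * |l|\<close> and
  \<open>1 + |l|\<close>, and the decay of \<open>hker\<close> applies; the term
  \<open>l = 0\<close> accounts for \<open>pi powr \<alpha>\<close>.\<close>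

lemma hker_shift_bound:
  assumes \<alpha>: "0 < \<alpha>" "\<alpha> < real p + 1" and \<theta>: "\<theta> \<in> {-pi..pi}"
  shows "norm (hker \<alpha> p (\<theta> + 2 * pi * of_int l)) \<le> (pi powr \<alpha> + 2 ^ (p + 1)) * (1 + \<bar>of_int l\<bar>) powr (- (real p + 1 - \<alpha>))"
proof (cases "l = 0")
  case True
  have "\<bar>hker \<alpha> p \<theta>\<bar> \<le> \<bar>\<theta>\<bar> powr \<alpha>" by (rule hker_bound(1)[OF \<alpha>(1)])
  also have "\<dots> \<le> pi powr \<alpha>" using \<theta> \<alpha> by (intro powr_mono2) auto
  also have "\<dots> \<le> pi powr \<alpha> + 2 ^ (p + 1)" by simp
  finally show ?thesis using True by simp
next
  case False
  let ?w = "\<theta> + 2 * pi * of_int l"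
  have l1: "\<bar>of_int l\<bar> \<ge> (1::real)" using False by linarith
  have "2 * pi * \<bar>of_int l\<bar> \<le> \<bar>?w\<bar> + \<bar>\<theta>\<bar>"
    using abs_triangle_ineq4[of ?w \<theta>] pi_gt_zero by (simp add: abs_mult)
  moreover have "\<bar>\<theta>\<bar> \<le> pi * 1" using \<theta> by auto
  moreover have "pi * 1 \<le> pi * \<bar>of_int l\<bar>" using l1 by (intro mult_left_mono) auto
  ultimately have "\<bar>?w\<bar> \<ge> pi * \<bar>of_int l\<bar>" by linarith
  moreover have "pi * \<bar>of_int l\<bar> \<ge> 2 * \<bar>of_int l\<bar>" using pi_ge_two by (intro mult_right_mono) auto
  ultimately have w: "\<bar>?w\<bar> \<ge> 1 + \<bar>of_int l\<bar>" using l1 by linarith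
  hence w0: "?w \<noteq> 0" by auto
  have "\<bar>hker \<alpha> p ?w\<bar> \<le> 2 ^ (p + 1) * \<bar>?w\<bar> powr (\<alpha> - real (p + 1))" by (rule hker_bound(2)[OF \<alpha>(1) w0])
  also have "\<dots> \<le> 2 ^ (p + 1) * (1 + \<bar>of_int l\<bar>) powr (- (real p + 1 - \<alpha>))"
    using w \<alpha> by (intro mult_left_mono) (auto simp: algebra_simps intro!: powr_mono2')
  also have "\<dots> \<le> (pi powr \<alpha> + 2 ^ (p + 1)) * (1 + \<bar>of_int l\<bar>) powr (- (real p + 1 - \<alpha>))"
    by (intro mult_right_mono) auto
  finally show ?thesis by simp
qed

lemma hker_majorant_summable:
  assumes "1 < \<alpha>" "\<alpha> < 2" "p \<ge> (2::nat)"
  shows "(\<lambda>l::int. (pi powr \<alpha> + 2 ^ (p + 1)) * (1 + \<bar>of_int l\<bar>) powr (- (real p + 1 - \<alpha>))) summable_on UNIV"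
  by (intro summable_on_cmult_right summable_int_powr) (use assms in auto)

lemma symbol_f_continuous:
  assumes \<alpha>: "1 < \<alpha>" "\<alpha> < 2" and p: "p \<ge> 2"
  shows "continuous_on {-pi..pi} (symbol_f p \<alpha>)"
proof -
  have "continuous_on {-pi..pi} (\<lambda>\<theta>. \<Sum>\<^sub>\<infinity>l::int. hker \<alpha> p (\<theta> + 2 * pi * of_int l))"
  proof (rule continuous_on_infsum_int[OF hker_majorant_summable[OF \<alpha> p]])
    show "continuous_on {-pi..pi} (\<lambda>\<theta>. hker \<alpha> p (\<theta> + 2 * pi * of_int l))" for l
      using \<alpha> by (intro continuous_on_compose2[OF hker_continuous[of \<alpha> UNIV]] continuous_intros) auto
  qed (rule hker_shift_bound, use \<alpha> p in auto)
  thus ?thesis by (simp add: symbol_f_conv_hker[abs_def])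
qed

lemma symbol_f_even: "symbol_f p \<alpha> (- \<theta>) = symbol_f p \<alpha> \<theta>"
proof -
  have "symbol_f p \<alpha> (- \<theta>) = (\<Sum>\<^sub>\<infinity>l::int. hker \<alpha> p (\<theta> + 2 * pi * of_int (0 - l)))"
    unfolding symbol_f_conv_hker
  proof (intro infsum_cong)
    fix l :: int
    show "hker \<alpha> p (- \<theta> + 2 * pi * of_int l) = hker \<alpha> p (\<theta> + 2 * pi * of_int (0 - l))"
      using hker_minus[of \<alpha> p "\<theta> + 2 * pi * of_int (0 - l)"] by (simp add: algebra_simps)
  qed
  also have "\<dots> = symbol_f p \<alpha> \<theta>"
    unfolding symbol_f_conv_hker by (rule infsum_shift_int(2)[of "\<lambda>l. hker \<alpha> p (\<theta> + 2 * pi * of_int l)" 0])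
  finally show ?thesis .
qed

text \<open>Unfolding as in Poisson summation: \<open>cos (k * \<theta>)\<close> with integer
  \<open>k\<close> has period \<open>2 * pi\<close>, so the integrals of the shifted kernels over
  one period join to an integral over the line, which \<open>hker_integral\<close>
  evaluates.\<close>

lemma integral_symbol_f_cos:
  assumes \<alpha>: "1 < \<alpha>" "\<alpha> < 2" and p: "p \<ge> 2"
  shows "integral {-pi..pi} (\<lambda>\<theta>. symbol_f p \<alpha> \<theta> * cos (of_int k * \<theta>)) = 2 * pi * riesz_card \<alpha> p (of_int k)"
proof -
  let ?h = "\<lambda>w. hker \<alpha> p w * cos (of_int k * w)"
  have hc: "continuous_on S ?h" for S using \<alpha> by (intro continuous_intros hker_continuous) auto
  note H = hker_integral[OF \<alpha> p, of "of_int k"]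
  have M: "(\<lambda>N. \<Sum>l\<in>{-int N..int N}. integral {-pi..pi} (\<lambda>\<theta>. ?h (\<theta> + 2 * pi * of_int l))) \<longlonglongrightarrow>
      integral {-pi..pi} (\<lambda>\<theta>. \<Sum>\<^sub>\<infinity>l::int. ?h (\<theta> + 2 * pi * of_int l))"
  proof (rule integral_infsum_int[OF hker_majorant_summable[OF \<alpha> p]])
    fix m :: int and x :: real assume x: "x \<in> {-pi..pi}"
    have "norm (?h (x + 2 * pi * of_int m)) \<le> norm (hker \<alpha> p (x + 2 * pi * of_int m)) * 1"
      unfolding norm_mult by (intro mult_left_mono) auto
    also have "\<dots> \<le> (pi powr \<alpha> + 2 ^ (p + 1)) * (1 + \<bar>of_int m\<bar>) powr (- (real p + 1 - \<alpha>))"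
      using hker_shift_bound[of \<alpha> p x m] \<alpha> p x by simp
    finally show "norm (?h (x + 2 * pi * of_int m)) \<le> (pi powr \<alpha> + 2 ^ (p + 1)) * (1 + \<bar>of_int m\<bar>) powr (- (real p + 1 - \<alpha>))" .
  qed (intro continuous_on_compose2[OF hc[of UNIV]] continuous_intros subset_UNIV)
  have "(\<Sum>\<^sub>\<infinity>l::int. ?h (\<theta> + 2 * pi * of_int l)) = symbol_f p \<alpha> \<theta> * cos (of_int k * \<theta>)" for \<theta>
  proof -
    have "cos (of_int k * (\<theta> + 2 * pi * of_int l)) = cos (of_int k * \<theta>)" for l :: int
    proof -
      have "of_int k * (\<theta> + 2 * pi * of_int l) = of_int k * \<theta> + 2 * pi * of_int (k * l)" by (simp add: algebra_simps)
      thus ?thesis by (simp only: cos_add sin_int_2pin cos_int_2pin)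
    qed
    thus ?thesis unfolding symbol_f_conv_hker by (simp add: infsum_cmult_left')
  qed
  hence M': "(\<lambda>N. \<Sum>l\<in>{-int N..int N}. integral {-pi..pi} (\<lambda>\<theta>. ?h (\<theta> + 2 * pi * of_int l))) \<longlonglongrightarrow>
      integral {-pi..pi} (\<lambda>\<theta>. symbol_f p \<alpha> \<theta> * cos (of_int k * \<theta>))" using M by simp
  have shift: "integral {-pi..pi} (\<lambda>\<theta>. ?h (\<theta> + 2 * pi * of_int l)) = integral {2 * pi * of_int l - pi..2 * pi * of_int l + pi} ?h" for l :: int
    using integral_shift_Icc_real[where f="?h" and c="2 * pi * of_int l" and a="-pi" and b=pi]
    by (simp add: comp_def add.commute)
  have sum: "(\<Sum>l\<in>{-int N..int N}. integral {-pi..pi} (\<lambda>\<theta>. ?h (\<theta> + 2 * pi * of_int l))) = integral {- (2 * pi * real N + pi)..2 * pi * real N + pi} ?h" for N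
  proof (induct N)
    case 0
    show ?case by simp
  next
    case (Suc N)
    have "{- int (Suc N)..int (Suc N)} = insert (- int (Suc N)) (insert (int (Suc N)) {- int N..int N})" by auto
    hence "(\<Sum>l\<in>{-int (Suc N)..int (Suc N)}. integral {-pi..pi} (\<lambda>\<theta>. ?h (\<theta> + 2 * pi * of_int l))) =
       integral {-pi..pi} (\<lambda>\<theta>. ?h (\<theta> + 2 * pi * of_int (- int (Suc N)))) +
       (integral {-pi..pi} (\<lambda>\<theta>. ?h (\<theta> + 2 * pi * of_int (int (Suc N)))) + (\<Sum>l\<in>{-int N..int N}. integral {-pi..pi} (\<lambda>\<theta>. ?h (\<theta> + 2 * pi * of_int l))))"
      by (simp only:) (subst sum.insert, auto)
    also have "\<dots> = integral {2 * pi * of_int (- int (Suc N)) - pi..2 * pi * of_int (- int (Suc N)) + pi} ?h +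
       (integral {2 * pi * of_int (int (Suc N)) - pi..2 * pi * of_int (int (Suc N)) + pi} ?h + integral {- (2 * pi * real N + pi)..2 * pi * real N + pi} ?h)"
      unfolding Suc unfolding shift ..
    also have "\<dots> = integral {- (2 * pi * real (Suc N) + pi)..- (2 * pi * real N + pi)} ?h +
       (integral {2 * pi * real N + pi..2 * pi * real (Suc N) + pi} ?h + integral {- (2 * pi * real N + pi)..2 * pi * real N + pi} ?h)"
      by (simp add: algebra_simps)
    also have "integral {2 * pi * real N + pi..2 * pi * real (Suc N) + pi} ?h + integral {- (2 * pi * real N + pi)..2 * pi * real N + pi} ?h
       = integral {- (2 * pi * real N + pi)..2 * pi * real (Suc N) + pi} ?h"
      by (subst add.commute, rule Henstock_Kurzweil_Integration.integral_combine[OF _ _ integrable_continuous_real[OF hc]]) (auto simp: algebra_simps add_nonneg_nonneg)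
    also have "integral {- (2 * pi * real (Suc N) + pi)..- (2 * pi * real N + pi)} ?h + \<dots> = integral {- (2 * pi * real (Suc N) + pi)..2 * pi * real (Suc N) + pi} ?h"
      by (rule Henstock_Kurzweil_Integration.integral_combine[OF _ _ integrable_continuous_real[OF hc]]) (auto simp: algebra_simps add_nonneg_nonneg)
    finally show ?case .
  qed
  have int: "integrable lborel ?h" using H by (auto simp: has_bochner_integral_iff)
  \<comment> \<open>The windows grow to the whole line; the integrable function itself dominates its
    truncations.\<close>
  have "(\<lambda>N. LINT w|lborel. indicator {- (2 * pi * real N + pi)..2 * pi * real N + pi} w *\<^sub>R ?h w) \<longlonglongrightarrow> (LINT w|lborel. ?h w)"
  proof (rule integral_dominated_convergence[where w="\<lambda>w. norm (?h w)"])
    show "AE w in lborel. (\<lambda>N. indicator {- (2 * pi * real N + pi)..2 * pi * real N + pi} w *\<^sub>R ?h w) \<longlonglongrightarrow> ?h w"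
    proof (intro AE_I2)
      fix w :: real
      obtain N0 :: nat where N0: "\<bar>w\<bar> \<le> real N0" using real_arch_simple by blast
      have "indicator {- (2 * pi * real N + pi)..2 * pi * real N + pi} w *\<^sub>R ?h w = ?h w" if "N \<ge> N0" for N
      proof -
        have "1 * real N \<le> 2 * pi * real N" using pi_ge_two by (intro mult_right_mono) auto
        hence "\<bar>w\<bar> \<le> 2 * pi * real N + pi" using N0 that pi_gt_zero by linarith
        thus ?thesis by (auto simp: indicator_def abs_le_iff)
      qed
      thus "(\<lambda>N. indicator {- (2 * pi * real N + pi)..2 * pi * real N + pi} w *\<^sub>R ?h w) \<longlonglongrightarrow> ?h w"
        by (intro tendsto_eventually) (auto simp: eventually_sequentially)
    qed
  qed (use int in \<open>auto simp: indicator_def\<close>)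
  moreover have "(LINT w|lborel. indicator {- (2 * pi * real N + pi)..2 * pi * real N + pi} w *\<^sub>R ?h w) = integral {- (2 * pi * real N + pi)..2 * pi * real N + pi} ?h" for N
    using set_borel_integral_eq_integral(2)[OF borel_integrable_atLeastAtMost'[OF hc]]
    unfolding set_lebesgue_integral_def by blast
  ultimately have "(\<lambda>N. integral {- (2 * pi * real N + pi)..2 * pi * real N + pi} ?h) \<longlonglongrightarrow> 2 * pi * riesz_card \<alpha> p (of_int k)"
    using H by (simp add: has_bochner_integral_iff)
  thus ?thesis using LIMSEQ_unique[OF M'[unfolded sum]] by blast
qed

text \<open>An even continuous function is a function of \<open>cos \<theta>\<close>, so that the Weierstrass theorem on \<open>[-1, 1]\<close> applies.\<close>
lemma even_zero_cosine_coefficients: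
  fixes g :: "real \<Rightarrow> real"
  assumes g: "continuous_on {-pi..pi} g" and even: "\<And>\<theta>. \<theta> \<in> {-pi..pi} \<Longrightarrow> g (- \<theta>) = g \<theta>"
    and zero: "\<And>k::nat. integral {-pi..pi} (\<lambda>\<theta>. g \<theta> * cos (real k * \<theta>)) = 0"
    and \<theta>: "\<theta> \<in> {-pi..pi}"
  shows "g \<theta> = 0"
proof -
  have ic: "h integrable_on {-pi..pi}" if "continuous_on {-pi..pi} h" for h :: "real \<Rightarrow> real"
    by (rule integrable_continuous_real[OF that])
  have pow: "integral {-pi..pi} (\<lambda>\<theta>. g \<theta> * (cos \<theta> ^ n * cos (real k * \<theta>))) = 0" for n k
  proof (induct n arbitrary: k)
    case 0
    show ?case using zero by simp
  next
    case (Suc n)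
    \<comment> \<open>For \<open>k = 0\<close> the product formula produces the frequency
      \<open>-1\<close>, replaced by \<open>1\<close> since the cosine is even.\<close>
    define j where "j = (if k = 0 then 1 else k - 1)"
    have "cos \<theta> * cos (real k * \<theta>) = (cos (real (k + 1) * \<theta>) + cos (real j * \<theta>)) / 2" for \<theta>
    proof (cases "k = 0")
      case False
      hence "real j * \<theta> = real k * \<theta> - \<theta>" by (simp add: j_def algebra_simps of_nat_diff)
      moreover have "real (k + 1) * \<theta> = real k * \<theta> + \<theta>" by (simp add: algebra_simps)
      ultimately show ?thesis by (simp only: cos_add cos_diff) simp
    qed (simp add: j_def)
    note * = this
    have "g \<theta> * (cos \<theta> ^ Suc n * cos (real k * \<theta>)) = 1/2 * (g \<theta> * (cos \<theta> ^ n * cos (real (k + 1) * \<theta>))) + 1/2 * (g \<theta> * (cos \<theta> ^ n * cos (real j * \<theta>)))" for \<theta>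
    proof -
      have "g \<theta> * (cos \<theta> ^ Suc n * cos (real k * \<theta>)) = g \<theta> * cos \<theta> ^ n * (cos \<theta> * cos (real k * \<theta>))" by simp
      thus ?thesis unfolding * by (simp add: algebra_simps add_divide_distrib)
    qed
    hence "integral {-pi..pi} (\<lambda>\<theta>. g \<theta> * (cos \<theta> ^ Suc n * cos (real k * \<theta>))) =
       integral {-pi..pi} (\<lambda>\<theta>. 1/2 * (g \<theta> * (cos \<theta> ^ n * cos (real (k + 1) * \<theta>))) + 1/2 * (g \<theta> * (cos \<theta> ^ n * cos (real j * \<theta>))))"
      by (simp only:)
    also have "\<dots> = 1/2 * integral {-pi..pi} (\<lambda>\<theta>. g \<theta> * (cos \<theta> ^ n * cos (real (k + 1) * \<theta>))) + 1/2 * integral {-pi..pi} (\<lambda>\<theta>. g \<theta> * (cos \<theta> ^ n * cos (real j * \<theta>)))"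
      by (subst Henstock_Kurzweil_Integration.integral_add) (auto intro!: ic continuous_intros g)
    also have "\<dots> = 0" unfolding Suc by simp
    finally show ?case .
  qed
  have poly: "integral {-pi..pi} (\<lambda>\<theta>. g \<theta> * (\<Sum>i\<le>n. a i * cos \<theta> ^ i)) = 0" for a :: "nat \<Rightarrow> real" and n
  proof -
    have "integral {-pi..pi} (\<lambda>\<theta>. g \<theta> * (\<Sum>i\<le>n. a i * cos \<theta> ^ i)) = integral {-pi..pi} (\<lambda>\<theta>. \<Sum>i\<le>n. a i * (g \<theta> * (cos \<theta> ^ i * cos (real 0 * \<theta>))))"
      by (intro Henstock_Kurzweil_Integration.integral_cong) (simp add: sum_distrib_left mult_ac)
    also have "\<dots> = (\<Sum>i\<le>n. integral {-pi..pi} (\<lambda>\<theta>. a i * (g \<theta> * (cos \<theta> ^ i * cos (real 0 * \<theta>)))))"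
      by (rule integral_sum) (auto intro!: ic continuous_intros g)
    also have "\<dots> = 0" by (intro sum.neutral) (simp only: integral_mult_right pow, simp)
    finally show ?thesis .
  qed
  have Gc: "continuous_on {-1..1} (\<lambda>x. g (arccos x))"
    by (rule continuous_on_compose2[OF g]) (use arccos_lbound arccos_ubound in \<open>auto intro!: continuous_on_arccos' simp: order_trans[of "-pi" 0]\<close>)
  have garc: "g \<theta> = g (arccos (cos \<theta>))" if "\<theta> \<in> {-pi..pi}" for \<theta>
  proof (cases "\<theta> \<ge> 0")
    case True
    thus ?thesis using that by (simp add: arccos_cos)
  next
    case False
    hence "arccos (cos (- \<theta>)) = - \<theta>" using that by (intro arccos_cos) auto
    thus ?thesis using even[OF that] by simp
  qed
  define I where "I = integral {-pi..pi} (\<lambda>\<theta>. \<bar>g \<theta>\<bar>)"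
  have I0: "I \<ge> 0" unfolding I_def by (intro Henstock_Kurzweil_Integration.integral_nonneg ic continuous_intros g) auto
  \<comment> \<open>Polynomials in \<open>cos \<theta>\<close> are orthogonal to \<open>g\<close>,
    so one factor of the squared integral may be replaced by the approximation error.\<close>
  have small: "integral {-pi..pi} (\<lambda>\<theta>. g \<theta> * g \<theta>) \<le> e * I" if e: "e > 0" for e
  proof -
    obtain q where q: "real_polynomial_function q" "\<And>x. x \<in> {-1..1} \<Longrightarrow> \<bar>g (arccos x) - q x\<bar> < e"
      using Stone_Weierstrass_real_polynomial_function[OF compact_Icc Gc e] by auto
    obtain a n where an: "q = (\<lambda>x. \<Sum>i\<le>n. a i * x ^ i)" using q(1) unfolding real_polynomial_function_iff_sum by auto
    have c: "continuous_on {-pi..pi} (\<lambda>\<theta>. q (cos \<theta>))" unfolding an by (intro continuous_intros)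
    have "integral {-pi..pi} (\<lambda>\<theta>. g \<theta> * g \<theta>) = integral {-pi..pi} (\<lambda>\<theta>. g \<theta> * (g \<theta> - q (cos \<theta>)) + g \<theta> * q (cos \<theta>))"
      by (simp add: algebra_simps)
    also have "\<dots> = integral {-pi..pi} (\<lambda>\<theta>. g \<theta> * (g \<theta> - q (cos \<theta>))) + integral {-pi..pi} (\<lambda>\<theta>. g \<theta> * q (cos \<theta>))"
      by (intro Henstock_Kurzweil_Integration.integral_add ic continuous_intros g c)
    also have "integral {-pi..pi} (\<lambda>\<theta>. g \<theta> * q (cos \<theta>)) = 0" unfolding an by (rule poly)
    also have "integral {-pi..pi} (\<lambda>\<theta>. g \<theta> * (g \<theta> - q (cos \<theta>))) \<le> integral {-pi..pi} (\<lambda>\<theta>. e * \<bar>g \<theta>\<bar>)"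
    proof (intro integral_le ic continuous_intros g c)
      fix \<theta> assume "\<theta> \<in> {-pi..pi}"
      hence "\<bar>g \<theta> - q (cos \<theta>)\<bar> \<le> e" using q(2)[of "cos \<theta>"] garc[of \<theta>] by simp
      hence "\<bar>g \<theta>\<bar> * \<bar>g \<theta> - q (cos \<theta>)\<bar> \<le> \<bar>g \<theta>\<bar> * e" by (intro mult_left_mono) auto
      thus "g \<theta> * (g \<theta> - q (cos \<theta>)) \<le> e * \<bar>g \<theta>\<bar>" using abs_ge_self[of "g \<theta> * (g \<theta> - q (cos \<theta>))"] by (simp add: abs_mult mult.commute)
    qed
    also have "\<dots> = e * I" by (simp add: I_def)
    finally show ?thesis by simp
  qed
  have nn: "integral {-pi..pi} (\<lambda>\<theta>. g \<theta> * g \<theta>) \<ge> 0"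
    by (intro Henstock_Kurzweil_Integration.integral_nonneg ic continuous_intros g) auto
  have "integral {-pi..pi} (\<lambda>\<theta>. g \<theta> * g \<theta>) = 0"
  proof (rule ccontr)
    assume "integral {-pi..pi} (\<lambda>\<theta>. g \<theta> * g \<theta>) \<noteq> 0"
    hence J: "integral {-pi..pi} (\<lambda>\<theta>. g \<theta> * g \<theta>) > 0" using nn by simp
    \<comment> \<open>With \<open>e = J / (2 * (I + 1))\<close> for the positive integral
      \<open>J\<close> the estimate becomes \<open>J \<le> J * I / (2 * (I + 1))\<close>, which is
      less than \<open>J\<close>.\<close>
    have "integral {-pi..pi} (\<lambda>\<theta>. g \<theta> * g \<theta>) \<le> integral {-pi..pi} (\<lambda>\<theta>. g \<theta> * g \<theta>) / (I + 1) / 2 * I"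
      using J I0 by (intro small) auto
    also have "\<dots> < integral {-pi..pi} (\<lambda>\<theta>. g \<theta> * g \<theta>)" using J I0 by (auto simp: field_simps intro!: add_nonneg_pos mult_nonneg_nonneg)
    finally show False by simp
  qed
  hence "((\<lambda>\<theta>. g \<theta> * g \<theta>) has_integral 0) (cbox (-pi) pi)"
    using integrable_integral[OF ic[of "\<lambda>\<theta>. g \<theta> * g \<theta>"]] g by (auto intro!: continuous_intros)
  moreover have "\<not> pi \<le> 0" using pi_gt_zero by linarith
  ultimately have "g \<theta> * g \<theta> = 0"
    by (intro has_integral_0_cbox_imp_0[of "-pi" pi "\<lambda>\<theta>. g \<theta> * g \<theta>"]) (use \<theta> g in \<open>auto intro!: continuous_intros\<close>)
  thus ?thesis by simp
qed

text \<open>Both functions are continuous and even and have the cosine coefficients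
  \<open>2 * pi * riesz_card \<alpha> p k\<close>, so their difference vanishes at every point of
  the interval.\<close>

lemma fourier_riesz_card:
  assumes \<alpha>: "1 < \<alpha>" "\<alpha> < 2" and p: "p \<ge> 2" and \<theta>: "\<theta> \<in> {-pi..pi}"
  defines "t \<equiv> \<lambda>m::int. complex_of_real (riesz_card \<alpha> p (of_int m))"
  assumes t: "t abs_summable_on UNIV"
  shows "fourier t \<theta> = of_real (symbol_f p \<alpha> \<theta>)"
proof -
  have ev: "t (- m) = t m" for m unfolding t_def riesz_card_def by (simp add: add.commute)
  have cn: "t (- m) = cnj (t m)" for m using ev[of m] by (simp add: t_def)
  have re: "Im (fourier t \<theta>) = 0" for \<theta> by (rule fourier_real) (rule cn)
  have cont: "continuous_on S (fourier t)" for S by (rule fourier_continuous[OF t])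
  have coeff: "integral {-pi..pi} (\<lambda>\<theta>. Re (fourier t \<theta>) * cos (real k * \<theta>)) = 2 * pi * riesz_card \<alpha> p (real k)" for k
  proof -
    \<comment> \<open>Multiplication by \<open>cis (- (k * \<theta>))\<close> shifts the
      coefficients by \<open>k\<close>, so that the mean value extracts \<open>t k\<close>.\<close>
    let ?u = "\<lambda>m. t (int k + m)"
    have u: "?u abs_summable_on UNIV" using summable_shift_int(1)[OF t, of "int k"] by simp
    have "fourier ?u \<theta> = fourier t \<theta> * cis (- (real k * \<theta>))" for \<theta>
    proof -
      have "fourier t \<theta> = (\<Sum>\<^sub>\<infinity>m. t (int k + m) * cis (of_int (int k + m) * \<theta>))"
        unfolding fourier_def by (rule infsum_shift_int(1)[symmetric])
      hence "fourier t \<theta> * cis (- (real k * \<theta>)) = (\<Sum>\<^sub>\<infinity>m. t (int k + m) * cis (of_int (int k + m) * \<theta>) * cis (- (real k * \<theta>)))"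
        by (simp only: infsum_cmult_left')
      also have "\<dots> = fourier ?u \<theta>"
        unfolding fourier_def by (intro infsum_cong) (simp add: mult.assoc cis_mult algebra_simps)
      finally show ?thesis ..
    qed
    hence "integral {-pi..pi} (\<lambda>\<theta>. fourier t \<theta> * cis (- (real k * \<theta>))) = of_real (2 * pi) * ?u 0"
      using integral_fourier[OF u] ext[of "fourier ?u" "\<lambda>\<theta>. fourier t \<theta> * cis (- (real k * \<theta>))"] by simp
    hence "Re (integral {-pi..pi} (\<lambda>\<theta>. fourier t \<theta> * cis (- (real k * \<theta>)))) = 2 * pi * riesz_card \<alpha> p (real k)"
      by (simp add: t_def)
    moreover have "Re (integral {-pi..pi} (\<lambda>\<theta>. fourier t \<theta> * cis (- (real k * \<theta>)))) = integral {-pi..pi} (\<lambda>\<theta>. Re (fourier t \<theta> * cis (- (real k * \<theta>))))"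
    proof -
      have "(\<lambda>\<theta>. fourier t \<theta> * cis (- (real k * \<theta>))) integrable_on {-pi..pi}"
        by (intro integrable_continuous_real continuous_intros cont)
      from integral_linear[OF this bounded_linear_Re] show ?thesis by (simp add: comp_def)
    qed
    ultimately show ?thesis by (simp add: re)
  qed
  define g where "g = (\<lambda>\<theta>. symbol_f p \<alpha> \<theta> - Re (fourier t \<theta>))"
  have "g \<theta> = 0"
  proof (rule even_zero_cosine_coefficients[OF _ _ _ \<theta>])
    show "continuous_on {-pi..pi} g" unfolding g_def by (intro continuous_intros symbol_f_continuous[OF \<alpha> p] cont)
    show "g (- \<theta>) = g \<theta>" for \<theta> by (simp add: g_def symbol_f_even fourier_even[of t, OF ev])
    fix k :: nat
    have "integral {-pi..pi} (\<lambda>\<theta>. g \<theta> * cos (real k * \<theta>)) = integral {-pi..pi} (\<lambda>\<theta>. symbol_f p \<alpha> \<theta> * cos (of_int (int k) * \<theta>) - Re (fourier t \<theta>) * cos (real k * \<theta>))"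
      by (simp add: g_def algebra_simps)
    also have "\<dots> = 0"
      by (subst Henstock_Kurzweil_Integration.integral_diff)
         (auto intro!: integrable_continuous_real continuous_intros symbol_f_continuous[OF \<alpha> p] cont simp: coeff integral_symbol_f_cos[OF \<alpha> p, of "int k", simplified])
    finally show "integral {-pi..pi} (\<lambda>\<theta>. g \<theta> * cos (real k * \<theta>)) = 0" .
  qed
  thus ?thesis using re by (simp add: g_def complex_eq_iff)
qed

section \<open>Riemann-Liouville derivatives of truncated powers\<close>

definition rl_int :: "real \<Rightarrow> (real \<Rightarrow> real) \<Rightarrow> real \<Rightarrow> real" where
  "rl_int \<alpha> u t = integral {0..t} (\<lambda>y. (t - y) powr (1 - \<alpha>) * u y)"

text \<open>More than an equation for \<open>RL_left\<close>: \<open>deriv\<close> and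
  \<open>integral\<close> return arbitrary values where no derivative or integral exists, and
  neither is additive then. With existence recorded on an open set the notion is linear and local,
  and both differentiations can be carried out.\<close>

definition has_rl :: "real \<Rightarrow> (real \<Rightarrow> real) \<Rightarrow> (real \<Rightarrow> real) \<Rightarrow> real set \<Rightarrow> bool" where
  "has_rl \<alpha> u h S \<longleftrightarrow> open S \<and> (\<forall>t\<in>S. (\<lambda>y. (t - y) powr (1 - \<alpha>) * u y) integrable_on {0..t}) \<and>
     (\<exists>F. \<forall>t\<in>S. (rl_int \<alpha> u has_real_derivative F t) (at t) \<and> (F has_real_derivative Gamma (2 - \<alpha>) * h t) (at t))"

lemma deriv_deriv_eq:
  assumes "open S" "x \<in> S" and F: "\<And>t. t \<in> S \<Longrightarrow> (F has_real_derivative F1 t) (at t)"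
    and F1: "(F1 has_real_derivative D) (at x)"
  shows "deriv (deriv F) x = D"
proof -
  have "(deriv F has_real_derivative D) (at x)"
  proof (rule DERIV_cong_ev[THEN iffD1, OF refl _ refl F1])
    show "\<forall>\<^sub>F t in nhds x. F1 t = deriv F t"
      using eventually_nhds_in_open[OF assms(1,2)] by eventually_elim (metis DERIV_imp_deriv F)
  qed
  thus ?thesis by (rule DERIV_imp_deriv)
qed

lemma has_rl_imp_RL_left:
  assumes "has_rl \<alpha> u h S" "x \<in> S" "\<alpha> < 2"
  shows "RL_left \<alpha> u x = h x"
proof -
  obtain F where F: "open S" "\<And>t. t \<in> S \<Longrightarrow> (rl_int \<alpha> u has_real_derivative F t) (at t)"
    "\<And>t. t \<in> S \<Longrightarrow> (F has_real_derivative Gamma (2 - \<alpha>) * h t) (at t)"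
    using assms(1) unfolding has_rl_def by blast
  have "Gamma (2 - \<alpha>) > 0" using assms(3) by (intro Gamma_real_pos) simp
  moreover have "deriv (deriv (rl_int \<alpha> u)) x = Gamma (2 - \<alpha>) * h x"
    by (rule deriv_deriv_eq[OF F(1) assms(2) F(2) F(3)[OF assms(2)]])
  moreover have "(\<lambda>t. integral {0..t} (\<lambda>y. (t - y) powr (1 - \<alpha>) * u y)) = rl_int \<alpha> u"
    by (simp add: rl_int_def fun_eq_iff)
  ultimately show ?thesis unfolding RL_left_def by simp
qed

text \<open>The substitution \<open>y \<mapsto> 1 - y\<close> turns the right integral into a left
  one; the two signs from the chain rule cancel.\<close>

lemma has_rl_imp_RL_right:
  assumes h: "has_rl \<alpha> (\<lambda>y. u (1 - y)) h S" and x: "1 - x \<in> S" and \<alpha>: "\<alpha> < 2"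
  shows "RL_right \<alpha> u x = h (1 - x)"
proof -
  let ?v = "\<lambda>y. u (1 - y)"
  obtain F where F: "open S" "\<And>t. t \<in> S \<Longrightarrow> (rl_int \<alpha> ?v has_real_derivative F t) (at t)"
    "\<And>t. t \<in> S \<Longrightarrow> (F has_real_derivative Gamma (2 - \<alpha>) * h t) (at t)"
    using h unfolding has_rl_def by blast
  have eq: "(\<lambda>t. integral {t..1} (\<lambda>y. (y - t) powr (1 - \<alpha>) * u y)) = (\<lambda>t. rl_int \<alpha> ?v (1 - t))"
  proof
    fix t :: real
    let ?f = "\<lambda>y. (y - t) powr (1 - \<alpha>) * u y"
    have "integral {t..1} ?f = integral {-1..-t} (\<lambda>y. ?f (- y))"
      using Henstock_Kurzweil_Integration.integral_reflect_real[where f="?f" and a=t and b=1] by simp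
    also have "\<dots> = integral {0..1 - t} ((\<lambda>y. ?f (- y)) \<circ> (+) (- 1))"
      using integral_shift_Icc_real[of 0 "1 - t" "\<lambda>y. ?f (- y)" "- 1"] by simp
    finally show "integral {t..1} ?f = rl_int \<alpha> ?v (1 - t)" by (simp add: rl_int_def comp_def algebra_simps)
  qed
  let ?S = "{t. 1 - t \<in> S}"
  have "open ?S" using open_vimage[OF F(1), of "\<lambda>t. 1 - t"] by (simp add: vimage_def continuous_intros)
  moreover have g: "((\<lambda>t. 1 - t) has_real_derivative -1) (at t)" for t :: real
    by (auto intro!: derivative_eq_intros)
  moreover have "((\<lambda>t. rl_int \<alpha> ?v (1 - t)) has_real_derivative - F (1 - t)) (at t)" if "t \<in> ?S" for t
    using DERIV_chain2[where f="rl_int \<alpha> ?v" and g="\<lambda>t. 1 - t", OF F(2)[of "1 - t"] g[of t]] that by simp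
  moreover have "((\<lambda>t. - F (1 - t)) has_real_derivative Gamma (2 - \<alpha>) * h (1 - x)) (at x)"
    using DERIV_minus[OF DERIV_chain2[where f=F and g="\<lambda>t. 1 - t", OF F(3)[of "1 - x"] g[of x]]] x by simp
  ultimately have "deriv (deriv (\<lambda>t. rl_int \<alpha> ?v (1 - t))) x = Gamma (2 - \<alpha>) * h (1 - x)"
    by (intro deriv_deriv_eq[of ?S]) (use x in auto)
  moreover have "Gamma (2 - \<alpha>) > 0" using \<alpha> by (intro Gamma_real_pos) simp
  ultimately show ?thesis unfolding RL_right_def eq by simp
qed

lemma has_rl_subset:
  assumes "has_rl \<alpha> u h S" "T \<subseteq> S" "open T"
  shows "has_rl \<alpha> u h T"
  using assms unfolding has_rl_def by blast

text \<open>The finite exceptional set \<open>K\<close> is there for the reflected B-splines, whose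
  half-open intervals change sides at the knots.\<close>

lemma has_rl_cong:
  assumes h: "has_rl \<alpha> u h S" and K: "finite K"
    and eq: "\<And>t y. t \<in> S \<Longrightarrow> 0 \<le> y \<Longrightarrow> y \<le> t \<Longrightarrow> y \<notin> K \<Longrightarrow> v y = u y"
    and hk: "\<And>t. t \<in> S \<Longrightarrow> k t = h t"
  shows "has_rl \<alpha> v k S"
proof -
  obtain F where F: "open S" "\<And>t. t \<in> S \<Longrightarrow> (rl_int \<alpha> u has_real_derivative F t) (at t)"
    "\<And>t. t \<in> S \<Longrightarrow> (F has_real_derivative Gamma (2 - \<alpha>) * h t) (at t)"
    "\<And>t. t \<in> S \<Longrightarrow> (\<lambda>y. (t - y) powr (1 - \<alpha>) * u y) integrable_on {0..t}"
    using h unfolding has_rl_def by blast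
  have I: "(\<lambda>y. (t - y) powr (1 - \<alpha>) * v y) integrable_on {0..t}" if "t \<in> S" for t
    by (rule integrable_spike_finite[OF K _ F(4)[OF that]]) (use eq[OF that] in auto)
  have J: "rl_int \<alpha> v t = rl_int \<alpha> u t" if "t \<in> S" for t
    unfolding rl_int_def
    by (rule integral_spike[OF negligible_finite[OF K]]) (use eq[OF that] in auto)
  have "(rl_int \<alpha> v has_real_derivative F t) (at t)" if t: "t \<in> S" for t
  proof (rule DERIV_cong_ev[THEN iffD1, OF refl _ refl F(2)[OF t]])
    show "\<forall>\<^sub>F t in nhds t. rl_int \<alpha> u t = rl_int \<alpha> v t"
      using eventually_nhds_in_open[OF F(1) t] by eventually_elim (simp add: J)
  qed
  thus ?thesis unfolding has_rl_def using F I hk by auto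
qed

lemma has_rl_add:
  assumes "has_rl \<alpha> u h S" "has_rl \<alpha> v k S"
  shows "has_rl \<alpha> (\<lambda>y. u y + v y) (\<lambda>t. h t + k t) S"
proof -
  obtain F where F: "open S" "\<And>t. t \<in> S \<Longrightarrow> (rl_int \<alpha> u has_real_derivative F t) (at t)"
    "\<And>t. t \<in> S \<Longrightarrow> (F has_real_derivative Gamma (2 - \<alpha>) * h t) (at t)"
    "\<And>t. t \<in> S \<Longrightarrow> (\<lambda>y. (t - y) powr (1 - \<alpha>) * u y) integrable_on {0..t}"
    using assms(1) unfolding has_rl_def by blast
  obtain G where G: "\<And>t. t \<in> S \<Longrightarrow> (rl_int \<alpha> v has_real_derivative G t) (at t)"
    "\<And>t. t \<in> S \<Longrightarrow> (G has_real_derivative Gamma (2 - \<alpha>) * k t) (at t)"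
    "\<And>t. t \<in> S \<Longrightarrow> (\<lambda>y. (t - y) powr (1 - \<alpha>) * v y) integrable_on {0..t}"
    using assms(2) unfolding has_rl_def by blast
  have I: "(\<lambda>y. (t - y) powr (1 - \<alpha>) * (u y + v y)) integrable_on {0..t}"
    "rl_int \<alpha> (\<lambda>y. u y + v y) t = rl_int \<alpha> u t + rl_int \<alpha> v t" if "t \<in> S" for t
    using F(4)[OF that] G(3)[OF that]
    by (simp_all add: rl_int_def distrib_left Henstock_Kurzweil_Integration.integrable_add Henstock_Kurzweil_Integration.integral_add)
  have "(rl_int \<alpha> (\<lambda>y. u y + v y) has_real_derivative F t + G t) (at t)" if t: "t \<in> S" for t
  proof (rule DERIV_cong_ev[THEN iffD1, OF refl _ refl DERIV_add[OF F(2)[OF t] G(1)[OF t]]])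
    show "\<forall>\<^sub>F t in nhds t. rl_int \<alpha> u t + rl_int \<alpha> v t = rl_int \<alpha> (\<lambda>y. u y + v y) t"
      using eventually_nhds_in_open[OF F(1) t] by eventually_elim (simp add: I)
  qed
  moreover have "((\<lambda>t. F t + G t) has_real_derivative Gamma (2 - \<alpha>) * (h t + k t)) (at t)" if t: "t \<in> S" for t
    using DERIV_add[OF F(3)[OF t] G(2)[OF t]] by (simp add: distrib_left)
  ultimately show ?thesis unfolding has_rl_def using F(1) I(1)
    by (intro conjI exI[of _ "\<lambda>t. F t + G t"]) auto
qed

lemma has_rl_cmult:
  assumes "has_rl \<alpha> u h S"
  shows "has_rl \<alpha> (\<lambda>y. c * u y) (\<lambda>t. c * h t) S"
proof -
  obtain F where F: "open S" "\<And>t. t \<in> S \<Longrightarrow> (rl_int \<alpha> u has_real_derivative F t) (at t)"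
    "\<And>t. t \<in> S \<Longrightarrow> (F has_real_derivative Gamma (2 - \<alpha>) * h t) (at t)"
    "\<And>t. t \<in> S \<Longrightarrow> (\<lambda>y. (t - y) powr (1 - \<alpha>) * u y) integrable_on {0..t}"
    using assms(1) unfolding has_rl_def by blast
  have e: "(\<lambda>y. (t - y) powr (1 - \<alpha>) * (c * u y)) = (\<lambda>y. c * ((t - y) powr (1 - \<alpha>) * u y))" for t
    by (auto simp: mult_ac)
  have I: "(\<lambda>y. (t - y) powr (1 - \<alpha>) * (c * u y)) integrable_on {0..t}" if "t \<in> S" for t
    unfolding e by (intro integrable_on_mult_right F(4) that)
  have J: "rl_int \<alpha> (\<lambda>y. c * u y) = (\<lambda>t. c * rl_int \<alpha> u t)"
    unfolding rl_int_def e by simp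
  have "((\<lambda>t. c * rl_int \<alpha> u t) has_real_derivative c * F t) (at t)"
    "((\<lambda>t. c * F t) has_real_derivative Gamma (2 - \<alpha>) * (c * h t)) (at t)" if t: "t \<in> S" for t
    using DERIV_cmult[OF F(2)[OF t], of c] DERIV_cmult[OF F(3)[OF t], of c] by (simp_all add: mult_ac)
  thus ?thesis unfolding has_rl_def J using F(1) I by (intro conjI exI[of _ "\<lambda>t. c * F t"]) auto
qed

lemma has_rl_sum:
  assumes "finite I" "open S" "\<And>i. i \<in> I \<Longrightarrow> has_rl \<alpha> (u i) (h i) S"
  shows "has_rl \<alpha> (\<lambda>y. \<Sum>i\<in>I. u i y) (\<lambda>t. \<Sum>i\<in>I. h i t) S"
  using assms(1,3)
proof (induct I rule: finite_induct)
  case empty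
  show ?case using assms(2) by (auto simp: has_rl_def rl_int_def[abs_def] intro!: exI[of _ "\<lambda>_. 0"])
next
  case (insert i I)
  have "has_rl \<alpha> (\<lambda>y. u i y + (\<Sum>i\<in>I. u i y)) (\<lambda>t. h i t + (\<Sum>i\<in>I. h i t)) S"
    using insert by (intro has_rl_add) auto
  thus ?case using insert by simp
qed

lemma rl_int_scale:
  assumes n: "n > 0"
  shows "rl_int \<alpha> (\<lambda>y. u (n * y)) t = n powr (\<alpha> - 2) * rl_int \<alpha> u (n * t)"
    and "(\<lambda>y. (n * t - y) powr (1 - \<alpha>) * u y) integrable_on {0..n * t} \<Longrightarrow> (\<lambda>y. (t - y) powr (1 - \<alpha>) * u (n * y)) integrable_on {0..t}"
proof -
  let ?f = "\<lambda>y. (n * t - y) powr (1 - \<alpha>) * u y"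
  have e: "(t - y) powr (1 - \<alpha>) * u (n * y) = n powr (\<alpha> - 1) * ?f (n * y)" if "y \<in> {0..t}" for y
  proof -
    have "n * t - n * y = n * (t - y)" by (simp add: algebra_simps)
    hence "(n * t - n * y) powr (1 - \<alpha>) = n powr (1 - \<alpha>) * (t - y) powr (1 - \<alpha>)"
      using that n by (simp add: powr_mult)
    hence "n powr (\<alpha> - 1) * ?f (n * y) = (n powr (\<alpha> - 1) * n powr (1 - \<alpha>)) * ((t - y) powr (1 - \<alpha>) * u (n * y))"
      by (simp only: mult_ac)
    moreover have "n powr (\<alpha> - 1) * n powr (1 - \<alpha>) = 1" using n by (simp flip: powr_add)
    ultimately show ?thesis by (simp only: mult_1_left)
  qed
  have st: "integral {0..t} (\<lambda>y. ?f (n * y)) = integral {0..n * t} ?f / n"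
    "(\<lambda>y. ?f (n * y)) integrable_on {0..t} \<longleftrightarrow> ?f integrable_on {0..n * t}"
  proof -
    have hi: "((\<lambda>y. ?f (n * y)) has_integral i /\<^sub>R n) {0..t} \<longleftrightarrow> (?f has_integral i) {0..n * t}" for i
    proof -
      have e: "inverse n * (n * t) = t" "inverse n * 0 = 0" using n by simp_all
      from has_integral_affinity_iff[of n ?f 0 i 0 "n * t"] n show ?thesis
        by (simp only: e DIM_real power_one_right add_0_right diff_0_right real_scaleR_def box_real simp_thms True_implies_equals)
    qed
    show "(\<lambda>y. ?f (n * y)) integrable_on {0..t} \<longleftrightarrow> ?f integrable_on {0..n * t}"
    proof
      assume "(\<lambda>y. ?f (n * y)) integrable_on {0..t}"
      then obtain j where "((\<lambda>y. ?f (n * y)) has_integral j) {0..t}" by blast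
      hence "((\<lambda>y. ?f (n * y)) has_integral (n * j) /\<^sub>R n) {0..t}" using n by (simp add: mult.assoc[symmetric])
      thus "?f integrable_on {0..n * t}" using hi by blast
    qed (use hi in blast)
    show "integral {0..t} (\<lambda>y. ?f (n * y)) = integral {0..n * t} ?f / n"
    proof (cases "?f integrable_on {0..n * t}")
      case True
      from hi[THEN iffD2, OF integrable_integral[OF True]] show ?thesis by (simp add: integral_unique divide_inverse mult.commute)
    next
      case False
      hence "\<not> (\<lambda>y. ?f (n * y)) integrable_on {0..t}"
        using \<open>(\<lambda>y. ?f (n * y)) integrable_on {0..t} \<longleftrightarrow> ?f integrable_on {0..n * t}\<close> by blast
      thus ?thesis using False by (simp add: not_integrable_integral)
    qed
  qed
  have "rl_int \<alpha> (\<lambda>y. u (n * y)) t = integral {0..t} (\<lambda>y. n powr (\<alpha> - 1) * ?f (n * y))"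
    unfolding rl_int_def by (rule Henstock_Kurzweil_Integration.integral_cong) (rule e)
  also have "\<dots> = n powr (\<alpha> - 1) * (integral {0..n * t} ?f / n)" using st(1) by simp
  also have "\<dots> = n powr (\<alpha> - 2) * rl_int \<alpha> u (n * t)"
    using n by (simp add: rl_int_def powr_diff power2_eq_square)
  finally show "rl_int \<alpha> (\<lambda>y. u (n * y)) t = n powr (\<alpha> - 2) * rl_int \<alpha> u (n * t)" .
  assume "?f integrable_on {0..n * t}"
  hence "(\<lambda>y. n powr (\<alpha> - 1) * ?f (n * y)) integrable_on {0..t}" using st(2) by (intro integrable_on_mult_right) blast
  thus "(\<lambda>y. (t - y) powr (1 - \<alpha>) * u (n * y)) integrable_on {0..t}"
    by (rule integrable_eq) (rule e[symmetric])
qed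

text \<open>The substitution contributes \<open>n powr (\<alpha> - 2)\<close> and each
  differentiation another factor \<open>n\<close>. The resulting \<open>n powr \<alpha>\<close> is
  the growth removed by the scaling of the matrices.\<close>

lemma has_rl_scale:
  assumes h: "has_rl \<alpha> u h S" and n: "n > 0"
  shows "has_rl \<alpha> (\<lambda>y. u (n * y)) (\<lambda>t. n powr \<alpha> * h (n * t)) {t. n * t \<in> S}"
proof -
  obtain F where F: "open S" "\<And>t. t \<in> S \<Longrightarrow> (rl_int \<alpha> u has_real_derivative F t) (at t)"
    "\<And>t. t \<in> S \<Longrightarrow> (F has_real_derivative Gamma (2 - \<alpha>) * h t) (at t)"
    "\<And>t. t \<in> S \<Longrightarrow> (\<lambda>y. (t - y) powr (1 - \<alpha>) * u y) integrable_on {0..t}"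
    using h unfolding has_rl_def by blast
  have o: "open {t. n * t \<in> S}" using open_vimage[OF F(1), of "\<lambda>t. n * t"] by (simp add: vimage_def continuous_intros)
  have p: "n powr (\<alpha> - 2) * n * n = n powr \<alpha>" using n by (simp add: powr_diff power2_eq_square)
  have "((\<lambda>t. n powr (\<alpha> - 2) * rl_int \<alpha> u (n * t)) has_real_derivative n powr (\<alpha> - 2) * (F (n * t) * n)) (at t)"
    if "n * t \<in> S" for t
    by (intro DERIV_cmult DERIV_chain2[where f="rl_int \<alpha> u" and g="\<lambda>t. n * t", OF F(2)[OF that]]) (auto intro!: derivative_eq_intros)
  moreover have "((\<lambda>t. n powr (\<alpha> - 2) * (F (n * t) * n)) has_real_derivative Gamma (2 - \<alpha>) * (n powr \<alpha> * h (n * t))) (at t)"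
    if "n * t \<in> S" for t
  proof -
    have "((\<lambda>t. n powr (\<alpha> - 2) * (F (n * t) * n)) has_real_derivative n powr (\<alpha> - 2) * (Gamma (2 - \<alpha>) * h (n * t) * n * n)) (at t)"
      by (intro DERIV_cmult DERIV_cmult_right DERIV_chain2[where f=F and g="\<lambda>t. n * t", OF F(3)[OF that]]) (auto intro!: derivative_eq_intros)
    thus ?thesis unfolding p[symmetric] by (simp add: mult_ac)
  qed
  ultimately show ?thesis unfolding has_rl_def using o F(4) rl_int_scale(2)[OF n, where u=u and \<alpha>=\<alpha>]
    by (intro conjI exI[of _ "\<lambda>t. n powr (\<alpha> - 2) * (F (n * t) * n)"]) (auto simp: rl_int_scale(1)[OF n, abs_def])
qed

text \<open>The left derivative at \<open>x\<close> sees only values of \<open>u\<close> on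
  \<open>[0, t]\<close> for \<open>t\<close> near \<open>x\<close>. This handles splines at the
  right end, evaluated to the left of their support.\<close>

lemma has_rl_zero:
  assumes h: "has_rl \<alpha> u h S" and x: "x \<in> S" "x < c" and z: "\<And>y. 0 \<le> y \<Longrightarrow> y < c \<Longrightarrow> u y = 0" and \<alpha>: "\<alpha> < 2"
  shows "h x = 0"
proof -
  obtain F where F: "open S" "\<And>t. t \<in> S \<Longrightarrow> (rl_int \<alpha> u has_real_derivative F t) (at t)"
    "\<And>t. t \<in> S \<Longrightarrow> (F has_real_derivative Gamma (2 - \<alpha>) * h t) (at t)"
    using h unfolding has_rl_def by blast
  have G: "Gamma (2 - \<alpha>) > 0" using \<alpha> by (intro Gamma_real_pos) simp
  have "rl_int \<alpha> u t = 0" if "t < c" for t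
  proof -
    have "rl_int \<alpha> u t = integral {0..t} (\<lambda>_. 0)"
      unfolding rl_int_def by (rule Henstock_Kurzweil_Integration.integral_cong) (use z that in auto)
    thus ?thesis by simp
  qed
  hence "(rl_int \<alpha> u has_real_derivative 0) (at t)" if "t < c" for t
    by (subst DERIV_cong_ev[OF refl _ refl, of _ "\<lambda>_. 0"])
       (use eventually_nhds_in_open[of "{..<c}" t] that in \<open>auto elim!: eventually_mono\<close>)
  hence F0: "F t = 0" if "t < c" "t \<in> S" for t using DERIV_unique[OF F(2)] that by blast
  have "\<forall>\<^sub>F t in nhds x. F t = 0"
    using eventually_nhds_in_open[OF open_Int[OF open_lessThan F(1)], of x c] x by (auto elim!: eventually_mono simp: F0)
  hence "(F has_real_derivative 0) (at x)" by (subst DERIV_cong_ev[OF refl _ refl, of _ "\<lambda>_. 0"]) auto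
  from DERIV_unique[OF this F(3)[OF x(1)]] G show ?thesis by simp
qed


text \<open>For \<open>m = 0\<close> this is the step function with value \<open>1\<close> at
  \<open>0\<close>, in accordance with the half-open intervals of B-splines of degree
  \<open>0\<close>; \<open>tpowr\<close>, in contrast, vanishes at \<open>0\<close>.\<close>

definition tpow :: "nat \<Rightarrow> real \<Rightarrow> real" where
  "tpow m x = (if x \<ge> 0 then x ^ m else 0)"

text \<open>The form in which the factor arises: a Beta integral differentiated twice. The usual
  quotient of Gamma values is \<open>rl_coeff_eq\<close>.\<close>

definition rl_coeff :: "real \<Rightarrow> nat \<Rightarrow> real" where
  "rl_coeff \<alpha> m = Beta (real m + 1) (2 - \<alpha>) * (real m + 2 - \<alpha>) * (real m + 1 - \<alpha>) / Gamma (2 - \<alpha>)"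

lemma rl_coeff_eq:
  assumes \<alpha>: "1 < \<alpha>" "\<alpha> < 2" and m: "m \<ge> 1"
  shows "rl_coeff \<alpha> m = fact m / Gamma (real m + 1 - \<alpha>)"
proof -
  have p: "real m + 1 - \<alpha> > 0" "2 - \<alpha> > 0" using \<alpha> m by auto
  have ni: "real m + 1 - \<alpha> \<notin> \<int>\<^sub>\<le>\<^sub>0" "real m + 2 - \<alpha> \<notin> \<int>\<^sub>\<le>\<^sub>0" using p nonpos_Ints_nonpos by fastforce+
  have "Gamma (real m + 1 + (2 - \<alpha>)) = (real m + 2 - \<alpha>) * ((real m + 1 - \<alpha>) * Gamma (real m + 1 - \<alpha>))"
  proof -
    have "real m + 1 + (2 - \<alpha>) = real m + 2 - \<alpha> + 1" "real m + 2 - \<alpha> = real m + 1 - \<alpha> + 1" by simp_all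
    thus ?thesis using Gamma_plus1[OF ni(1)] Gamma_plus1[OF ni(2)] by metis
  qed
  moreover have "Gamma (real m + 1) = fact m" using Gamma_fact[of m, where 'a=real] by (simp add: add.commute)
  moreover have "Gamma (2 - \<alpha>) \<noteq> 0" "Gamma (real m + 1 - \<alpha>) \<noteq> 0"
    using Gamma_real_pos[OF p(1)] Gamma_real_pos[OF p(2)] by linarith+
  ultimately show ?thesis using p by (simp add: rl_coeff_def Beta_def)
qed

text \<open>For \<open>t > a\<close> the integral lives on \<open>[a, t]\<close>, and
  \<open>y = a + (t - a) * s\<close> makes it a Beta integral.\<close>

lemma tpow_rl_integral:
  assumes \<alpha>: "1 < \<alpha>" "\<alpha> < 2" and a: "a \<ge> 0"
  shows "((\<lambda>y. (t - y) powr (1 - \<alpha>) * tpow m (y - a)) has_integral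
     Beta (real m + 1) (2 - \<alpha>) * tpowr (real m + 2 - \<alpha>) (t - a)) {0..t}"
proof (cases "t > a")
  case False
  have "((\<lambda>y. (t - y) powr (1 - \<alpha>) * tpow m (y - a)) has_integral 0) {0..t}"
    by (rule has_integral_eq[OF _ has_integral_0]) (use False in \<open>auto simp: tpow_def\<close>)
  thus ?thesis using False by (simp add: tpowr_def)
next
  case True
  define l where "l = t - a"
  have l: "l > 0" using True by (simp add: l_def)
  have t_eq: "t = a + l" by (simp add: l_def)
  let ?B = "Beta (real m + 1) (2 - \<alpha>)"
  let ?b = "\<lambda>s. s powr (real m + 1 - 1) * (1 - s) powr (2 - \<alpha> - 1)"
  have "(?b has_integral ?B) {0..1}" by (rule has_integral_Beta_real) (use \<alpha> in auto)
  hence "((\<lambda>y. ?b (1 / l * y + - a / l)) has_integral l * ?B) {a..t}"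
  proof -
    have e: "(0 - - a / l) /\<^sub>R (1 / l) = a" "(1 - - a / l) /\<^sub>R (1 / l) = a + l" "?B /\<^sub>R (1 / l) ^ DIM(real) = l * ?B"
      using l by (simp_all add: field_simps)
    have "a + l = t" by (simp add: l_def)
    with has_integral_affinity'[of ?b ?B 0 1 "1 / l" "- a / l"] l \<open>(?b has_integral ?B) {0..1}\<close>
    show ?thesis unfolding e by simp
  qed
  hence "((\<lambda>y. l powr (real m + 1 - \<alpha>) * ?b (1 / l * y + - a / l)) has_integral l powr (real m + 1 - \<alpha>) * (l * ?B)) {a..t}"
    by (rule has_integral_mult_right)
  moreover have "l powr (real m + 1 - \<alpha>) * (l * ?B) = ?B * tpowr (real m + 2 - \<alpha>) (t - a)"
  proof -
    have "l powr (real m + 2 - \<alpha>) = l powr (real m + 1 - \<alpha>) * l powr 1"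
      unfolding powr_add[symmetric] by (simp add: algebra_simps)
    thus ?thesis using l by (simp add: tpowr_def l_def[symmetric])
  qed
  ultimately have 1: "((\<lambda>y. l powr (real m + 1 - \<alpha>) * ?b (1 / l * y + - a / l)) has_integral ?B * tpowr (real m + 2 - \<alpha>) (t - a)) {a..t}"
    by simp
  have "((\<lambda>y. (t - y) powr (1 - \<alpha>) * tpow m (y - a)) has_integral ?B * tpowr (real m + 2 - \<alpha>) (t - a)) {a..t}"
  proof (rule has_integral_spike_finite[of "{a, t}", OF _ _ 1])
    fix y assume y: "y \<in> {a..t} - {a, t}"
    have e: "1 / l * y + - a / l = (y - a) / l" "1 - (y - a) / l = (t - y) / l"
      using l t_eq by (simp_all add: field_simps)
    have "?b (1 / l * y + - a / l) = ((y - a) / l) ^ m * ((t - y) / l) powr (1 - \<alpha>)"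
      unfolding e using y l by (simp add: powr_realpow)
    also have "\<dots> = (y - a) ^ m * (t - y) powr (1 - \<alpha>) / (l ^ m * l powr (1 - \<alpha>))"
      using y l by (simp add: power_divide powr_divide)
    also have "l ^ m * l powr (1 - \<alpha>) = l powr (real m + 1 - \<alpha>)"
      using l by (simp add: powr_realpow[symmetric] powr_add[symmetric] add_diff_eq)
    finally show "(t - y) powr (1 - \<alpha>) * tpow m (y - a) = l powr (real m + 1 - \<alpha>) * ?b (1 / l * y + - a / l)"
      using l y by (simp add: tpow_def)
  qed simp
  moreover have "((\<lambda>y. (t - y) powr (1 - \<alpha>) * tpow m (y - a)) has_integral 0) {0..a}"
    by (rule has_integral_spike_finite[of "{a}" _ _ "\<lambda>_. 0"]) (auto simp: tpow_def)
  ultimately have "((\<lambda>y. (t - y) powr (1 - \<alpha>) * tpow m (y - a)) has_integral 0 + ?B * tpowr (real m + 2 - \<alpha>) (t - a)) {0..t}"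
    using a True by (intro has_integral_combine[of 0 a t]) auto
  thus ?thesis by simp
qed

text \<open>Because of \<open>m \<ge> 2\<close> the exponents exceed \<open>1\<close> in both
  differentiations, so that the formula holds across the knot \<open>a\<close> and on the whole
  line.\<close>

lemma has_rl_tpow:
  assumes \<alpha>: "1 < \<alpha>" "\<alpha> < 2" and a: "a \<ge> 0" and m: "m \<ge> 2"
  shows "has_rl \<alpha> (\<lambda>y. tpow m (y - a)) (\<lambda>t. rl_coeff \<alpha> m * tpowr (real m - \<alpha>) (t - a)) UNIV"
proof -
  let ?B = "Beta (real m + 1) (2 - \<alpha>)"
  note I = tpow_rl_integral[OF \<alpha> a]
  have G: "Gamma (2 - \<alpha>) > 0" using \<alpha> by (intro Gamma_real_pos) simp
  have rl: "rl_int \<alpha> (\<lambda>y. tpow m (y - a)) = (\<lambda>t. ?B * tpowr (real m + 2 - \<alpha>) (t - a))"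
    unfolding rl_int_def using I by (intro ext integral_unique)
  have d: "((\<lambda>t. c * tpowr \<beta> (t - a)) has_real_derivative c * (\<beta> * tpowr (\<beta> - 1) (t - a))) (at t)" if "\<beta> > 1" for c \<beta> t
  proof -
    have "((\<lambda>t. t - a) has_real_derivative 1) (at t)" by (auto intro!: derivative_eq_intros)
    from DERIV_cmult[OF DERIV_chain2[where f="tpowr \<beta>" and g="\<lambda>t. t - a", OF tpowr_deriv[OF that, of "t - a"] this], of c]
    show ?thesis by simp
  qed
  have e1: "1 + (real m - \<alpha>) = real m + 1 - \<alpha>" by simp
  have "real m + 2 - \<alpha> > 1" "real m + 1 - \<alpha> > 1" using \<alpha> m by auto
  from d[OF this(1), of ?B] d[OF this(2), of "?B * (real m + 2 - \<alpha>)"]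
  have "(rl_int \<alpha> (\<lambda>y. tpow m (y - a)) has_real_derivative ?B * (real m + 2 - \<alpha>) * tpowr (real m + 1 - \<alpha>) (t - a)) (at t)"
    "((\<lambda>t. ?B * (real m + 2 - \<alpha>) * tpowr (real m + 1 - \<alpha>) (t - a)) has_real_derivative Gamma (2 - \<alpha>) * (rl_coeff \<alpha> m * tpowr (real m - \<alpha>) (t - a))) (at t)" for t
    using G by (simp_all add: rl rl_coeff_def mult.assoc e1)
  thus ?thesis unfolding has_rl_def using has_integral_integrable[OF I]
    by (intro conjI exI[of _ "\<lambda>t. ?B * (real m + 2 - \<alpha>) * tpowr (real m + 1 - \<alpha>) (t - a)"]) auto
qed

text \<open>Here \<open>m\<close> may be \<open>0\<close> or \<open>1\<close>, as multiple knots at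
  \<open>0\<close> require; then the derivative is unbounded as \<open>t\<close> tends to
  \<open>0\<close>, whence the restriction to positive \<open>t\<close>.\<close>

lemma has_rl_power:
  assumes \<alpha>: "1 < \<alpha>" "\<alpha> < 2"
  shows "has_rl \<alpha> (\<lambda>y. y ^ m) (\<lambda>t. rl_coeff \<alpha> m * tpowr (real m - \<alpha>) t) {0<..}"
proof -
  let ?B = "Beta (real m + 1) (2 - \<alpha>)"
  have G: "Gamma (2 - \<alpha>) > 0" using \<alpha> by (intro Gamma_real_pos) simp
  have I: "((\<lambda>y. (t - y) powr (1 - \<alpha>) * y ^ m) has_integral ?B * tpowr (real m + 2 - \<alpha>) t) {0..t}" for t
  proof (rule has_integral_eq)
    show "((\<lambda>y. (t - y) powr (1 - \<alpha>) * tpow m (y - 0)) has_integral ?B * tpowr (real m + 2 - \<alpha>) t) {0..t}"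
      using tpow_rl_integral[OF \<alpha>, of 0 t m] by simp
  qed (auto simp: tpow_def)
  have rl: "rl_int \<alpha> (\<lambda>y. y ^ m) = (\<lambda>t. ?B * tpowr (real m + 2 - \<alpha>) t)"
    unfolding rl_int_def using I by (intro ext integral_unique)
  have d: "((\<lambda>t. c * tpowr \<beta> t) has_real_derivative c * (\<beta> * tpowr (\<beta> - 1) t)) (at t)" if t: "t > 0" for c \<beta> t
  proof -
    have "((\<lambda>t. t powr \<beta>) has_real_derivative \<beta> * t powr (\<beta> - 1)) (at t)"
      using t by (auto intro!: derivative_eq_intros)
    moreover have "\<forall>\<^sub>F y in nhds t. tpowr \<beta> y = y powr \<beta>"
      using eventually_nhds_in_open[of "{0<..}" t] t by (auto elim!: eventually_mono simp: tpowr_def)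
    ultimately have "(tpowr \<beta> has_real_derivative \<beta> * tpowr (\<beta> - 1) t) (at t)"
      using t by (subst DERIV_cong_ev[OF refl _ refl]) (auto simp: tpowr_def)
    thus ?thesis by (rule DERIV_cmult)
  qed
  have e1: "1 + (real m - \<alpha>) = real m + 1 - \<alpha>" by simp
  have "(rl_int \<alpha> (\<lambda>y. y ^ m) has_real_derivative ?B * (real m + 2 - \<alpha>) * tpowr (real m + 1 - \<alpha>) t) (at t)"
    "((\<lambda>t. ?B * (real m + 2 - \<alpha>) * tpowr (real m + 1 - \<alpha>) t) has_real_derivative Gamma (2 - \<alpha>) * (rl_coeff \<alpha> m * tpowr (real m - \<alpha>) t)) (at t)" if "t > 0" for t
    using G d[OF that, of ?B "real m + 2 - \<alpha>"] d[OF that, of "?B * (real m + 2 - \<alpha>)" "real m + 1 - \<alpha>"]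
    by (simp_all add: rl rl_coeff_def mult.assoc e1)
  thus ?thesis unfolding has_rl_def using I
    by (intro conjI exI[of _ "\<lambda>t. ?B * (real m + 2 - \<alpha>) * tpowr (real m + 1 - \<alpha>) t"]) (auto simp: integrable_on_def)
qed

text \<open>Past the support of \<open>u\<close> the kernel is smooth and can be differentiated under the integral.\<close>
lemma has_rl_decay:
  assumes h: "has_rl \<alpha> u h {0<..}" and \<alpha>: "1 < \<alpha>" "\<alpha> < 2" and b: "b \<ge> 0"
    and u: "continuous_on {0..b} u" and z: "\<And>y. y > b \<Longrightarrow> u y = 0"
  shows "\<exists>C\<ge>0. \<forall>x>b. \<bar>h x\<bar> \<le> C * (x - b) powr (- 1 - \<alpha>)"
proof -
  obtain F where F: "\<And>t. t > 0 \<Longrightarrow> (rl_int \<alpha> u has_real_derivative F t) (at t)"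
    "\<And>t. t > 0 \<Longrightarrow> (F has_real_derivative Gamma (2 - \<alpha>) * h t) (at t)"
    using h unfolding has_rl_def by auto
  have G: "Gamma (2 - \<alpha>) > 0" using \<alpha> by (intro Gamma_real_pos) simp
  \<comment> \<open>For \<open>t > b\<close> this is an integral over a fixed interval with a smooth
    kernel. Each differentiation lowers the exponent by one, from \<open>1 - \<alpha>\<close> to
    \<open>- 1 - \<alpha>\<close>.\<close>
  let ?K = "\<lambda>\<beta> t. integral (cbox 0 b) (\<lambda>y. (t - y) powr \<beta> * u y)"
  have dK: "(?K \<beta> has_real_derivative \<beta> * ?K (\<beta> - 1) t) (at t)" if t: "t > b" for \<beta> t
  proof -
    have "(?K \<beta> has_real_derivative integral (cbox 0 b) (\<lambda>y. \<beta> * (t - y) powr (\<beta> - 1) * u y)) (at t within {b<..})"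
    proof (rule leibniz_rule_field_derivative)
      fix x y assume xy: "x \<in> {b<..}" "y \<in> cbox 0 b"
      show "((\<lambda>x. (x - y) powr \<beta> * u y) has_real_derivative \<beta> * (x - y) powr (\<beta> - 1) * u y) (at x within {b<..})"
        using xy by (auto intro!: derivative_eq_intros)
    next
      fix x assume "x \<in> {b<..}"
      thus "(\<lambda>y. (x - y) powr \<beta> * u y) integrable_on cbox 0 b"
        using u by (intro integrable_continuous continuous_intros) auto
    next
      show "continuous_on ({b<..} \<times> cbox 0 b) (\<lambda>(x, y). \<beta> * (x - y) powr (\<beta> - 1) * u y)"
        unfolding split_beta
        by (intro continuous_intros continuous_on_compose2[OF u]) auto
    qed (use t in auto)
    moreover have "(\<lambda>y. \<beta> * (t - y) powr (\<beta> - 1) * u y) = (\<lambda>y. \<beta> * ((t - y) powr (\<beta> - 1) * u y))"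
      by (simp add: mult.assoc)
    ultimately show ?thesis using t at_within_open[of t "{b<..}"] by simp
  qed
  have rl: "rl_int \<alpha> u t = ?K (1 - \<alpha>) t" if t: "t > b" for t
  proof -
    have "(\<lambda>y. (t - y) powr (1 - \<alpha>) * u y) integrable_on cbox 0 b"
      using u t by (intro integrable_continuous continuous_intros) auto
    hence "((\<lambda>y. (t - y) powr (1 - \<alpha>) * u y) has_integral ?K (1 - \<alpha>) t) {0..b}" by (simp add: integrable_integral)
    moreover have "((\<lambda>y. (t - y) powr (1 - \<alpha>) * u y) has_integral 0) {b..t}"
      by (rule has_integral_spike_finite[of "{b}" _ _ "\<lambda>_. 0"]) (use z in auto)
    ultimately have "((\<lambda>y. (t - y) powr (1 - \<alpha>) * u y) has_integral ?K (1 - \<alpha>) t + 0) {0..t}"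
      using b t by (intro has_integral_combine[of 0 b t]) auto
    thus ?thesis by (simp add: rl_int_def integral_unique)
  qed
  have F1: "F t = (1 - \<alpha>) * ?K (- \<alpha>) t" if t: "t > b" for t
  proof -
    have "(rl_int \<alpha> u has_real_derivative (1 - \<alpha>) * ?K (1 - \<alpha> - 1) t) (at t)"
      by (rule DERIV_cong_ev[THEN iffD2, OF refl _ refl dK[OF t]])
         (use eventually_nhds_in_open[of "{b<..}" t] t rl in \<open>auto elim!: eventually_mono\<close>)
    from DERIV_unique[OF F(1) this] t b show ?thesis by simp
  qed
  have h_eq: "Gamma (2 - \<alpha>) * h t = (1 - \<alpha>) * (- \<alpha>) * ?K (- 1 - \<alpha>) t" if t: "t > b" for t
  proof -
    have "(F has_real_derivative (1 - \<alpha>) * (- \<alpha> * ?K (- \<alpha> - 1) t)) (at t)"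
      by (rule DERIV_cong_ev[THEN iffD2, OF refl _ refl DERIV_cmult[OF dK[OF t]]])
         (use eventually_nhds_in_open[of "{b<..}" t] t F1 in \<open>auto elim!: eventually_mono\<close>)
    moreover have "- \<alpha> - 1 = - 1 - \<alpha>" by simp
    ultimately have "Gamma (2 - \<alpha>) * h t = (1 - \<alpha>) * (- \<alpha> * ?K (- 1 - \<alpha>) t)"
      using DERIV_unique[OF F(2)] t b by (metis le_less_trans)
    thus ?thesis by simp
  qed
  obtain M where M: "M > 0" "\<And>y. y \<in> {0..b} \<Longrightarrow> \<bar>u y\<bar> \<le> M"
    using compact_imp_bounded[OF compact_continuous_image[OF u compact_Icc]] unfolding bounded_pos by auto
  have "\<bar>h x\<bar> \<le> (\<alpha> - 1) * \<alpha> * M * b / Gamma (2 - \<alpha>) * (x - b) powr (- 1 - \<alpha>)" if x: "x > b" for x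
  proof -
    have "norm (?K (- 1 - \<alpha>) x) \<le> (x - b) powr (- 1 - \<alpha>) * M * (b - 0)"
      unfolding cbox_interval
    proof (rule integral_bound[OF b])
      show "continuous_on {0..b} (\<lambda>y. (x - y) powr (- 1 - \<alpha>) * u y)"
        using u x by (intro continuous_intros) auto
      fix y assume y: "y \<in> {0..b}"
      show "norm ((x - y) powr (- 1 - \<alpha>) * u y) \<le> (x - b) powr (- 1 - \<alpha>) * M"
        unfolding norm_mult using x y M \<alpha> by (intro mult_mono) (auto intro!: powr_mono2')
    qed
    hence "(\<alpha> - 1) * \<alpha> * \<bar>?K (- 1 - \<alpha>) x\<bar> \<le> (\<alpha> - 1) * \<alpha> * ((x - b) powr (- 1 - \<alpha>) * M * b)"
      using \<alpha> by (intro mult_left_mono) auto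
    moreover have "Gamma (2 - \<alpha>) * \<bar>h x\<bar> = (\<alpha> - 1) * \<alpha> * \<bar>?K (- 1 - \<alpha>) x\<bar>"
      using arg_cong[OF h_eq[OF x], of abs] G \<alpha> by (simp add: abs_mult)
    ultimately show ?thesis using G by (simp add: field_simps)
  qed
  moreover have "(\<alpha> - 1) * \<alpha> * M * b / Gamma (2 - \<alpha>) \<ge> 0" using \<alpha> M b G by simp
  ultimately show ?thesis by blast
qed

section \<open>B-splines\<close>

text \<open>The B-splines in the variable \<open>n * x\<close>. Truncated subtraction yields the
  knots \<open>0, ..., 0, 1, 2, ...\<close> with the multiple knot at \<open>0\<close>; without a
  right end the functions do not depend on \<open>n\<close>.\<close>

fun sspline :: "nat \<Rightarrow> nat \<Rightarrow> nat \<Rightarrow> real \<Rightarrow> real" where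
  "sspline p 0 i x = indicator {real (i - (p + 1))..<real (i + 1 - (p + 1))} x"
| "sspline p (Suc k) i x =
     (x - real (i - (p + 1))) / (real (i + Suc k - (p + 1)) - real (i - (p + 1))) * sspline p k i x
   + (real (i + Suc k + 1 - (p + 1)) - x) / (real (i + Suc k + 1 - (p + 1)) - real (i + 1 - (p + 1)))
       * sspline p k (i + 1) x"

lemma knot_scaled:
  assumes "n > 0" "i \<le> p + n + 1"
  shows "knot p n i = real (i - (p + 1)) / real n"
  using assms by (auto simp: knot_def of_nat_diff)

text \<open>The recursion involves knots up to the index \<open>i + k + 1 \<le> p + n + 1\<close>,
  and up to the first knot with value \<open>1\<close> the two knot sequences agree after
  scaling.\<close>

lemma bspline_conv_sspline:
  assumes n: "n > 0" and "i + k \<le> p + n"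
  shows "bspline p n k i x = sspline p k i (real n * x)"
  using assms(2)
proof (induct k arbitrary: i)
  case 0
  thus ?case using n
    by (simp add: knot_scaled indicator_def field_simps del: One_nat_def)
next
  case (Suc k)
  have r: "(x - a / real n) / (b / real n - a / real n) = (real n * x - a) / (b - a)"
      "(b / real n - x) / (b / real n - a / real n) = (b - real n * x) / (b - a)" for a b :: real
  proof -
    have "b / real n - a / real n = (b - a) / real n" by (simp add: diff_divide_distrib)
    moreover have "x - a / real n = (real n * x - a) / real n" "b / real n - x = (b - real n * x) / real n"
      using n by (simp_all add: field_simps)
    ultimately show "(x - a / real n) / (b / real n - a / real n) = (real n * x - a) / (b - a)"
      "(b / real n - x) / (b / real n - a / real n) = (b - real n * x) / (b - a)" using n by simp_all
  qed
  have kn: "knot p n j = real (j - (p + 1)) / real n" if "j \<le> i + Suc k + 1" for j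
    using that Suc(2) by (intro knot_scaled n) auto
  have "bspline p n k i x = sspline p k i (real n * x)" "bspline p n k (i + 1) x = sspline p k (i + 1) (real n * x)"
    using Suc by auto
  thus ?case unfolding bspline.simps sspline.simps by (simp only: kn r le_add1 add_le_mono order_refl le_add2 trans_le_add1)
qed

lemma knot_symm:
  assumes "n > 0" "j \<le> 2 * p + n + 2"
  shows "knot p n (2 * p + n + 2 - j) = 1 - knot p n j"
  using assms by (auto simp: knot_def of_nat_diff field_simps)

text \<open>The knot sequence is symmetric, and reflection exchanges the two terms of the recursion.
  Knots are excluded because the reflected half-open interval is closed at the other end.\<close>

lemma bspline_reflect:
  assumes n: "n > 0" and "i + k \<le> 2 * p + n + 1" and x: "x \<notin> knot p n ` UNIV"
  shows "bspline p n k i (1 - x) = bspline p n k (2 * p + n + 1 - k - i) x"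
  using assms(2)
proof (induct k arbitrary: i)
  case 0
  define r where "r = 2 * p + n + 1 - i"
  have r: "r = 2 * p + n + 2 - (i + 1)" "r + 1 = 2 * p + n + 2 - i" using 0 by (auto simp: r_def)
  have "knot p n r = 1 - knot p n (i + 1)" unfolding r(1) using 0 by (intro knot_symm n) auto
  moreover have "knot p n (r + 1) = 1 - knot p n i" unfolding r(2) using 0 by (intro knot_symm n) auto
  moreover have "x \<noteq> knot p n r" "x \<noteq> knot p n (r + 1)" using x by auto
  ultimately have "indicator {knot p n i..<knot p n (i + 1)} (1 - x) = (indicator {knot p n r..<knot p n (r + 1)} x :: real)"
    by (auto simp: indicator_def)
  thus ?case by (simp add: r_def)
next
  case (Suc k)
  define r where "r = 2 * p + n + 1 - Suc k - i"
  have r: "2 * p + n + 1 - k - i = r + 1" "2 * p + n + 1 - k - (i + 1) = r" using Suc(2) by (auto simp: r_def)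
  have B: "bspline p n k i (1 - x) = bspline p n k (r + 1) x" "bspline p n k (i + 1) (1 - x) = bspline p n k r x"
    using Suc(1)[of i] Suc(1)[of "i + 1"] Suc(2) r by auto
  have e: "r + Suc k + 1 = 2 * p + n + 2 - i" "r + 1 = 2 * p + n + 2 - (i + Suc k)"
    "r + Suc k = 2 * p + n + 2 - (i + 1)" "r = 2 * p + n + 2 - (i + Suc k + 1)" using Suc(2) by (auto simp: r_def)
  have K: "knot p n (r + Suc k + 1) = 1 - knot p n i"
    unfolding e(1) by (rule knot_symm[OF n]) (use Suc(2) in simp)
  have K': "knot p n (r + 1) = 1 - knot p n (i + Suc k)"
    unfolding e(2) by (rule knot_symm[OF n]) (use Suc(2) in simp)
  have K'': "knot p n (r + Suc k) = 1 - knot p n (i + 1)"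
    unfolding e(3) by (rule knot_symm[OF n]) (use Suc(2) in simp)
  have K2: "knot p n r = 1 - knot p n (i + Suc k + 1)"
    unfolding e(4) by (rule knot_symm[OF n]) (use Suc(2) in simp)
  have "bspline p n (Suc k) i (1 - x) = 
     (1 - x - knot p n i) / (knot p n (i + Suc k) - knot p n i) * bspline p n k (r + 1) x
   + (knot p n (i + Suc k + 1) - (1 - x)) / (knot p n (i + Suc k + 1) - knot p n (i+1)) * bspline p n k r x"
    unfolding bspline.simps B ..
  also have "\<dots> = bspline p n (Suc k) r x"
    unfolding bspline.simps K K' K'' K2 by (simp add: algebra_simps)
  finally show ?case by (simp add: r_def)
qed

lemma sspline_eq_0: "x \<ge> real (i + k + 1 - (p + 1)) \<Longrightarrow> sspline p k i x = 0"
proof (induct k arbitrary: i)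
  case (Suc k)
  have "real (i + k + 1 - (p + 1)) \<le> real (i + Suc k + 1 - (p + 1))" by simp
  hence "sspline p k i x = 0" "sspline p k (i + 1) x = 0"
    using Suc(2) by (intro Suc(1); simp)+
  thus ?case by simp
qed auto

text \<open>The difference of order \<open>k + 1\<close> of the truncated power, divided by
  \<open>k!\<close>: the B-spline with the simple knots \<open>0, ..., k + 1\<close>.\<close>

definition card_spline :: "nat \<Rightarrow> real \<Rightarrow> real" where
  "card_spline k x = (\<Sum>j\<le>k+1. (-1) ^ j * real ((k + 1) choose j) * tpow k (x - real j)) / fact k"

lemma tpow_Suc: "x * tpow k x = tpow (Suc k) x"
  by (simp add: tpow_def)

text \<open>The coefficient \<open>j C(k+1,j) - (k+2-j) C(k+1,j-1)\<close> of \<open>(x - j)\<^sub>+\<^sup>k\<close> vanishes.\<close>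
lemma card_spline_Suc:
  "card_spline (Suc k) x = (x * card_spline k x + (real k + 2 - x) * card_spline k (x - 1)) / (real k + 1)"
proof -
  let ?c = "\<lambda>j. (-1) ^ j * real ((k + 1) choose j)"
  let ?T = "\<lambda>j. tpow k (x - real j)" and ?U = "\<lambda>j. tpow (Suc k) (x - real j)"
  have U: "?U j = (x - real j) * ?T j" for j by (simp add: tpow_Suc)
  have 1: "x * (\<Sum>j\<le>k+1. ?c j * ?T j) = (\<Sum>j\<le>k+1. ?c j * ?U j) + (\<Sum>j\<le>k+1. real j * ?c j * ?T j)"
    unfolding U sum_distrib_left sum.distrib[symmetric] by (intro sum.cong refl) (simp add: algebra_simps)
  have 2: "(real k + 2 - x) * (\<Sum>j\<le>k+1. ?c j * ?T (Suc j)) =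
     - (\<Sum>j\<le>k+1. ?c j * ?U (Suc j)) + (\<Sum>j\<le>k+1. (real k + 1 - real j) * ?c j * ?T (Suc j))"
    unfolding U sum_distrib_left sum.distrib[symmetric] sum_negf[symmetric] by (intro sum.cong refl) (simp add: algebra_simps)
  \<comment> \<open>The summand \<open>j = 0\<close> on the left and \<open>j = k + 1\<close> on the
    right carry the factor \<open>0\<close>; after the index shift the absorption identities reduce
    both binomial products to \<open>(k + 1) * (k choose j)\<close>.\<close>
  have 3: "(\<Sum>j\<le>k+1. real j * ?c j * ?T j) = - (\<Sum>j\<le>k+1. (real k + 1 - real j) * ?c j * ?T (Suc j))"
  proof -
    have "(\<Sum>j\<le>k+1. real j * ?c j * ?T j) = (\<Sum>j\<le>k. real (Suc j) * ?c (Suc j) * ?T (Suc j))"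
      using sum.atMost_Suc_shift[of "\<lambda>j. real j * ?c j * ?T j" k] by simp
    also have "\<dots> = (\<Sum>j\<le>k. - ((real k + 1 - real j) * ?c j * ?T (Suc j)))"
    proof (intro sum.cong refl)
      fix j assume j: "j \<in> {..k}"
      have "Suc j * ((k + 1) choose Suc j) = (k + 1) * (k choose j)"
        using Suc_times_binomial_eq[of k j] by simp
      moreover have "(k + 1 - j) * ((k + 1) choose j) = (k + 1) * (k choose j)"
        using binomial_absorb_comp[of "k + 1" j] by simp
      ultimately have "real (Suc j * ((k + 1) choose Suc j)) = real ((k + 1 - j) * ((k + 1) choose j))" by (simp only:)
      hence "real (Suc j) * real ((k + 1) choose Suc j) = (real k + 1 - real j) * real ((k + 1) choose j)"
      proof -
        have d: "real (k + 1 - j) = real k + 1 - real j" using j by (simp add: of_nat_diff)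
        assume "real (Suc j * ((k + 1) choose Suc j)) = real ((k + 1 - j) * ((k + 1) choose j))"
        thus ?thesis unfolding of_nat_mult d .
      qed
      moreover have "u * ((-1) ^ Suc j * v) * z = - (u' * ((-1) ^ j * v') * z)" if "u * v = u' * v'" for u v u' v' z :: real
      proof -
        have "u * ((-1) ^ Suc j * v) * z = - ((u * v) * ((-1) ^ j * z))" by simp
        thus ?thesis unfolding that by simp
      qed
      ultimately show "real (Suc j) * ?c (Suc j) * ?T (Suc j) = - ((real k + 1 - real j) * ?c j * ?T (Suc j))"
        by blast
    qed
    also have "\<dots> = - (\<Sum>j\<le>k. (real k + 1 - real j) * ?c j * ?T (Suc j))" by (rule sum_negf)
    also have "(\<Sum>j\<le>k. (real k + 1 - real j) * ?c j * ?T (Suc j)) = (\<Sum>j\<le>k+1. (real k + 1 - real j) * ?c j * ?T (Suc j))"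
      by simp
    finally show ?thesis .
  qed
  have sh: "tpow k (x - 1 - real j) = ?T (Suc j)" for j by (simp add: algebra_simps)
  have "x * card_spline k x + (real k + 2 - x) * card_spline k (x - 1) =
      (x * (\<Sum>j\<le>k+1. ?c j * ?T j) + (real k + 2 - x) * (\<Sum>j\<le>k+1. ?c j * ?T (Suc j))) / fact k"
    unfolding card_spline_def sh by (simp only: times_divide_eq_right add_divide_distrib)
  also have "\<dots> = ((\<Sum>j\<le>k+1. ?c j * ?U j) - (\<Sum>j\<le>k+1. ?c j * ?U (Suc j))) / fact k"
    unfolding 1 2 3 by simp
  also have "\<dots> = (\<Sum>j\<le>Suc (k+1). (-1) ^ j * real (Suc (k + 1) choose j) * ?U j) / fact k"
    using choose_Suc_alternating_sum[of "k + 1" "\<lambda>j. ?U j"] by (simp only:)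
  also have "\<dots> = (real k + 1) * card_spline (Suc k) x"
  proof -
    have cs: "card_spline (Suc k) x = (\<Sum>j\<le>Suc (k+1). (-1) ^ j * real (Suc (k + 1) choose j) * ?U j) / ((real k + 1) * fact k)"
      by (simp add: card_spline_def algebra_simps del: sum.atMost_Suc binomial_Suc_Suc)
    have gen: "S / F = c * (S / (c * F))" if "c \<noteq> 0" for S F c :: real using that by simp
    show ?thesis unfolding cs by (rule gen) simp
  qed
  finally show ?thesis by simp
qed

lemma sspline_interior:
  assumes "i \<ge> p + 1"
  shows "sspline p k i x = card_spline k (x - real (i - (p + 1)))"
  using assms
proof (induct k arbitrary: i)
  case 0
  define a where "a = real (i - (p + 1))"
  have "real (i + 1 - (p + 1)) = a + 1" using 0 by (simp add: a_def of_nat_diff)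
  thus ?case unfolding sspline.simps card_spline_def a_def[symmetric]
    by (auto simp: tpow_def indicator_def)
next
  case (Suc k)
  define a where "a = real (i - (p + 1))"
  have e: "real (i + Suc k - (p + 1)) = a + (real k + 1)" "real (i + Suc k + 1 - (p + 1)) = a + (real k + 2)" 
    "real (i + 1 - (p + 1)) = a + 1"
    using Suc(2) by (simp_all add: a_def of_nat_diff)
  have IH: "sspline p k i x = card_spline k (x - a)" "sspline p k (i + 1) x = card_spline k (x - a - 1)"
    using Suc(1)[of i] Suc(1)[of "i + 1"] Suc(2) e(3) by (simp_all add: a_def[symmetric] algebra_simps)
  have "sspline p (Suc k) i x = (x - a) / (real k + 1) * card_spline k (x - a) + (a + (real k + 2) - x) / (real k + 1) * card_spline k (x - a - 1)"
    unfolding sspline.simps a_def[symmetric] e IH by simp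
  also have "\<dots> = ((x - a) * card_spline k (x - a) + (real k + 2 - (x - a)) * card_spline k (x - a - 1)) / (real k + 1)"
    by (simp add: add_divide_distrib diff_divide_distrib algebra_simps)
  also have "\<dots> = card_spline (Suc k) (x - a)" by (rule card_spline_Suc[symmetric])
  finally show ?case by (simp add: a_def)
qed

text \<open>Functions on \<open>[0, \<infinity>)\<close> whose only knots of higher multiplicity are at \<open>0\<close>; this class is
  closed under multiplication by \<open>x\<close>, so for the B-splines only degree \<open>2\<close> has to be examined.\<close>
inductive lspl :: "(real \<Rightarrow> real) \<Rightarrow> bool" where
  power: "lspl (\<lambda>x. x ^ m)"
| tpow: "m \<ge> 2 \<Longrightarrow> a \<ge> 0 \<Longrightarrow> lspl (\<lambda>x. tpow m (x - a))"
| add: "lspl f \<Longrightarrow> lspl g \<Longrightarrow> lspl (\<lambda>x. f x + g x)"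
| cmult: "lspl f \<Longrightarrow> lspl (\<lambda>x. c * f x)"
| cong: "lspl f \<Longrightarrow> (\<And>x. x \<ge> 0 \<Longrightarrow> g x = f x) \<Longrightarrow> lspl g"

text \<open>The counterpart seen from the right: no polynomial part, so that the function vanishes for large arguments.\<close>
inductive rspl :: "(real \<Rightarrow> real) \<Rightarrow> bool" where
  tpow: "m \<ge> 2 \<Longrightarrow> a \<ge> 0 \<Longrightarrow> rspl (\<lambda>x. tpow m (a - x))"
| add: "rspl f \<Longrightarrow> rspl g \<Longrightarrow> rspl (\<lambda>x. f x + g x)"
| cmult: "rspl f \<Longrightarrow> rspl (\<lambda>x. c * f x)"
| cong: "rspl f \<Longrightarrow> (\<And>x. x \<ge> 0 \<Longrightarrow> g x = f x) \<Longrightarrow> rspl g"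

lemma lspl_mult_x: "lspl f \<Longrightarrow> lspl (\<lambda>x. x * f x)"
proof (induct rule: lspl.induct)
  case (power m)
  show ?case using lspl.power[of "Suc m"] by simp
next
  case (tpow m a)
  have "lspl (\<lambda>x. tpow (Suc m) (x - a) + a * tpow m (x - a))"
    using tpow by (intro lspl.intros) auto
  thus ?case by (rule lspl.cong) (simp add: tpow_Suc[symmetric] algebra_simps)
next
  case (add f g)
  thus ?case using lspl.add[OF add(2) add(4)] by (simp add: distrib_left)
next
  case (cmult f c)
  thus ?case using lspl.cmult[OF cmult(2), of c] by (simp add: mult.left_commute)
next
  case (cong f g)
  show ?case by (rule lspl.cong[OF cong(2)]) (simp add: cong(3))
qed

lemma rspl_mult_x: "rspl f \<Longrightarrow> rspl (\<lambda>x. x * f x)"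
proof (induct rule: rspl.induct)
  case (tpow m a)
  have "rspl (\<lambda>x. (-1) * tpow (Suc m) (a - x) + a * tpow m (a - x))"
    using tpow by (intro rspl.intros) auto
  thus ?case by (rule rspl.cong) (simp add: tpow_Suc[symmetric] algebra_simps)
next
  case (add f g)
  thus ?case using rspl.add[OF add(2) add(4)] by (simp add: distrib_left)
next
  case (cmult f c)
  thus ?case using rspl.cmult[OF cmult(2), of c] by (simp add: mult.left_commute)
next
  case (cong f g)
  show ?case by (rule rspl.cong[OF cong(2)]) (simp add: cong(3))
qed

lemma lspl_continuous: "lspl f \<Longrightarrow> continuous_on {0..} f"
proof (induct rule: lspl.induct)
  case (tpow m a)
  have eq: "tpow m (x - a) = max 0 (x - a) ^ m" for x using tpow by (auto simp: tpow_def max_def)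
  show ?case unfolding eq by (intro continuous_intros)
next
  case (cong f g)
  thus ?case using continuous_on_cong[of "{0..}" "{0..}" f g] by auto
qed (auto intro!: continuous_intros)

lemma lspl_has_rl:
  assumes \<alpha>: "1 < \<alpha>" "\<alpha> < 2" 
  shows "lspl f \<Longrightarrow> \<exists>h. has_rl \<alpha> f h {0<..} \<and> continuous_on {0<..} h"
proof (induct rule: lspl.induct)
  case (power m)
  have "continuous_on {0<..} (\<lambda>t. rl_coeff \<alpha> m * tpowr (real m - \<alpha>) t)"
  proof -
    have "continuous_on {0<..} (\<lambda>t. rl_coeff \<alpha> m * t powr (real m - \<alpha>))" by (auto intro!: continuous_intros)
    thus ?thesis by (rule continuous_on_cong[THEN iffD1, rotated -1]) (auto simp: tpowr_def)
  qed
  thus ?case using has_rl_power[OF \<alpha>, of m] by blast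
next
  case (tpow m a)
  have "has_rl \<alpha> (\<lambda>y. tpow m (y - a)) (\<lambda>t. rl_coeff \<alpha> m * tpowr (real m - \<alpha>) (t - a)) {0<..}"
    by (rule has_rl_subset[OF has_rl_tpow]) (use \<alpha> tpow in auto)
  moreover have "continuous_on {0<..} (\<lambda>t. rl_coeff \<alpha> m * tpowr (real m - \<alpha>) (t - a))"
    using \<alpha> tpow by (intro continuous_intros continuous_on_compose2[OF tpowr_continuous[of _ UNIV]]) auto
  ultimately show ?case by blast
next
  case (add f g)
  then obtain h k where "has_rl \<alpha> f h {0<..}" "continuous_on {0<..} h" "has_rl \<alpha> g k {0<..}" "continuous_on {0<..} k" by blast
  thus ?case by (intro exI[of _ "\<lambda>t. h t + k t"] conjI has_rl_add continuous_intros)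
next
  case (cmult f c)
  then obtain h where "has_rl \<alpha> f h {0<..}" "continuous_on {0<..} h" by blast
  thus ?case by (intro exI[of _ "\<lambda>t. c * h t"] conjI has_rl_cmult continuous_intros)
next
  case (cong f g)
  then obtain h where h: "has_rl \<alpha> f h {0<..}" "continuous_on {0<..} h" by blast
  have "has_rl \<alpha> g h {0<..}" by (rule has_rl_cong[OF h(1), of "{}"]) (use cong(3) in auto)
  thus ?case using h(2) by blast
qed

text \<open>The function is placed at the right end of \<open>[0, 1]\<close>, and \<open>h\<close>
  depends only on the scaled distance to that end, so it is the same for all \<open>n\<close>. The
  threshold \<open>N\<close> ensures that the transported knots \<open>1 - a / n\<close> are
  nonnegative.\<close>

lemma rspl_has_rl:
  assumes \<alpha>: "1 < \<alpha>" "\<alpha> < 2" 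
  shows "rspl f \<Longrightarrow> \<exists>h N. continuous_on UNIV h \<and> (\<forall>n\<ge>N. n > 0 \<longrightarrow>
      has_rl \<alpha> (\<lambda>y. f (real n * (1 - y))) (\<lambda>t. real n powr \<alpha> * h (real n * (1 - t))) {..<1})"
proof (induct rule: rspl.induct)
  case (tpow m a)
  define h where "h = (\<lambda>w. rl_coeff \<alpha> m * tpowr (real m - \<alpha>) (a - w))"
  have "has_rl \<alpha> (\<lambda>y. tpow m (a - real n * (1 - y))) (\<lambda>t. real n powr \<alpha> * h (real n * (1 - t))) {..<1}"
    if n: "n \<ge> nat \<lceil>a\<rceil>" "n > 0" for n
  proof -
    have "real n \<ge> a" using n by linarith
    hence "0 \<le> 1 - a / real n" using n by (simp add: field_simps)
    from has_rl_cmult[OF has_rl_tpow[OF \<alpha> this tpow(1)], of "real n ^ m"]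
    have "has_rl \<alpha> (\<lambda>y. real n ^ m * tpow m (y - (1 - a / real n))) (\<lambda>t. real n ^ m * (rl_coeff \<alpha> m * tpowr (real m - \<alpha>) (t - (1 - a / real n)))) {..<1}"
      by (rule has_rl_subset) auto
    thus ?thesis
    proof (rule has_rl_cong[of _ _ _ _ "{}"])
      have e: "a - real n * (1 - y) = real n * (y - (1 - a / real n))" for y using n by (simp add: field_simps)
      show "tpow m (a - real n * (1 - y)) = real n ^ m * tpow m (y - (1 - a / real n))" for y
        unfolding e using n by (auto simp: tpow_def zero_le_mult_iff power_mult_distrib)
      fix t
      have "real n powr \<alpha> * tpowr (real m - \<alpha>) (real n * s) = real n ^ m * tpowr (real m - \<alpha>) s" for s
        using n by (auto simp: tpowr_def zero_less_mult_iff powr_mult powr_diff powr_realpow)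
      thus "real n powr \<alpha> * h (real n * (1 - t)) = real n ^ m * (rl_coeff \<alpha> m * tpowr (real m - \<alpha>) (t - (1 - a / real n)))"
        unfolding h_def e by (simp only: mult.left_commute)
    qed auto
  qed
  moreover have "continuous_on UNIV h" unfolding h_def
    using \<alpha> tpow by (intro continuous_intros continuous_on_compose2[OF tpowr_continuous[of _ UNIV]]) auto
  ultimately show ?case by blast
next
  case (add f g)
  then obtain h k M N where *: "continuous_on UNIV h" "continuous_on UNIV k"
    "\<And>n. n \<ge> N \<Longrightarrow> n > 0 \<Longrightarrow> has_rl \<alpha> (\<lambda>y. f (real n * (1 - y))) (\<lambda>t. real n powr \<alpha> * h (real n * (1 - t))) {..<1}"
    "\<And>n. n \<ge> M \<Longrightarrow> n > 0 \<Longrightarrow> has_rl \<alpha> (\<lambda>y. g (real n * (1 - y))) (\<lambda>t. real n powr \<alpha> * k (real n * (1 - t))) {..<1}" by metis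
  show ?case
    using *(1,2) has_rl_add[OF *(3,4)] 
    by (intro exI[of _ "\<lambda>t. h t + k t"] exI[of _ "max M N"] conjI continuous_intros) (auto simp: distrib_left)
next
  case (cmult f c)
  then obtain h N where *: "continuous_on UNIV h"
    "\<And>n. n \<ge> N \<Longrightarrow> n > 0 \<Longrightarrow> has_rl \<alpha> (\<lambda>y. f (real n * (1 - y))) (\<lambda>t. real n powr \<alpha> * h (real n * (1 - t))) {..<1}" by metis
  show ?case
    using *(1) has_rl_cmult[OF *(2), of _ c] 
    by (intro exI[of _ "\<lambda>t. c * h t"] exI[of _ N] conjI continuous_intros) (auto simp: mult.left_commute)
next
  case (cong f g)
  then obtain h N where *: "continuous_on UNIV h"
    "\<And>n. n \<ge> N \<Longrightarrow> n > 0 \<Longrightarrow> has_rl \<alpha> (\<lambda>y. f (real n * (1 - y))) (\<lambda>t. real n powr \<alpha> * h (real n * (1 - t))) {..<1}" by metis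
  have "has_rl \<alpha> (\<lambda>y. g (real n * (1 - y))) (\<lambda>t. real n powr \<alpha> * h (real n * (1 - t))) {..<1}" if "n \<ge> N" "n > 0" for n
    by (rule has_rl_cong[OF *(2)[OF that], of "{}"]) (use cong(3) that in auto)
  thus ?case using *(1) by blast
qed

lemma lspl_minus: "lspl f \<Longrightarrow> lspl g \<Longrightarrow> lspl (\<lambda>x. f x - g x)"
  using lspl.add[OF _ lspl.cmult[of g "-1"]] by simp

lemma rspl_minus: "rspl f \<Longrightarrow> rspl g \<Longrightarrow> rspl (\<lambda>x. f x - g x)"
  using rspl.add[OF _ rspl.cmult[of g "-1"]] by simp

lemma lspl_rspl_card_spline_2:
  assumes "a \<ge> 0"
  shows "lspl (\<lambda>x. card_spline 2 (x - a))" "rspl (\<lambda>x. card_spline 2 (x - a))"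
proof -
  have c: "card_spline 2 y = 1/2 * (tpow 2 y - 3 * tpow 2 (y - 1) + 3 * tpow 2 (y - 2) - tpow 2 (y - 3))" for y
    unfolding card_spline_def by (simp add: numeral_2_eq_2 numeral_3_eq_3 diff_diff_eq)
  have "lspl (\<lambda>x. 1/2 * (tpow 2 (x - a) - 3 * tpow 2 (x - (a + 1)) + 3 * tpow 2 (x - (a + 2)) - tpow 2 (x - (a + 3))))"
    using assms by (intro lspl.cmult lspl.add lspl_minus lspl.tpow) auto
  thus "lspl (\<lambda>x. card_spline 2 (x - a))" by (simp add: c diff_diff_eq)
  have "rspl (\<lambda>x. 1/2 * (tpow 2 (a + 3 - x) - 3 * tpow 2 (a + 2 - x) + 3 * tpow 2 (a + 1 - x) - tpow 2 (a - x)))"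
    using assms by (intro rspl.cmult rspl.add rspl_minus rspl.tpow) auto
  thus "rspl (\<lambda>x. card_spline 2 (x - a))"
  proof (rule rspl.cong)
    fix x :: real
    define y where "y = x - a"
    have e: "a + 3 - x = 3 - y" "a + 2 - x = 2 - y" "a + 1 - x = 1 - y" "a - x = - y" by (auto simp: y_def)
    \<comment> \<open>Passing to the reflected truncated powers leaves a third difference of
      \<open>z\<^sup>2\<close>, which is \<open>0\<close>.\<close>
    have "tpow 2 z = z\<^sup>2 - tpow 2 (- z)" for z by (auto simp: tpow_def)
    from this[of y] this[of "y - 1"] this[of "y - 2"] this[of "y - 3"]
    show "card_spline 2 (x - a) = 1/2 * (tpow 2 (a + 3 - x) - 3 * tpow 2 (a + 2 - x) + 3 * tpow 2 (a + 1 - x) - tpow 2 (a - x))"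
      unfolding c e y_def[symmetric] by (simp add: power2_eq_square algebra_simps)
  qed
qed

text \<open>The four knots involved are \<open>0, 0, 0, 0\<close> in the first case,
  \<open>0, 0, 0, 1\<close> for the index \<open>p - 1\<close>, and \<open>0, 0, 1, 2\<close> for
  the index \<open>p\<close>.\<close>

lemma sspline_2_boundary:
  assumes p: "p \<ge> 1"
  shows "i + 2 \<le> p \<Longrightarrow> sspline p 2 i x = 0"
    and "0 \<le> x \<Longrightarrow> sspline p 2 (p - 1) x = tpow 2 (1 - x)"
    and "0 \<le> x \<Longrightarrow> sspline p 2 p x = 1/2 * tpow 2 (2 - x) - 2 * tpow 2 (1 - x)"
  using p by (auto simp: numeral_2_eq_2 indicator_def tpow_def field_simps split: if_splits)

lemma lspl_rspl_sspline_2: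
  assumes p: "p \<ge> 1"
  shows "lspl (sspline p 2 i) \<and> rspl (sspline p 2 i)"
proof -
  consider "i + 2 \<le> p" | "i = p - 1" | "i = p" | "i \<ge> p + 1" by linarith
  thus ?thesis
  proof cases
    case 1
    have "lspl (\<lambda>x. 0 * x ^ 0)" "rspl (\<lambda>x. 0 * tpow 2 (0 - x))" by (intro lspl.intros rspl.intros; simp)+
    thus ?thesis using sspline_2_boundary(1)[OF p 1] by (auto intro: lspl.cong rspl.cong)
  next
    case 2
    have "lspl (\<lambda>x. 1 * x ^ 0 + (-2) * x ^ 1 + 1 * x ^ 2 - tpow 2 (x - 1))" 
      by (intro lspl.add lspl_minus lspl.cmult lspl.tpow lspl.power) auto
    hence "lspl (sspline p 2 i)"
      by (rule lspl.cong) (use sspline_2_boundary(2)[OF p] 2 in \<open>auto simp: tpow_def power2_eq_square algebra_simps\<close>)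
    moreover have "rspl (\<lambda>x. tpow 2 (1 - x))" by (intro rspl.tpow) auto
    hence "rspl (sspline p 2 i)" by (rule rspl.cong) (use sspline_2_boundary(2)[OF p] 2 in auto)
    ultimately show ?thesis by blast
  next
    case 3
    have "lspl (\<lambda>x. 2 * x ^ 1 + (- 3/2) * x ^ 2 + 2 * tpow 2 (x - 1) - 1/2 * tpow 2 (x - 2))" 
      by (intro lspl.add lspl_minus lspl.cmult lspl.tpow lspl.power) auto
    hence "lspl (sspline p 2 i)"
      by (rule lspl.cong) (auto simp: 3 sspline_2_boundary(3)[OF p] tpow_def power2_eq_square field_simps)
    moreover have "rspl (\<lambda>x. 1/2 * tpow 2 (2 - x) - 2 * tpow 2 (1 - x))" by (intro rspl_minus rspl.cmult rspl.tpow) auto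
    hence "rspl (sspline p 2 i)" by (rule rspl.cong) (use sspline_2_boundary(3)[OF p] 3 in auto)
    ultimately show ?thesis by blast
  next
    case 4
    have "sspline p 2 i = (\<lambda>x. card_spline 2 (x - real (i - (p + 1))))" using sspline_interior[OF 4] by auto
    thus ?thesis using lspl_rspl_card_spline_2[of "real (i - (p + 1))"] by simp
  qed
qed

lemma lspl_rspl_sspline:
  assumes p: "p \<ge> 1" and k: "k \<ge> 2"
  shows "lspl (sspline p k i) \<and> rspl (sspline p k i)"
  using k
proof (induct k arbitrary: i rule: dec_induct)
  case base
  show ?case by (rule lspl_rspl_sspline_2[OF p])
next
  case (step k)
  let ?a = "real (i - (p + 1))" and ?b = "real (i + Suc k - (p + 1))" and ?c = "real (i + Suc k + 1 - (p + 1))" and ?d = "real (i + 1 - (p + 1))"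
  let ?f = "sspline p k i" and ?g = "sspline p k (i + 1)"
  have e: "sspline p (Suc k) i x = (1 / (?b - ?a) * (x * ?f x) + (- ?a / (?b - ?a)) * ?f x) + ((- 1 / (?c - ?d)) * (x * ?g x) + ?c / (?c - ?d) * ?g x)" for x
    unfolding sspline.simps by (simp add: diff_divide_distrib algebra_simps)
  have "lspl (\<lambda>x. (1 / (?b - ?a) * (x * ?f x) + (- ?a / (?b - ?a)) * ?f x) + ((- 1 / (?c - ?d)) * (x * ?g x) + ?c / (?c - ?d) * ?g x))"
    using step(3)[of i] step(3)[of "i + 1"] by (intro lspl.add lspl.cmult lspl_mult_x) auto
  moreover have "rspl (\<lambda>x. (1 / (?b - ?a) * (x * ?f x) + (- ?a / (?b - ?a)) * ?f x) + ((- 1 / (?c - ?d)) * (x * ?g x) + ?c / (?c - ?d) * ?g x))"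
    using step(3)[of i] step(3)[of "i + 1"] by (intro rspl.add rspl.cmult rspl_mult_x) auto
  ultimately show ?case using e by (metis (no_types, lifting) lspl.cong rspl.cong)
qed

section \<open>The collocation matrix\<close>

text \<open>An inequality of Peetre type, from \<open>1 + |y| \<le> (1 + c) * (1 + |x|)\<close>. It
  allows bounded displacements of the argument at the price of a constant.\<close>

lemma powr_shift_bound:
  assumes "\<bar>x - y\<bar> \<le> c" "s \<ge> (0::real)"
  shows "(1 + \<bar>x\<bar>) powr (- s) \<le> (1 + c) powr s * (1 + \<bar>y\<bar>) powr (- s)"
proof -
  have c: "c \<ge> 0" using assms(1) by linarith
  have "1 + \<bar>y\<bar> \<le> 1 + (\<bar>x\<bar> + c)" using assms(1) by linarith
  also have "\<dots> \<le> (1 + c) * (1 + \<bar>x\<bar>)" using c by (simp add: algebra_simps)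
  finally have "(1 + \<bar>y\<bar>) powr s \<le> ((1 + c) * (1 + \<bar>x\<bar>)) powr s" using assms(2) by (intro powr_mono2) auto
  also have "\<dots> = (1 + c) powr s * (1 + \<bar>x\<bar>) powr s" by (rule powr_mult)
  finally show ?thesis by (simp add: powr_minus field_simps)
qed

lemma decay_bound:
  assumes h: "continuous_on {e..b + 1} h" and b: "b \<ge> 0" and s: "s > 0" and C0: "C0 \<ge> 0"
    and d: "\<And>x. x > b \<Longrightarrow> \<bar>h x\<bar> \<le> C0 * (x - b) powr (- s)"
  shows "\<exists>C\<ge>0. \<forall>x\<ge>e. \<bar>h x :: real\<bar> \<le> C * (1 + \<bar>x - b\<bar>) powr (- s)"
proof -
  obtain M where M: "M > 0" "\<And>y. y \<in> {e..b + 1} \<Longrightarrow> \<bar>h y\<bar> \<le> M"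
    using compact_imp_bounded[OF compact_continuous_image[OF h compact_Icc]] unfolding bounded_pos by auto
  \<comment> \<open>An upper bound for \<open>1 + |x - b|\<close> on \<open>[e, b + 1]\<close>,
    where \<open>h\<close> is merely bounded. Beyond \<open>b + 1\<close> the factor
    \<open>2\<close> comes from \<open>(1 + (x - b)) / 2 \<le> x - b\<close>.\<close>
  define R where "R = 1 + (1 + b + \<bar>e\<bar>)"
  show ?thesis
  proof (intro exI[of _ "M * R powr s + C0 * 2 powr s"] conjI allI impI)
    show "0 \<le> M * R powr s + C0 * 2 powr s" using M C0 by simp
    fix x assume x: "x \<ge> e"
    show "\<bar>h x\<bar> \<le> (M * R powr s + C0 * 2 powr s) * (1 + \<bar>x - b\<bar>) powr (- s)"
    proof (cases "x \<le> b + 1")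
      case True
      have "1 \<le> R powr s * (1 + \<bar>x - b\<bar>) powr (- s)"
        using powr_shift_bound[of 0 "x - b" "1 + b + \<bar>e\<bar>" s] True x b s by (simp add: R_def)
      hence "M * 1 \<le> M * (R powr s * (1 + \<bar>x - b\<bar>) powr (- s))" using M(1) by (intro mult_left_mono) auto
      moreover have "0 \<le> C0 * 2 powr s * (1 + \<bar>x - b\<bar>) powr (- s)" using C0 by simp
      moreover have "\<bar>h x\<bar> \<le> M" using True x by (intro M(2)) auto
      ultimately show ?thesis by (simp add: algebra_simps)
    next
      case False
      have "(x - b) powr (- s) \<le> ((1 + \<bar>x - b\<bar>) / 2) powr (- s)" using False s by (intro powr_mono2') auto
      also have "\<dots> = 2 powr s * (1 + \<bar>x - b\<bar>) powr (- s)" by (simp add: powr_divide powr_minus field_simps)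
      finally have "C0 * (x - b) powr (- s) \<le> C0 * (2 powr s * (1 + \<bar>x - b\<bar>) powr (- s))" using C0 by (intro mult_left_mono)
      moreover have "\<bar>h x\<bar> \<le> C0 * (x - b) powr (- s)" using False by (intro d) auto
      moreover have "0 \<le> M * R powr s * (1 + \<bar>x - b\<bar>) powr (- s)" using M by simp
      ultimately show ?thesis by (simp add: algebra_simps)
    qed
  qed
qed

text \<open>Justifies \<open>card_rl\<close>: each truncated power is differentiated separately, and
  \<open>rl_coeff \<alpha> p / fact p\<close> is the reciprocal Gamma value in its
  definition.\<close>

lemma card_spline_has_rl:
  assumes \<alpha>: "1 < \<alpha>" "\<alpha> < 2" and p: "p \<ge> 2" and a: "a \<ge> 0"
  shows "has_rl \<alpha> (\<lambda>x. card_spline p (x - a)) (\<lambda>t. card_rl \<alpha> p (t - a)) UNIV"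
proof -
  let ?c = "\<lambda>j. (-1) ^ j * real ((p + 1) choose j)"
  have "has_rl \<alpha> (\<lambda>x. 1 / fact p * (\<Sum>j\<le>p+1. ?c j * tpow p (x - (a + real j)))) 
     (\<lambda>t. 1 / fact p * (\<Sum>j\<le>p+1. ?c j * (rl_coeff \<alpha> p * tpowr (real p - \<alpha>) (t - (a + real j))))) UNIV"
    using \<alpha> p a by (intro has_rl_cmult has_rl_sum has_rl_tpow) auto
  thus ?thesis
  proof (rule has_rl_cong[of _ _ _ _ "{}"])
    fix t
    have "1 / fact p * (\<Sum>j\<le>p+1. ?c j * (rl_coeff \<alpha> p * tpowr (real p - \<alpha>) (t - (a + real j)))) =
        rl_coeff \<alpha> p / fact p * (\<Sum>j\<le>p+1. ?c j * tpowr (real p - \<alpha>) (t - a - real j))"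
      unfolding sum_distrib_left by (intro sum.cong refl) (simp add: diff_diff_eq mult_ac)
    thus "card_rl \<alpha> p (t - a) = 1 / fact p * (\<Sum>j\<le>p+1. ?c j * (rl_coeff \<alpha> p * tpowr (real p - \<alpha>) (t - (a + real j))))"
      using rl_coeff_eq[OF \<alpha>, of p] p by (simp add: card_rl_def)
  qed (auto simp: card_spline_def diff_diff_eq)
qed

text \<open>The spline of degree \<open>p\<close> and index \<open>i\<close> vanishes from
  \<open>i\<close> on, so the decay is measured from the right end of the support.\<close>

lemma sspline_decay:
  assumes \<alpha>: "1 < \<alpha>" "\<alpha> < 2" and p: "p \<ge> 2" 
    and h: "has_rl \<alpha> (sspline p p i) h {0<..}" and c: "continuous_on {e..} h" and e: "e \<ge> 0"
  shows "\<exists>C\<ge>0. \<forall>z\<ge>e. \<bar>h z\<bar> \<le> C * (1 + \<bar>z - real i\<bar>) powr (- (1 + \<alpha>))"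
proof -
  have l: "lspl (sspline p p i)" using lspl_rspl_sspline[of p p i] p by auto
  obtain C0 where C0: "C0 \<ge> 0" "\<And>x. x > real i \<Longrightarrow> \<bar>h x\<bar> \<le> C0 * (x - real i) powr (- 1 - \<alpha>)"
    using has_rl_decay[OF h \<alpha>, of "real i"] continuous_on_subset[OF lspl_continuous[OF l], of "{0..real i}"]
      sspline_eq_0[of i p p] by force
  have "- 1 - \<alpha> = - (1 + \<alpha>)" by simp
  with C0 have C0': "\<bar>h x\<bar> \<le> C0 * (x - real i) powr (- (1 + \<alpha>))" if "x > real i" for x using that by metis
  show ?thesis
    by (rule decay_bound[OF continuous_on_subset[OF c] _ _ C0(1) C0']) (use \<alpha> in auto)
qed

lemma card_rl_continuous:
  assumes \<alpha>: "1 < \<alpha>" "\<alpha> < 2" and p: "p \<ge> 2"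
  shows "continuous_on S (card_rl \<alpha> p)"
  unfolding card_rl_def using \<alpha> p
  by (intro continuous_intros continuous_on_compose2[OF tpowr_continuous[of _ UNIV]]) (auto simp: Gamma_eq_zero_iff intro!: continuous_intros)

lemma card_rl_bound:
  assumes \<alpha>: "1 < \<alpha>" "\<alpha> < 2" and p: "p \<ge> 2"
  shows "\<exists>C\<ge>0. \<forall>x. \<bar>card_rl \<alpha> p x\<bar> \<le> C * (1 + \<bar>x - (real p + 1)\<bar>) powr (- (1 + \<alpha>))"
proof -
  have "sspline p p (p + 1) = (\<lambda>x. card_spline p (x - 0))" using sspline_interior[of p "p + 1"] by auto
  hence "has_rl \<alpha> (sspline p p (p + 1)) (card_rl \<alpha> p) {0<..}"
    using has_rl_subset[OF card_spline_has_rl[OF \<alpha> p, of 0]] by simp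
  from sspline_decay[OF \<alpha> p this card_rl_continuous[OF \<alpha> p], of 0]
  obtain C where C: "C \<ge> 0" "\<And>x. x \<ge> 0 \<Longrightarrow> \<bar>card_rl \<alpha> p x\<bar> \<le> C * (1 + \<bar>x - (real p + 1)\<bar>) powr (- (1 + \<alpha>))"
    by (auto simp: add.commute)
  have "card_rl \<alpha> p x = 0" if "x < 0" for x
  proof -
    have "tpowr (real p - \<alpha>) (x - real j) = 0" for j using that by (simp add: tpowr_def)
    thus ?thesis by (simp add: card_rl_def)
  qed
  hence "\<bar>card_rl \<alpha> p x\<bar> \<le> C * (1 + \<bar>x - (real p + 1)\<bar>) powr (- (1 + \<alpha>))" for x
    using C by (cases "x \<ge> 0") auto
  thus ?thesis using C(1) by blast
qed

text \<open>The derivative may be unbounded near \<open>0\<close>; the lower limit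
  \<open>1 / p\<close> is the distance that the scaled collocation points keep from the
  ends.\<close>

lemma left_boundary_bound:
  assumes \<alpha>: "1 < \<alpha>" "\<alpha> < 2" and p: "p \<ge> 2"
  shows "\<exists>h C. C \<ge> 0 \<and> has_rl \<alpha> (sspline p p i) h {0<..} \<and>
     (\<forall>z\<ge>1 / real p. \<bar>h z\<bar> \<le> C * (1 + \<bar>z - real i\<bar>) powr (- (1 + \<alpha>)))"
proof -
  have "lspl (sspline p p i)" using lspl_rspl_sspline[of p p i] p by auto
  from lspl_has_rl[OF \<alpha> this] obtain h where h: "has_rl \<alpha> (sspline p p i) h {0<..}" "continuous_on {0<..} h" by blast
  have "continuous_on {1 / real p..} h" by (rule continuous_on_subset[OF h(2)]) (use p in \<open>auto intro: less_le_trans[of 0 "1 / real p"]\<close>)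
  from sspline_decay[OF \<alpha> p h(1) this] h(1) show ?thesis by auto
qed

text \<open>Here \<open>w\<close> is the scaled distance to the right end. A bound on
  \<open>{0..i}\<close> suffices, since at larger distance the support has not been reached and the
  left derivative is \<open>0\<close>.\<close>

lemma right_boundary_bound:
  assumes \<alpha>: "1 < \<alpha>" "\<alpha> < 2" and p: "p \<ge> 2"
  shows "\<exists>h C N. C \<ge> 0 \<and> (\<forall>w\<in>{0..real i}. \<bar>h w\<bar> \<le> C) \<and> (\<forall>n\<ge>N. n > 0 \<longrightarrow>
     has_rl \<alpha> (\<lambda>y. sspline p p i (real n * (1 - y))) (\<lambda>t. real n powr \<alpha> * h (real n * (1 - t))) {..<1})"
proof -
  have "rspl (sspline p p i)" using lspl_rspl_sspline[of p p i] p by auto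
  from rspl_has_rl[OF \<alpha> this] obtain h N where h: "continuous_on UNIV h" "\<And>n. n \<ge> N \<Longrightarrow> n > 0 \<Longrightarrow>
     has_rl \<alpha> (\<lambda>y. sspline p p i (real n * (1 - y))) (\<lambda>t. real n powr \<alpha> * h (real n * (1 - t))) {..<1}" by blast
  obtain M where "M > 0" "\<And>y. y \<in> {0..real i} \<Longrightarrow> \<bar>h y\<bar> \<le> M"
    using compact_imp_bounded[OF compact_continuous_image[OF continuous_on_subset[OF h(1)] compact_Icc, of 0 "real i"]] unfolding bounded_pos by auto
  thus ?thesis using h(2) by (intro exI[of _ h] exI[of _ M] exI[of _ N]) auto
qed

lemma finite_knots: "finite (knot p n ` UNIV)"
proof -
  have "knot p n ` UNIV \<subseteq> knot p n ` {..p + n + 2}"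
  proof safe
    fix j
    have "knot p n j = knot p n (min j (p + n + 2))" by (auto simp: knot_def min_def)
    thus "knot p n j \<in> knot p n ` {..p + n + 2}" by (metis atMost_iff image_eqI min.cobounded2)
  qed
  thus ?thesis by (rule finite_subset) simp
qed

text \<open>The three cases are splines touching the left boundary, interior splines, and splines touching the right boundary.\<close>
lemma bspline_rl_bound:
  assumes \<alpha>: "1 < \<alpha>" "\<alpha> < 2" and p: "p \<ge> 2"
  shows "\<exists>C N. C \<ge> 0 \<and> (\<forall>n\<ge>N. n > 0 \<longrightarrow> (\<forall>i. 2 \<le> i \<and> i \<le> n + p - 1 \<longrightarrow> 
    (\<exists>h. has_rl \<alpha> (bspline p n p i) h {0<..<1} \<and>
      (\<forall>x. 1 / real p \<le> real n * x \<longrightarrow> real n * x \<le> real n - 1 / real p \<longrightarrow>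
          \<bar>h x\<bar> \<le> real n powr \<alpha> * (C * (1 + \<bar>real n * x - real i\<bar>) powr (- (1 + \<alpha>)))) \<and>
      (p + 1 \<le> i \<longrightarrow> i \<le> n \<longrightarrow> h = (\<lambda>x. real n powr \<alpha> * card_rl \<alpha> p (real n * x - real (i - (p + 1))))))))"
proof -
  let ?P = "\<lambda>C x. C * (1 + \<bar>x\<bar>) powr (- (1 + \<alpha>))"
  obtain hL CL where L: "\<And>i. CL i \<ge> 0" "\<And>i. has_rl \<alpha> (sspline p p i) (hL i) {0<..}"
     "\<And>i z. z \<ge> 1 / real p \<Longrightarrow> \<bar>hL i z\<bar> \<le> ?P (CL i) (z - real i)"
    using left_boundary_bound[OF \<alpha> p] by metis
  obtain hR CR NR where R: "\<And>i. CR i \<ge> 0" "\<And>i w. w \<in> {0..real i} \<Longrightarrow> \<bar>hR i w\<bar> \<le> CR i" 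
     "\<And>i n. n \<ge> NR i \<Longrightarrow> n > 0 \<Longrightarrow>
     has_rl \<alpha> (\<lambda>y. sspline p p i (real n * (1 - y))) (\<lambda>t. real n powr \<alpha> * hR i (real n * (1 - t))) {..<1}"
    using right_boundary_bound[OF \<alpha> p] by metis
  obtain CI where I: "CI \<ge> 0" "\<And>x. \<bar>card_rl \<alpha> p x\<bar> \<le> ?P CI (x - (real p + 1))"
    using card_rl_bound[OF \<alpha> p] by blast
  \<comment> \<open>For a spline at the right end and a point within reach of its support
    \<open>|n * x - i| \<le> p + 1\<close>; the factor \<open>r\<close> then converts plain
    boundedness into the required form of decay.\<close>
  define r where "r = (1 + (real p + 1)) powr (1 + \<alpha>)"
  \<comment> \<open>Finitely many left shapes, one interior shape and finitely many right shapes: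
    their constants are added, so \<open>C\<close> depends neither on \<open>n\<close> nor on
    \<open>i\<close>.\<close>
  define C where "C = (\<Sum>i\<le>p. CL i) + CI + (\<Sum>i\<le>p. CR i) * r"
  define N where "N = p + (\<Sum>i\<le>p. NR i)"
  have r0: "r \<ge> 0" by (simp add: r_def)
  have CL: "CL i \<le> C" if "i \<le> p" for i
    unfolding C_def using member_le_sum[of i "{..p}" CL] that L(1) I(1) R(1) r0
    by (smt (verit) atMost_iff finite_atMost mult_nonneg_nonneg sum_nonneg)
  have CR: "CR i * r \<le> C" if "i \<le> p" for i
  proof -
    have "CR i * r \<le> (\<Sum>i\<le>p. CR i) * r" using member_le_sum[of i "{..p}" CR] that R(1) r0 by (intro mult_right_mono) auto
    thus ?thesis unfolding C_def using sum_nonneg[of "{..p}" CL] L(1) I(1) by auto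
  qed
  have CI: "CI \<le> C" unfolding C_def using L(1) R(1) r0 by (simp add: sum_nonneg)
  have C0: "C \<ge> 0" using CI I(1) by linarith
  have NR: "NR i \<le> N" if "i \<le> p" for i
    unfolding N_def using member_le_sum[of i "{..p}" NR] that by auto
  have mono: "?P c x \<le> ?P C x" if "c \<le> C" for c x using that by (intro mult_right_mono) auto
  show ?thesis
  proof (intro exI[of _ C] exI[of _ N] conjI allI impI C0)
    fix n i assume n: "N \<le> n" "0 < n" and i: "2 \<le> i \<and> i \<le> n + p - 1"
    have np: "p \<le> n" using n(1) by (simp add: N_def)
    let ?B = "bspline p n p i"
    show "\<exists>h. has_rl \<alpha> ?B h {0<..<1} \<and>
      (\<forall>x. 1 / real p \<le> real n * x \<longrightarrow> real n * x \<le> real n - 1 / real p \<longrightarrow>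
          \<bar>h x\<bar> \<le> real n powr \<alpha> * ?P C (real n * x - real i)) \<and>
      (p + 1 \<le> i \<longrightarrow> i \<le> n \<longrightarrow> h = (\<lambda>x. real n powr \<alpha> * card_rl \<alpha> p (real n * x - real (i - (p + 1)))))"
    proof -
      consider "i \<le> p" | "p + 1 \<le> i" "i \<le> n" | "n + 1 \<le> i" by linarith
      thus ?thesis
      proof cases
        case 1
        have B: "?B = (\<lambda>x. sspline p p i (real n * x))" using bspline_conv_sspline[of n i p p] n np 1 by auto
        have "has_rl \<alpha> ?B (\<lambda>t. real n powr \<alpha> * hL i (real n * t)) {0<..<1}"
          unfolding B by (rule has_rl_subset[OF has_rl_scale[OF L(2)]]) (use n in auto)
        moreover have "\<bar>real n powr \<alpha> * hL i (real n * x)\<bar> \<le> real n powr \<alpha> * ?P C (real n * x - real i)"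
          if "1 / real p \<le> real n * x" for x
          using order_trans[OF L(3)[OF that, of i] mono[OF CL[OF 1]]] by (simp add: abs_mult mult_left_mono)
        ultimately show ?thesis using 1 by (intro exI[of _ "\<lambda>t. real n powr \<alpha> * hL i (real n * t)"]) auto
      next
        case 2
        let ?a = "real (i - (p + 1))"
        have B: "?B = (\<lambda>x. card_spline p (real n * x - ?a))"
          using bspline_conv_sspline[of n i p p] sspline_interior[OF 2(1)] n 2 by auto
        have "has_rl \<alpha> ?B (\<lambda>t. real n powr \<alpha> * card_rl \<alpha> p (real n * t - ?a)) {0<..<1}"
          unfolding B by (rule has_rl_subset[OF has_rl_scale[OF card_spline_has_rl[OF \<alpha> p]]]) (use n in auto)
        moreover have "\<bar>real n powr \<alpha> * card_rl \<alpha> p (real n * x - ?a)\<bar> \<le> real n powr \<alpha> * ?P C (real n * x - real i)" for x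
        proof -
          have "real n * x - ?a - (real p + 1) = real n * x - real i" using 2 by (simp add: of_nat_diff)
          thus ?thesis using order_trans[OF I(2)[of "real n * x - ?a"] mono[OF CI]] by (simp add: abs_mult mult_left_mono)
        qed
        ultimately show ?thesis by (intro exI[of _ "\<lambda>t. real n powr \<alpha> * card_rl \<alpha> p (real n * t - ?a)"]) auto
      next
        case 3
        \<comment> \<open>The index of the reflected spline. It is at most \<open>p\<close>, so the
          reflected spline touches the left end, and \<open>p \<le> n\<close> makes
          \<open>bspline_conv_sspline\<close> applicable.\<close>
        define k where "k = p + n + 1 - i"
        have k: "2 \<le> k" "k \<le> p" "i = p + n + 1 - k" "k \<le> n" using 3 i np by (auto simp: k_def)
        have ik: "real i = real p + real n + 1 - real k" using k by (simp add: of_nat_diff)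
        let ?h = "\<lambda>t. real n powr \<alpha> * hR k (real n * (1 - t))"
        have rl: "has_rl \<alpha> (\<lambda>y. sspline p p k (real n * (1 - y))) ?h {..<1}"
          using R(3) NR[OF k(2)] n by auto
        have B: "?B y = sspline p p k (real n * (1 - y))" if "y \<notin> knot p n ` UNIV" for y
          using bspline_reflect[of n k p p y] bspline_conv_sspline[of n k p p "1 - y"] n k that by simp
        have "has_rl \<alpha> ?B ?h {0<..<1}"
          by (rule has_rl_cong[OF has_rl_subset[OF rl] finite_knots]) (use B in auto)
        moreover have "\<bar>?h x\<bar> \<le> real n powr \<alpha> * ?P C (real n * x - real i)"
          if x: "1 / real p \<le> real n * x" "real n * x \<le> real n - 1 / real p" for x
        proof (cases "real n * (1 - x) > real k")
          case True
          have p0: "1 / real p > 0" using p by simp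
          have "real n * x < real n" using x p0 by linarith
          hence x1: "x < 1" using n by simp
          have "?h x = 0"
          proof (rule has_rl_zero[OF rl, of x "1 - real k / real n"])
            show "x < 1 - real k / real n" using True n by (simp add: field_simps)
            fix y assume "y < 1 - real k / real n"
            hence "real n * (1 - y) \<ge> real k" using n by (simp add: field_simps)
            thus "sspline p p k (real n * (1 - y)) = 0" by (intro sspline_eq_0) simp
          qed (use x1 \<alpha> in auto)
          show ?thesis unfolding \<open>?h x = 0\<close> using C0 by simp
        next
          case False
          have p0: "1 / real p > 0" using p by simp
          have w: "0 \<le> real n * (1 - x)" "real n * (1 - x) \<le> real k"
            using False x p0 right_diff_distrib[of "real n" 1 x] by linarith+
          have kp: "real k \<le> real p" using k by simp
          have "1 \<le> r * (1 + \<bar>real n * x - real i\<bar>) powr (- (1 + \<alpha>))"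
            using powr_shift_bound[of 0 "real n * x - real i" "real p + 1" "1 + \<alpha>"] w kp \<alpha> 
            by (simp add: r_def ik algebra_simps)
          hence "CR k * 1 \<le> CR k * (r * (1 + \<bar>real n * x - real i\<bar>) powr (- (1 + \<alpha>)))"
            using R(1) by (intro mult_left_mono)
          also have "\<dots> \<le> ?P C (real n * x - real i)" using mono[OF CR[OF k(2)]] by (simp add: mult.assoc)
          finally have "\<bar>hR k (real n * (1 - x))\<bar> \<le> ?P C (real n * x - real i)"
            using R(2)[of "real n * (1 - x)" k] w by auto
          thus ?thesis by (simp add: abs_mult mult_left_mono)
        qed
        ultimately show ?thesis using 3 by (intro exI[of _ ?h]) auto
      qed
    qed
  qed
qed

section \<open>The Greville abscissae in the variable \<open>n x\<close>\<close>

lemma greville_scaled: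
  assumes n: "n > 0" and p: "p > 0"
  shows "real n * greville p n i = (\<Sum>j = i + 1..i + p. real (min (j - (p + 1)) n)) / real p"
proof -
  have "real n * knot p n j = real (min (j - (p + 1)) n)" for j
    using n by (auto simp: knot_def min_def of_nat_diff)
  thus ?thesis by (simp add: greville_def sum_distrib_left)
qed

text \<open>Among the \<open>p\<close> averaged scaled knots the last is at least \<open>1\<close>
  and the first at most \<open>n - 1\<close>; a single such knot moves the average away from the end
  by \<open>1 / p\<close>. The third bound is deliberately coarse.\<close>

lemma greville_bounds:
  assumes n: "n > 0" and p: "p > 0" and i: "2 \<le> i" "i \<le> n + p - 1"
  shows "1 / real p \<le> real n * greville p n i" "real n * greville p n i \<le> real n - 1 / real p"
    "\<bar>real n * greville p n i - real i\<bar> \<le> 3 * real p + 2"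
proof -
  let ?k = "\<lambda>j. real (min (j - (p + 1)) n)"
  have "1 \<le> ?k (i + p)" using i n by auto
  also have "\<dots> \<le> (\<Sum>j = i + 1..i + p. ?k j)" by (rule member_le_sum) (use p in auto)
  finally have "1 / real p \<le> (\<Sum>j = i + 1..i + p. ?k j) / real p" by (intro divide_right_mono) auto
  thus low: "1 / real p \<le> real n * greville p n i" using greville_scaled[OF n p] by simp
  have "1 \<le> real n - ?k (i + 1)" using i n by auto
  also have "\<dots> \<le> (\<Sum>j = i + 1..i + p. real n - ?k j)"
    by (rule member_le_sum[of "i + 1" _ "\<lambda>j. real n - ?k j"]) (use p in auto)
  also have "\<dots> = real p * real n - (\<Sum>j = i + 1..i + p. ?k j)" by (simp add: sum_subtractf)
  finally have "(\<Sum>j = i + 1..i + p. ?k j) \<le> real p * real n - 1" by simp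
  hence "(\<Sum>j = i + 1..i + p. ?k j) / real p \<le> (real p * real n - 1) / real p" by (intro divide_right_mono) auto
  thus "real n * greville p n i \<le> real n - 1 / real p" 
    unfolding greville_scaled[OF n p] using p by (simp add: diff_divide_distrib)
  have "\<bar>(\<Sum>j = i + 1..i + p. ?k j) - real p * real i\<bar> = \<bar>\<Sum>j = i + 1..i + p. ?k j - real i\<bar>"
    by (simp add: sum_subtractf)
  also have "\<dots> \<le> (\<Sum>j = i + 1..i + p. \<bar>?k j - real i\<bar>)" by (rule sum_abs)
  also have "\<dots> \<le> (\<Sum>j = i + 1..i + p. 3 * real p + 2)"
  proof (rule sum_mono)
    fix j assume "j \<in> {i + 1..i + p}"
    hence "min (j - (p + 1)) n \<le> i + (3 * p + 2)" "i \<le> min (j - (p + 1)) n + (3 * p + 2)" using i by auto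
    hence "?k j \<le> real (i + (3 * p + 2))" "real i \<le> real (min (j - (p + 1)) n + (3 * p + 2))" unfolding of_nat_le_iff by blast+
    thus "\<bar>?k j - real i\<bar> \<le> 3 * real p + 2" unfolding of_nat_add of_nat_mult by (simp add: abs_le_iff)
  qed
  also have "\<dots> = real p * (3 * real p + 2)" by simp
  finally have "\<bar>(\<Sum>j = i + 1..i + p. ?k j) - real p * real i\<bar> / real p \<le> 3 * real p + 2"
    using p by (simp add: divide_le_eq mult.commute)
  moreover have "\<bar>(\<Sum>j = i + 1..i + p. ?k j) - real p * real i\<bar> / real p = \<bar>real n * greville p n i - real i\<bar>"
  proof -
    have "real n * greville p n i - real i = ((\<Sum>j = i + 1..i + p. ?k j) - real p * real i) / real p"
      unfolding greville_scaled[OF n p] using p by (simp add: diff_divide_distrib)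
    thus ?thesis by (simp only: abs_divide abs_of_nat)
  qed
  ultimately show "\<bar>real n * greville p n i - real i\<bar> \<le> 3 * real p + 2" by simp
qed

text \<open>In this range the clipping of the knots to \<open>[0, n]\<close> has no effect, and the
  average is that of \<open>p\<close> consecutive integers.\<close>

lemma greville_interior:
  assumes n: "n > 0" and p: "p > 0" and i: "p \<le> i" "i \<le> n + 1"
  shows "real n * greville p n i = real i - (real p + 1) / 2"
proof -
  have "(\<Sum>j = i + 1..i + p. real (min (j - (p + 1)) n)) = (\<Sum>j = i + 1..i + p. real j - (real p + 1))"
    by (intro sum.cong refl) (use i in \<open>auto simp: min_def of_nat_diff\<close>)
  also have "\<dots> = (\<Sum>m = 1..p. (real i - (real p + 1)) + real m)"
    by (rule sum.reindex_bij_witness[of _ "\<lambda>m. m + i" "\<lambda>j. j - i"]) auto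
  also have "\<dots> = real p * (real i - (real p + 1)) + (\<Sum>m = 1..p. real m)" by (simp add: sum.distrib)
  also have "(\<Sum>m = 1..p. real m) = real p * (real p + 1) / 2"
    using double_gauss_sum_from_Suc_0[of p, where 'a=real] by simp
  also have "real p * (real i - (real p + 1)) + real p * (real p + 1) / 2 = real p * (real i - (real p + 1) / 2)"
    by (simp add: field_simps)
  finally have "(\<Sum>j = i + 1..i + p. real (min (j - (p + 1)) n)) = real p * (real i - (real p + 1) / 2)" .
  thus ?thesis unfolding greville_scaled[OF n p] using p by simp
qed


text \<open>The right derivative of a spline at \<open>x\<close> is the left derivative of the
  reflected spline at \<open>1 - x\<close>, so \<open>bspline_rl_bound\<close> covers both summands.
  Their arguments differ from \<open>i - j\<close> and \<open>j - i\<close> by bounded amounts,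
  which \<open>powr_shift_bound\<close> absorbs.\<close>

lemma colloc_matrix_entries:
  assumes \<alpha>: "1 < \<alpha>" "\<alpha> < 2" and p: "p \<ge> 2"
  shows "\<exists>G N. G \<ge> 0 \<and> (\<forall>m::int. \<bar>riesz_card \<alpha> p (of_int m)\<bar> \<le> G * (1 + \<bar>of_int m\<bar>) powr (- (1 + \<alpha>))) \<and>
    (\<forall>n\<ge>N. \<forall>i<n + p - 2. \<forall>j<n + p - 2.
       \<bar>real n powr (- \<alpha>) * colloc_matrix p \<alpha> n $$ (i, j)\<bar> \<le> G * (1 + \<bar>of_int (int i - int j)\<bar>) powr (- (1 + \<alpha>)) \<and>
       (p \<le> i \<longrightarrow> i + p < n + p - 2 \<longrightarrow> p \<le> j \<longrightarrow> j + p < n + p - 2 \<longrightarrow>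
         real n powr (- \<alpha>) * colloc_matrix p \<alpha> n $$ (i, j) = riesz_card \<alpha> p (of_int (int i - int j))))"
proof -
  let ?P = "\<lambda>x. (1 + \<bar>x\<bar>) powr (- (1 + \<alpha>))"
  obtain C N where C: "C \<ge> 0" and CN: "\<And>n i. n \<ge> N \<Longrightarrow> n > 0 \<Longrightarrow> 2 \<le> i \<Longrightarrow> i \<le> n + p - 1 \<Longrightarrow>
    (\<exists>h. has_rl \<alpha> (bspline p n p i) h {0<..<1} \<and>
      (\<forall>x. 1 / real p \<le> real n * x \<longrightarrow> real n * x \<le> real n - 1 / real p \<longrightarrow>
          \<bar>h x\<bar> \<le> real n powr \<alpha> * (C * ?P (real n * x - real i))) \<and>
      (p + 1 \<le> i \<longrightarrow> i \<le> n \<longrightarrow> h = (\<lambda>x. real n powr \<alpha> * card_rl \<alpha> p (real n * x - real (i - (p + 1))))))"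
    using bspline_rl_bound[OF \<alpha> p] by metis
  obtain CI where I: "CI \<ge> 0" "\<And>x. \<bar>card_rl \<alpha> p x\<bar> \<le> CI * ?P (x - (real p + 1))"
    using card_rl_bound[OF \<alpha> p] by blast
  define c0 where "c0 = 1 / (2 * cos (pi * \<alpha> / 2))"
  \<comment> \<open>The displacement \<open>3 * p + 2\<close> of a collocation point from its index,
    plus \<open>p + 1\<close> from the reflection of the spline.\<close>
  define e where "e = 4 * real p + 3"
  define G where "G = \<bar>c0\<bar> * (2 * ((C + CI) * (1 + e) powr (1 + \<alpha>)))"
  have e0: "e \<ge> 0" by (simp add: e_def)
  have G0: "G \<ge> 0" using C I(1) by (simp add: G_def)
  have comb: "\<bar>c0 * (u + v)\<bar> \<le> G * ?P y"
    if "\<bar>u\<bar> \<le> c * ?P x" "\<bar>v\<bar> \<le> c * ?P x'" "\<bar>x - y\<bar> \<le> e" "\<bar>x' + y\<bar> \<le> e" "0 \<le> c" "c \<le> C + CI" for u v x x' y c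
  proof -
    have a: "w \<le> (C + CI) * (1 + e) powr (1 + \<alpha>) * ?P y" if "w \<le> c * ?P z" "\<bar>z - y\<bar> \<le> e \<or> \<bar>z - (- y)\<bar> \<le> e" for w z
    proof -
      have "?P z \<le> (1 + e) powr (1 + \<alpha>) * ?P y"
        using that(2) powr_shift_bound[of z y e "1 + \<alpha>"] powr_shift_bound[of z "- y" e "1 + \<alpha>"] \<alpha> by auto
      hence "c * ?P z \<le> (C + CI) * ((1 + e) powr (1 + \<alpha>) * ?P y)"
        using \<open>0 \<le> c\<close> \<open>c \<le> C + CI\<close> by (intro mult_mono) auto
      thus ?thesis using that(1) by (simp add: mult.assoc)
    qed
    have "\<bar>u + v\<bar> \<le> 2 * ((C + CI) * (1 + e) powr (1 + \<alpha>) * ?P y)"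
      using a[OF that(1)] a[OF that(2)] that(3,4) by (smt (verit))
    hence "\<bar>c0\<bar> * \<bar>u + v\<bar> \<le> \<bar>c0\<bar> * (2 * ((C + CI) * (1 + e) powr (1 + \<alpha>) * ?P y))" by (intro mult_left_mono) auto
    thus ?thesis by (simp add: G_def abs_mult mult_ac)
  qed
  have "\<bar>riesz_card \<alpha> p (of_int m)\<bar> \<le> G * ?P (of_int m)" for m :: int
    unfolding riesz_card_def c0_def[symmetric]
    by (rule comb[OF I(2) I(2)]) (use C I(1) in \<open>auto simp: e_def abs_le_iff field_simps\<close>)
  moreover have "\<bar>real n powr (- \<alpha>) * colloc_matrix p \<alpha> n $$ (i, j)\<bar> \<le> G * ?P (of_int (int i - int j)) \<and>
       (p \<le> i \<longrightarrow> i + p < n + p - 2 \<longrightarrow> p \<le> j \<longrightarrow> j + p < n + p - 2 \<longrightarrow>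
         real n powr (- \<alpha>) * colloc_matrix p \<alpha> n $$ (i, j) = riesz_card \<alpha> p (of_int (int i - int j)))"
    if n: "n \<ge> max N 1" and i: "i < n + p - 2" and j: "j < n + p - 2" for n i j
  proof -
    have n0: "n > 0" "n \<ge> N" using n by auto
    have p0: "p > 0" using p by simp
    \<comment> \<open>The spline belonging to column \<open>j\<close>, in the indexing of
      \<open>bspline\<close>, and its mirror image \<open>k'\<close>. Both lie in
      \<open>2..n + p - 1\<close>.\<close>
    define k where "k = j + 2"
    define k' where "k' = p + n + 1 - k"
    define x where "x = greville p n (i + 2)"
    have k: "2 \<le> k" "k \<le> n + p - 1" "2 \<le> k'" "k' \<le> n + p - 1" "real k' = real p + real n + 1 - real k"
      using j by (auto simp: k_def k'_def of_nat_diff)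
    have i2: "2 \<le> i + 2" "i + 2 \<le> n + p - 1" using i by auto
    note gb = greville_bounds[OF n0(1) p0 i2, folded x_def]
    have pp: "1 / real p > 0" using p by simp
    have x01: "0 < x" "x < 1"
    proof -
      have "0 < real n * x" "real n * x < real n * 1" using gb pp by linarith+
      thus "0 < x" "x < 1" using n0 by (auto simp: zero_less_mult_iff)
    qed
    have gb': "1 / real p \<le> real n * (1 - x)" "real n * (1 - x) \<le> real n - 1 / real p"
      using gb by (simp_all add: algebra_simps)
    obtain h where h: "has_rl \<alpha> (bspline p n p k) h {0<..<1}"
       "\<bar>h x\<bar> \<le> real n powr \<alpha> * (C * ?P (real n * x - real k))"
       "p + 1 \<le> k \<longrightarrow> k \<le> n \<longrightarrow> h = (\<lambda>x. real n powr \<alpha> * card_rl \<alpha> p (real n * x - real (k - (p + 1))))"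
      using CN[OF n0(2,1) k(1,2)] gb by blast
    obtain h' where h': "has_rl \<alpha> (bspline p n p k') h' {0<..<1}"
       "\<bar>h' (1 - x)\<bar> \<le> real n powr \<alpha> * (C * ?P (real n * (1 - x) - real k'))"
       "p + 1 \<le> k' \<longrightarrow> k' \<le> n \<longrightarrow> h' = (\<lambda>x. real n powr \<alpha> * card_rl \<alpha> p (real n * x - real (k' - (p + 1))))"
      using CN[OF n0(2,1) k(3,4)] gb' by blast
    have L: "RL_left \<alpha> (bspline p n p k) x = h x"
      by (rule has_rl_imp_RL_left[OF h(1)]) (use x01 \<alpha> in auto)
    have "has_rl \<alpha> (\<lambda>y. bspline p n p k (1 - y)) h' {0<..<1}"
    proof (rule has_rl_cong[OF h'(1) finite_knots])
      fix y assume "y \<notin> knot p n ` UNIV"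
      moreover have "k + p \<le> 2 * p + n + 1" "2 * p + n + 1 - p - k = k'" using k by (auto simp: k'_def)
      ultimately show "bspline p n p k (1 - y) = bspline p n p k' y" using bspline_reflect[OF n0(1)] by metis
    qed simp
    from has_rl_imp_RL_right[OF this] have R: "RL_right \<alpha> (bspline p n p k) x = h' (1 - x)"
      using x01 \<alpha> by simp
    have np: "real n powr (- \<alpha>) * real n powr \<alpha> = 1" using n0 by (simp flip: powr_add)
    have entry: "real n powr (- \<alpha>) * colloc_matrix p \<alpha> n $$ (i, j) = c0 * (real n powr (- \<alpha>) * h x + real n powr (- \<alpha>) * h' (1 - x))"
      using i j L R by (simp add: colloc_matrix_def c0_def k_def x_def algebra_simps)
    have scale: "\<bar>real n powr (- \<alpha>) * u\<bar> \<le> w" if "\<bar>u\<bar> \<le> real n powr \<alpha> * w" for u w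
    proof -
      have "real n powr (- \<alpha>) * \<bar>u\<bar> \<le> real n powr (- \<alpha>) * (real n powr \<alpha> * w)" using that by (intro mult_left_mono) auto
      also have "\<dots> = w" by (simp only: mult.assoc[symmetric] np mult_1_left)
      finally show ?thesis by (simp add: abs_mult)
    qed
    have ij: "of_int (int i - int j) = real (i + 2) - real k" by (simp add: k_def)
    have "\<bar>real n powr (- \<alpha>) * colloc_matrix p \<alpha> n $$ (i, j)\<bar> \<le> G * ?P (of_int (int i - int j))"
      unfolding entry
    proof (rule comb[OF scale[OF h(2)] scale[OF h'(2)]])
      have "real n * x - real k - of_int (int i - int j) = real n * x - real (i + 2)" unfolding ij by simp
      thus "\<bar>real n * x - real k - of_int (int i - int j)\<bar> \<le> e" using gb(3) p unfolding e_def by linarith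
      have "real n * (1 - x) - real k' + of_int (int i - int j) = - (real n * x - real (i + 2)) - (real p + 1)"
        unfolding ij k(5) by (simp add: algebra_simps)
      thus "\<bar>real n * (1 - x) - real k' + of_int (int i - int j)\<bar> \<le> e"
        using gb(3) unfolding e_def by linarith
    qed (use C I(1) in auto)
    moreover have "real n powr (- \<alpha>) * colloc_matrix p \<alpha> n $$ (i, j) = riesz_card \<alpha> p (of_int (int i - int j))"
      if int: "p \<le> i" "i + p < n + p - 2" "p \<le> j" "j + p < n + p - 2"
    proof -
      have xi: "real n * x = real (i + 2) - (real p + 1) / 2"
        unfolding x_def by (rule greville_interior[OF n0(1) p0]) (use int in auto)
      have kk: "p + 1 \<le> k" "k \<le> n" "p + 1 \<le> k'" "k' \<le> n" using int by (auto simp: k_def k'_def)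
      have "real n powr (- \<alpha>) * h x = card_rl \<alpha> p (real n * x - real (k - (p + 1)))"
        using h(3) kk np by (simp add: mult.assoc[symmetric])
      also have "real n * x - real (k - (p + 1)) = of_int (int i - int j) + (real p + 1) / 2"
        unfolding xi ij using kk by (simp add: of_nat_diff field_simps)
      finally have 1: "real n powr (- \<alpha>) * h x = card_rl \<alpha> p (of_int (int i - int j) + (real p + 1) / 2)" .
      have "real n powr (- \<alpha>) * h' (1 - x) = card_rl \<alpha> p (real n * (1 - x) - real (k' - (p + 1)))"
        using h'(3) kk np by (simp add: mult.assoc[symmetric])
      also have "real n * (1 - x) - real (k' - (p + 1)) = - of_int (int i - int j) + (real p + 1) / 2"
      proof -
        have "real n * (1 - x) = real n - real n * x" by (simp add: algebra_simps)
        thus ?thesis unfolding xi ij using kk k(5) by (simp add: of_nat_diff field_simps)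
      qed
      finally have 2: "real n powr (- \<alpha>) * h' (1 - x) = card_rl \<alpha> p (- of_int (int i - int j) + (real p + 1) / 2)" .
      show ?thesis unfolding entry 1 2 riesz_card_def c0_def ..
    qed
    ultimately show ?thesis by blast
  qed
  ultimately show ?thesis using G0 by (intro exI[of _ G] exI[of _ "max N 1"]) blast
qed

theorem theorem6p5:
  fixes \<alpha> :: real and p :: nat
  assumes "1 < \<alpha>" and "\<alpha> < 2" and "p \<ge> 2"
  shows "spectral_distr
           (\<lambda>n. map_mat complex_of_real (real n powr (- \<alpha>) \<cdot>\<^sub>m colloc_matrix p \<alpha> n))
           (\<lambda>\<theta>. complex_of_real (symbol_f p \<alpha> \<theta>)) {-pi..pi}"
proof -
  note \<alpha> = assms(1,2) and p = assms(3)
  define A where "A = (\<lambda>n. map_mat complex_of_real (real n powr (- \<alpha>) \<cdot>\<^sub>m colloc_matrix p \<alpha> n))"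
  have dim: "dim_row (A n) = n + p - 2" "dim_col (A n) = n + p - 2" for n by (simp_all add: A_def colloc_matrix_def)
  have A_entry: "A n $$ (i, j) = complex_of_real (real n powr (- \<alpha>) * colloc_matrix p \<alpha> n $$ (i, j))" if "i < n + p - 2" "j < n + p - 2" for n i j
    using that by (simp add: A_def colloc_matrix_def)
  obtain G N where G: "G \<ge> 0" "\<And>m::int. \<bar>riesz_card \<alpha> p (of_int m)\<bar> \<le> G * (1 + \<bar>of_int m\<bar>) powr (- (1 + \<alpha>))"
    and N: "\<And>n i j. n \<ge> N \<Longrightarrow> i < n + p - 2 \<Longrightarrow> j < n + p - 2 \<Longrightarrow>
       \<bar>real n powr (- \<alpha>) * colloc_matrix p \<alpha> n $$ (i, j)\<bar> \<le> G * (1 + \<bar>of_int (int i - int j)\<bar>) powr (- (1 + \<alpha>))"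
    "\<And>n i j. n \<ge> N \<Longrightarrow> i < n + p - 2 \<Longrightarrow> j < n + p - 2 \<Longrightarrow> p \<le> i \<Longrightarrow> i + p < n + p - 2 \<Longrightarrow> p \<le> j \<Longrightarrow> j + p < n + p - 2 \<Longrightarrow>
         real n powr (- \<alpha>) * colloc_matrix p \<alpha> n $$ (i, j) = riesz_card \<alpha> p (of_int (int i - int j))"
    using colloc_matrix_entries[OF \<alpha> p] by metis
  define g where "g = (\<lambda>m::int. G * (1 + \<bar>of_int m\<bar>) powr (- (1 + \<alpha>)))"
  define t where "t = (\<lambda>m::int. complex_of_real (riesz_card \<alpha> p (of_int m)))"
  \<comment> \<open>The estimates hold from \<open>N\<close> on, while \<open>near_toeplitz\<close>
    demands them for every index. The sequence is therefore shifted by \<open>N\<close>, and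
    \<open>LIMSEQ_offset\<close> undoes the shift in the limit.\<close>
  define d where "d = (\<lambda>n. n + N + p - 2)"
  have nt: "near_toeplitz d (\<lambda>n. A (n + N)) g t"
    unfolding near_toeplitz_def
  proof (intro conjI allI impI)
    show "A (n + N) \<in> carrier_mat (d n) (d n)" for n using dim[of "n + N"] by (auto simp: d_def)
    show "g summable_on UNIV" unfolding g_def
      by (intro summable_on_cmult_right summable_int_powr) (use \<alpha> in auto)
    show "cmod (t m) \<le> g m" for m using G(2)[of m] by (simp add: t_def g_def)
    show "cmod (A (n + N) $$ (i, j)) \<le> g (int i - int j)" if "i < d n" "j < d n" for n i j
      using N(1)[of "n + N" i j] that A_entry[of i "n + N" j] by (simp add: d_def g_def norm_mult)
    fix \<epsilon> :: real assume "\<epsilon> > 0"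
    show "\<exists>M. \<forall>n i j. M \<le> i \<longrightarrow> i + M < d n \<longrightarrow> M \<le> j \<longrightarrow> j + M < d n \<longrightarrow> cmod (A (n + N) $$ (i, j) - t (int i - int j)) \<le> \<epsilon>"
    proof (intro exI[of _ p] allI impI)
      fix n i j assume ij: "p \<le> i" "i + p < d n" "p \<le> j" "j + p < d n"
      hence "A (n + N) $$ (i, j) = t (int i - int j)"
        using N(2)[of "n + N" i j] A_entry[of i "n + N" j] unfolding t_def d_def by (simp only: le_add2) 
      thus "cmod (A (n + N) $$ (i, j) - t (int i - int j)) \<le> \<epsilon>" using \<open>\<epsilon> > 0\<close> by simp
    qed
  qed
  have herm: "t (- m) = cnj (t m)" for m by (simp add: t_def riesz_card_def add.commute)
  have d_lim: "filterlim d at_top sequentially"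
    unfolding filterlim_at_top eventually_sequentially
  proof
    fix Z
    show "\<exists>N. \<forall>n\<ge>N. Z \<le> d n" unfolding d_def by (intro exI[of _ Z] allI impI) (use p in linarith)
  qed
  have fourier_t: "fourier t \<theta> = of_real (symbol_f p \<alpha> \<theta>)" if "\<theta> \<in> {-pi..pi}" for \<theta>
    using fourier_riesz_card[OF \<alpha> p that] near_toeplitzD(6)[OF nt] unfolding t_def by blast
  have cont: "continuous_on {-pi..pi} (\<lambda>\<theta>. complex_of_real (symbol_f p \<alpha> \<theta>))"
    by (intro continuous_intros symbol_f_continuous[OF \<alpha> p])
  have lim: "(\<lambda>n. (\<Sum>z\<in>#eigvals (A n). F z) / of_nat (dim_row (A n)))
      \<longlonglongrightarrow> (LINT \<theta>:{-pi..pi}|lebesgue. F (of_real (symbol_f p \<alpha> \<theta>))) / complex_of_real (measure lebesgue {-pi..pi})"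
    if F: "continuous_on UNIV F" for F :: "complex \<Rightarrow> complex"
  proof -
    have c: "continuous_on {-pi..pi} (\<lambda>\<theta>. F (of_real (symbol_f p \<alpha> \<theta>)))"
      by (rule continuous_on_compose2[OF F cont]) simp
    have "(LINT \<theta>:{-pi..pi}|lebesgue. F (of_real (symbol_f p \<alpha> \<theta>))) = integral {-pi..pi} (\<lambda>\<theta>. F (of_real (symbol_f p \<alpha> \<theta>)))"
      by (rule set_lebesgue_integral_eq_integral(2)[OF absolutely_integrable_continuous_real[OF c]])
    also have "\<dots> = integral {-pi..pi} (\<lambda>\<theta>. F (fourier t \<theta>))"
      by (rule Henstock_Kurzweil_Integration.integral_cong) (simp add: fourier_t)
    finally have "(LINT \<theta>:{-pi..pi}|lebesgue. F (of_real (symbol_f p \<alpha> \<theta>))) / complex_of_real (measure lebesgue {-pi..pi})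
        = integral {-pi..pi} (\<lambda>\<theta>. F (fourier t \<theta>)) / complex_of_real (2 * pi)" by simp
    hence "(\<lambda>n. (\<Sum>z\<in>#eigvals (A (n + N)). F z) / of_nat (dim_row (A (n + N))))
      \<longlonglongrightarrow> (LINT \<theta>:{-pi..pi}|lebesgue. F (of_real (symbol_f p \<alpha> \<theta>))) / complex_of_real (measure lebesgue {-pi..pi})"
      using near_toeplitz_eigenvalue_limit[OF nt herm d_lim F] dim(1) by (simp add: d_def)
    thus ?thesis by (rule LIMSEQ_offset)
  qed
  have "strict_mono (\<lambda>n. dim_row (A n))" using p by (intro strict_monoI) (simp add: dim)
  moreover have "(\<lambda>\<theta>. complex_of_real (symbol_f p \<alpha> \<theta>)) \<in> borel_measurable (restrict_space lebesgue {-pi..pi})"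
    by (rule continuous_imp_measurable_on_sets_lebesgue[OF cont]) simp
  ultimately show ?thesis
    unfolding spectral_distr_def A_def[symmetric] using lim by (auto simp: dim)
qed

end
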